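(* Assume full participation, $\mathcal S_t=[n]$ for every $t\ge0$. Let $u_0\in[g_0,\bar f]$, $\chi_0\ge\max_i\mathbb E\|e_{i,0}\|^2$, and let $(u_t,\chi_t)$ be generated by the exact optimized controller as in the context. Let $(\bar w,\bar\theta^{\,c})\in\Delta_n\times[\underline\theta,\bar\theta]^n$ be any deterministic feasible comparator pair, with components $\bar w_i,\bar\theta_i$ and coefficients $a_{\mathrm{cvx}},\beta_{\mathrm{cvx}},\gamma_{\mathrm{cvx}},\delta_{\mathrm{cvx}}$ defined from it in the context. Then for every $t\ge0$ $$u_{t+1}\le u_t-a_{\mathrm{cvx}}u_t^2+\beta_{\mathrm{cvx}}u_t+\gamma_{\mathrm{cvx}}\chi_t+\delta_{\mathrm{cvx}}.$$ Consequently, if $\bar\chi:=\max\bigl\{\chi_0,\frac{A_\chi+B_\chi\bar f}{1-C_\chi}\bigr\}$, then $\chi_t\le\bar\chi$ for all $t$, and therefore $$u_{t+1}\le u_t-a_{\mathrm{cvx}}u_t^2+\beta_{\mathrm{cvx}}u_t+d_{\mathrm{cvx}},\qquad d_{\mathrm{cvx}}:=\gamma_{\mathrm{cvx}}\bar\chi+\delta_{\mathrm{cvx}}.$$ If the positive root $$m_{\mathrm{cvx}}:=\frac{\beta_{\mathrm{cvx}}+\sqrt{\beta_{\mathrm{cvx}}^2+4a_{\mathrm{cvx}}d_{\mathrm{cvx}}}}{2a_{\mathrm{cvx}}}$$ also satisfies $2a_{\mathrm{cvx}}m_{\mathrm{cvx}}\le1+\beta_{\mathrm{cvx}}$, then for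 every $T\ge0$, $$g_T\le u_T\le m_{\mathrm{cvx}}+\frac1{((u_0-m_{\mathrm{cvx}})_+)^{-1}+a_{\mathrm{cvx}}T}.$$ In particular, $g_T\le u_T\le m_{\mathrm{cvx}}+\frac1{u_0^{-1}+a_{\mathrm{cvx}}T}$.
   Context: Problem: $F(x)=\frac1n\sum_{i=1}^nF_i(x)$, $F_i(x)=\frac1{m_i}\sum_{j=1}^{m_i}\phi_{ij}(x)$, each $\phi_{ij}:\mathbb R^d\to\mathbb R$ convex and $L$-smooth ($L$-Lipschitz gradient). There are $x_\star\in\arg\min F$ and $R>0$; $B(x_\star,R)=\{x:\|x-x_\star\|\le R\}$, $F_\star:=F(x_\star)$, $\bar f:=LR^2/2$. Node $i$ has horizon $H_i\ge1$ and minibatch size $b_i$ (fixed across rounds), and $v_i^2:=\sup_{x\in B(x_\star,R)}\frac1{m_i}\sum_j\|\nabla\phi_{ij}(x)-\nabla F_i(x)\|^2$. Algorithm (HEW-Local SGD, full participation). $c_0=\frac1n\sum_ic_{i,0}$. At round $t$, with weights $w_t\in\Delta_n:=\{w\in\mathbb R_+^n:\sum_iw_i=1\}$ and amplitudes $\theta_{i,t}\in[\underline\theta,\bar\theta]$, where $0<\underline\theta\le\bar\theta\le1$ are scalars: each $i\in[n]$ sets $\eta_{i,t}=\theta_{i,t}/(LH_i)$, $y_{i,t}^{(0)}=x_t$, and for $\ell=0,\dots,H_i-1$ draws a minibatch $\mathcal B_{i,t,\ell}\subseteq[m_i]$ of size $b_i$, computes $g_{i,t,\ell}=\frac1{b_i}\sum_{j\in\mathcal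 B_{i,t,\ell}}\nabla\phi_{ij}(y_{i,t}^{(\ell)})$ and sets $y_{i,t}^{(\ell+1)}=y_{i,t}^{(\ell)}-\eta_{i,t}(g_{i,t,\ell}-c_{i,t}+c_t)$; then $\Delta_{i,t}=y_{i,t}^{(H_i)}-x_t$, $c_{i,t+1}=c_{i,t}-c_t+\frac1{H_i\eta_{i,t}}(x_t-y_{i,t}^{(H_i)})$, $x_{t+1}=x_t+\sum_iw_{i,t}\Delta_{i,t}$, $c_{t+1}=c_t+\frac1n\sum_i(c_{i,t+1}-c_{i,t})$. Standing assumptions: almost surely $x_t,y_{i,t}^{(\ell)}\in B(x_\star,R)$ for all $t,i,\ell$. $\mathcal F_t$ is generated by the initial state and all minibatches drawn strictly before round $t$; $\mathcal G_{i,t,\ell}$ by $\mathcal F_t$ and all minibatches of node $i$ drawn strictly before local step $\ell$ of round $t$. Conditionally on $\mathcal G_{i,t,\ell}$ the minibatches are independent across nodes and local steps, $\mathbb E[g_{i,t,\ell}\mid\mathcal G_{i,t,\ell}]=\nabla F_i(y_{i,t}^{(\ell)})$, $\mathbb E[\|g_{i,t,\ell}-\nabla F_i(y_{i,t}^{(\ell)})\|^2\mid\mathcal G_{i,t,\ell}]\le v_i^2/b_i$. Notation: $g_t:=\mathbb E[F(x_t)-F_\star]$, $e_{i,t}:=c_{i,t}-\nabla F_i(x_t)$, $T_a(u)=\frac u{1+au}$. For deterministic $(u,\chi)$ with $0\le u\le\bar f$: $A_i(\theta_i)=\frac{\theta_i}{2LR^2}$, $s_i(u;\theta_i)=u-T_{A_i(\theta_i)}(u)$,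 $$\rho_i(\theta_i;u,\chi)=32e^{2\theta_i}\theta_i^3u+\frac{16\theta_i+64e^{2\theta_i}\theta_i^3}L\chi+8e^{2\theta_i}\frac{\theta_i^3v_i^2}{LH_ib_i},$$ $$\kappa_i(\theta_i;u,\chi)=16e^{2\theta_i}\frac{\theta_i^4}Lu+32e^{2\theta_i}\frac{\theta_i^4}{L^2}\chi+(2\theta_i^2+4e^{2\theta_i}\theta_i^4)\frac{v_i^2}{L^2H_ib_i},$$ $\mu_i=s_i-\rho_i$, $\mathfrak J_t^{\mathrm{id}}(w,\theta;u,\chi)=u-\sum_iw_i\mu_i(\theta_i;u,\chi)+\frac L2\sum_iw_i^2\kappa_i(\theta_i;u,\chi)$. Exact optimized controller: at each round the algorithm is run with $(w_t^{\mathrm{id}},\theta_t^{\mathrm{id}})\in\arg\min_{w\in\Delta_n,\theta\in[\underline\theta,\bar\theta]^n}\mathfrak J_t^{\mathrm{id}}(w,\theta;u_t,\chi_t)$, and $u_{t+1}:=\min\{\bar f,\mathfrak J_t^{\mathrm{id}}(w_t^{\mathrm{id}},\theta_t^{\mathrm{id}};u_t,\chi_t)\}$, $\chi_{t+1}:=A_\chi+B_\chi u_t+C_\chi\chi_t$ with $A_\chi:=6\max_i\frac{v_i^2}{H_ib_i}$, $B_\chi:=144L\bar\theta^2$, $C_\chi:=288\bar\theta^2$ (here $\bar\theta$ is the scalar upper amplitude bound). Comparator coefficients (with components $\bar w_i$, $\bar\theta_i$ of the comparator pair): $$a_{\mathrm{cvx}}:=\sum_i\bar w_i\frac{\bar\theta_i}{2LR^2(1+\bar\theta_i/4)},\qquad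 \beta_{\mathrm{cvx}}:=96\sum_i\bar w_i\bar\theta_i^2+32\sum_i\bar w_i^2\bar\theta_i^4,$$ $$\gamma_{\mathrm{cvx}}:=\frac{256}L\sum_i\bar w_i\bar\theta_i+\frac{64}L\sum_i\bar w_i^2\bar\theta_i^4,\qquad \delta_{\mathrm{cvx}}:=\frac{32}L\sum_i\bar w_i\bar\theta_i^2\frac{v_i^2}{H_ib_i}+\frac{16}L\sum_i\bar w_i^2\bar\theta_i^2\frac{v_i^2}{H_ib_i}.$$ Conventions: $(x)_+=\max\{x,0\}$, $0^{-1}=\infty$, $1/\infty=0$.
   Formalization: The condition C_χ = 288 θ̄² < 1 is assumed throughout, also for the first recursion; without it χ̄ is undefined or χ_t ≤ χ̄ fails, and the first recursion is false at θ̄ = 1 (e.g. zero losses, n = L = R = 1, χ_0 = 0, u_0 = 0.001). *)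

theory Defs
  imports "HOL-Probability.Probability"
begin

text \<open>Nodes and samples are numbered from 0: node \<open>i\<close> ranges over \<open>{..<nodes P}\<close> and sample \<open>j\<close> of
  node \<open>i\<close> over \<open>{..<samples P i}\<close>.\<close>

record 'a fed_problem =
  nodes :: nat
  samples :: "nat \<Rightarrow> nat"
  loss :: "nat \<Rightarrow> nat \<Rightarrow> 'a \<Rightarrow> real"
  smoothness :: real
  minimizer :: 'a
  radius :: real
  horizon :: "nat \<Rightarrow> nat"
  batch :: "nat \<Rightarrow> nat"

definition grad :: "('a::euclidean_space \<Rightarrow> real) \<Rightarrow> 'a \<Rightarrow> 'a" where
  "grad f x = (THE D. GDERIV f x :> D)"

definition smooth_fun :: "real \<Rightarrow> ('a::euclidean_space \<Rightarrow> real) \<Rightarrow> bool" where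
  "smooth_fun L f \<longleftrightarrow> (\<forall>x. GDERIV f x :> grad f x) \<and> L-lipschitz_on UNIV (grad f)"

definition node_obj :: "('a::euclidean_space) fed_problem \<Rightarrow> nat \<Rightarrow> 'a \<Rightarrow> real" where
  "node_obj P i x = (1 / real (samples P i)) * (\<Sum>j<samples P i. loss P i j x)"

definition global_obj :: "('a::euclidean_space) fed_problem \<Rightarrow> 'a \<Rightarrow> real" where
  "global_obj P x = (1 / real (nodes P)) * (\<Sum>i<nodes P. node_obj P i x)"

definition trust_ball :: "('a::euclidean_space) fed_problem \<Rightarrow> 'a set" where
  "trust_ball P = cball (minimizer P) (radius P)"

definition fbar :: "('a::euclidean_space) fed_problem \<Rightarrow> real" where
  "fbar P = smoothness P * (radius P)\<^sup>2 / 2"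

text \<open>The quantity written \<open>v\<^sub>i\<^sup>2\<close>. For smooth losses the supremum is taken of a bounded function, 
  so the value of \<open>SUP\<close> on unbounded sets plays no role.\<close>

definition vsq :: "('a::euclidean_space) fed_problem \<Rightarrow> nat \<Rightarrow> real" where
  "vsq P i = (SUP x\<in>trust_ball P. (1 / real (samples P i)) *
      (\<Sum>j<samples P i. (norm (grad (loss P i j) x - grad (node_obj P i) x))\<^sup>2))"

definition convex_smooth_problem :: "('a::euclidean_space) fed_problem \<Rightarrow> bool" where
  "convex_smooth_problem P \<longleftrightarrow>
     1 \<le> nodes P \<and> 0 < smoothness P \<and> 0 < radius P \<and>
     (\<forall>i<nodes P. 1 \<le> samples P i \<and> 1 \<le> horizon P i \<and> 1 \<le> batch P i \<and>
        (\<forall>j<samples P i. convex_on UNIV (loss P i j) \<and> smooth_fun (smoothness P) (loss P i j))) \<and>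
     is_arg_min (global_obj P) (\<lambda>_. True) (minimizer P)"

definition minibatch_grad ::
    "('a::euclidean_space) fed_problem \<Rightarrow> nat \<Rightarrow> nat set \<Rightarrow> 'a \<Rightarrow> 'a" where
  "minibatch_grad P i S y = (1 / real (batch P i)) *\<^sub>R (\<Sum>j\<in>S. grad (loss P i j) y)"

definition stepsize :: "('a::euclidean_space) fed_problem \<Rightarrow> (nat \<Rightarrow> nat \<Rightarrow> real) \<Rightarrow> nat \<Rightarrow> nat \<Rightarrow> real" where
  "stepsize P \<theta> i t = \<theta> t i / (smoothness P * real (horizon P i))"

text \<open>Argument order: weights \<open>w t i\<close> and amplitudes \<open>\<theta> t i\<close> put the round first, so that \<open>w t\<close> and
  \<open>\<theta> t\<close> are vectors indexed by the node; minibatches \<open>S i t l\<close>, local iterates \<open>y i t l\<close> and control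
  variates \<open>c i t\<close> put the node first; \<open>cs t\<close> is the server control variate.\<close>

definition hew_local_sgd ::
    "('a::euclidean_space) fed_problem \<Rightarrow> (nat \<Rightarrow> nat \<Rightarrow> real) \<Rightarrow> (nat \<Rightarrow> nat \<Rightarrow> real) \<Rightarrow>
     (nat \<Rightarrow> nat \<Rightarrow> nat \<Rightarrow> nat set) \<Rightarrow>
     (nat \<Rightarrow> 'a) \<Rightarrow> (nat \<Rightarrow> nat \<Rightarrow> nat \<Rightarrow> 'a) \<Rightarrow> (nat \<Rightarrow> nat \<Rightarrow> 'a) \<Rightarrow> (nat \<Rightarrow> 'a) \<Rightarrow> bool" where
  "hew_local_sgd P w \<theta> S x y c cs \<longleftrightarrow>
     cs 0 = (1 / real (nodes P)) *\<^sub>R (\<Sum>i<nodes P. c i 0) \<and>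
     (\<forall>t. \<forall>i<nodes P. y i t 0 = x t) \<and>
     (\<forall>t. \<forall>i<nodes P. \<forall>l<horizon P i.
        y i t (Suc l) = y i t l
          - stepsize P \<theta> i t *\<^sub>R (minibatch_grad P i (S i t l) (y i t l) - c i t + cs t)) \<and>
     (\<forall>t. \<forall>i<nodes P.
        c i (Suc t) = c i t - cs t
          + (1 / (real (horizon P i) * stepsize P \<theta> i t)) *\<^sub>R (x t - y i t (horizon P i))) \<and>
     (\<forall>t. x (Suc t) = x t + (\<Sum>i<nodes P. w t i *\<^sub>R (y i t (horizon P i) - x t))) \<and>
     (\<forall>t. cs (Suc t) = cs t + (1 / real (nodes P)) *\<^sub>R (\<Sum>i<nodes P. c i (Suc t) - c i t))"

text \<open>\<open>x0\<close> and \<open>c0 i\<close> form the initial state; the server control variate is a function of them.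
  Minibatches are discrete, so every set of index sets is an event.\<close>

definition round_history ::
    "('a::euclidean_space) fed_problem \<Rightarrow> 'w measure \<Rightarrow> ('w \<Rightarrow> 'a) \<Rightarrow> (nat \<Rightarrow> 'w \<Rightarrow> 'a) \<Rightarrow>
     (nat \<Rightarrow> nat \<Rightarrow> nat \<Rightarrow> 'w \<Rightarrow> nat set) \<Rightarrow> nat \<Rightarrow> 'w measure" where
  "round_history P M x0 c0 B t = sigma (space M)
     ({x0 -` A \<inter> space M | A. A \<in> sets borel} \<union>
      {c0 i -` A \<inter> space M | i A. i < nodes P \<and> A \<in> sets borel} \<union>
      {B i s l -` A \<inter> space M | i s l A. i < nodes P \<and> s < t \<and> l < horizon P i})"

definition local_history ::
    "('a::euclidean_space) fed_problem \<Rightarrow> 'w measure \<Rightarrow> ('w \<Rightarrow> 'a) \<Rightarrow> (nat \<Rightarrow> 'w \<Rightarrow> 'a) \<Rightarrow>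
     (nat \<Rightarrow> nat \<Rightarrow> nat \<Rightarrow> 'w \<Rightarrow> nat set) \<Rightarrow> nat \<Rightarrow> nat \<Rightarrow> nat \<Rightarrow> 'w measure" where
  "local_history P M x0 c0 B i t l = sigma (space M)
     (sets (round_history P M x0 c0 B t) \<union>
      {B i t k -` A \<inter> space M | k A. k < l})"

definition vec_cond_exp ::
    "'w measure \<Rightarrow> 'w measure \<Rightarrow> ('w \<Rightarrow> 'a::euclidean_space) \<Rightarrow> 'w \<Rightarrow> 'a" where
  "vec_cond_exp M G X \<omega> = (\<Sum>b\<in>Basis. real_cond_exp M G (\<lambda>\<omega>'. X \<omega>' \<bullet> b) \<omega> *\<^sub>R b)"

text \<open>Mutual conditional independence, given \<open>G\<close>, of a finite family of discrete random variables.
  Independence of subfamilies is the case where some \<open>A k\<close> equal \<open>UNIV\<close>.\<close>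

definition cond_indep_discrete ::
    "'w measure \<Rightarrow> 'w measure \<Rightarrow> ('k \<Rightarrow> 'w \<Rightarrow> 's) \<Rightarrow> 'k set \<Rightarrow> bool" where
  "cond_indep_discrete M G X K \<longleftrightarrow>
     (\<forall>A. AE \<omega> in M.
        real_cond_exp M G (indicator {\<omega>'\<in>space M. \<forall>k\<in>K. X k \<omega>' \<in> A k}) \<omega> =
        (\<Prod>k\<in>K. real_cond_exp M G (indicator {\<omega>'\<in>space M. X k \<omega>' \<in> A k}) \<omega>))"

definition T_map :: "real \<Rightarrow> real \<Rightarrow> real" where
  "T_map a u = u / (1 + a * u)"

definition A_coef :: "('a::euclidean_space) fed_problem \<Rightarrow> real \<Rightarrow> real" where
  "A_coef P \<theta> = \<theta> / (2 * smoothness P * (radius P)\<^sup>2)"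

definition s_gain :: "('a::euclidean_space) fed_problem \<Rightarrow> real \<Rightarrow> real \<Rightarrow> real" where
  "s_gain P \<theta> u = u - T_map (A_coef P \<theta>) u"

definition rho :: "('a::euclidean_space) fed_problem \<Rightarrow> nat \<Rightarrow> real \<Rightarrow> real \<Rightarrow> real \<Rightarrow> real" where
  "rho P i \<theta> u chi =
     32 * exp (2 * \<theta>) * \<theta>^3 * u
     + (16 * \<theta> + 64 * exp (2 * \<theta>) * \<theta>^3) / smoothness P * chi
     + 8 * exp (2 * \<theta>) * (\<theta>^3 * vsq P i / (smoothness P * real (horizon P i) * real (batch P i)))"

definition kappa :: "('a::euclidean_space) fed_problem \<Rightarrow> nat \<Rightarrow> real \<Rightarrow> real \<Rightarrow> real \<Rightarrow> real" where
  "kappa P i \<theta> u chi =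
     16 * exp (2 * \<theta>) * (\<theta>^4 / smoothness P) * u
     + 32 * exp (2 * \<theta>) * (\<theta>^4 / (smoothness P)\<^sup>2) * chi
     + (2 * \<theta>\<^sup>2 + 4 * exp (2 * \<theta>) * \<theta>^4)
         * (vsq P i / ((smoothness P)\<^sup>2 * real (horizon P i) * real (batch P i)))"

definition mu :: "('a::euclidean_space) fed_problem \<Rightarrow> nat \<Rightarrow> real \<Rightarrow> real \<Rightarrow> real \<Rightarrow> real" where
  "mu P i \<theta> u chi = s_gain P \<theta> u - rho P i \<theta> u chi"

definition J_id ::
    "('a::euclidean_space) fed_problem \<Rightarrow> (nat \<Rightarrow> real) \<Rightarrow> (nat \<Rightarrow> real) \<Rightarrow> real \<Rightarrow> real \<Rightarrow> real" where
  "J_id P w \<theta> u chi =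
     u - (\<Sum>i<nodes P. w i * mu P i (\<theta> i) u chi)
     + smoothness P / 2 * (\<Sum>i<nodes P. (w i)\<^sup>2 * kappa P i (\<theta> i) u chi)"

text \<open>Membership in \<open>\<Delta>\<^sub>n \<times> [\<theta>lo, \<theta>hi]\<^sup>n\<close>; values at indices \<open>i \<ge> nodes P\<close> are irrelevant here and in
  all quantities built from \<open>w\<close> and \<open>\<theta>\<close>.\<close>

definition feasible ::
    "('a::euclidean_space) fed_problem \<Rightarrow> real \<Rightarrow> real \<Rightarrow> (nat \<Rightarrow> real) \<times> (nat \<Rightarrow> real) \<Rightarrow> bool" where
  "feasible P \<theta>lo \<theta>hi = (\<lambda>(w, \<theta>).
     (\<forall>i<nodes P. 0 \<le> w i) \<and> (\<Sum>i<nodes P. w i) = 1 \<and>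
     (\<forall>i<nodes P. \<theta> i \<in> {\<theta>lo..\<theta>hi}))"

definition A_chi :: "('a::euclidean_space) fed_problem \<Rightarrow> real" where
  "A_chi P = 6 * (MAX i\<in>{..<nodes P}. vsq P i / (real (horizon P i) * real (batch P i)))"

definition B_chi :: "('a::euclidean_space) fed_problem \<Rightarrow> real \<Rightarrow> real" where
  "B_chi P \<theta>hi = 144 * smoothness P * \<theta>hi\<^sup>2"

definition C_chi :: "real \<Rightarrow> real" where
  "C_chi \<theta>hi = 288 * \<theta>hi\<^sup>2"

definition exact_controller ::
    "('a::euclidean_space) fed_problem \<Rightarrow> real \<Rightarrow> real \<Rightarrow> (nat \<Rightarrow> nat \<Rightarrow> real) \<Rightarrow>
     (nat \<Rightarrow> nat \<Rightarrow> real) \<Rightarrow> (nat \<Rightarrow> real) \<Rightarrow> (nat \<Rightarrow> real) \<Rightarrow> bool" where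
  "exact_controller P \<theta>lo \<theta>hi w \<theta> u chi \<longleftrightarrow>
     (\<forall>t. is_arg_min (\<lambda>(w', \<theta>'). J_id P w' \<theta>' (u t) (chi t)) (feasible P \<theta>lo \<theta>hi) (w t, \<theta> t)) \<and>
     (\<forall>t. u (Suc t) = min (fbar P) (J_id P (w t) (\<theta> t) (u t) (chi t))) \<and>
     (\<forall>t. chi (Suc t) = A_chi P + B_chi P \<theta>hi * u t + C_chi \<theta>hi * chi t)"

definition a_cvx :: "('a::euclidean_space) fed_problem \<Rightarrow> (nat \<Rightarrow> real) \<Rightarrow> (nat \<Rightarrow> real) \<Rightarrow> real" where
  "a_cvx P w \<theta> =
     (\<Sum>i<nodes P. w i * (\<theta> i / (2 * smoothness P * (radius P)\<^sup>2 * (1 + \<theta> i / 4))))"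

definition beta_cvx :: "('a::euclidean_space) fed_problem \<Rightarrow> (nat \<Rightarrow> real) \<Rightarrow> (nat \<Rightarrow> real) \<Rightarrow> real" where
  "beta_cvx P w \<theta> =
     96 * (\<Sum>i<nodes P. w i * (\<theta> i)\<^sup>2) + 32 * (\<Sum>i<nodes P. (w i)\<^sup>2 * (\<theta> i)^4)"

definition gamma_cvx :: "('a::euclidean_space) fed_problem \<Rightarrow> (nat \<Rightarrow> real) \<Rightarrow> (nat \<Rightarrow> real) \<Rightarrow> real" where
  "gamma_cvx P w \<theta> =
     256 / smoothness P * (\<Sum>i<nodes P. w i * \<theta> i)
     + 64 / smoothness P * (\<Sum>i<nodes P. (w i)\<^sup>2 * (\<theta> i)^4)"

definition delta_cvx :: "('a::euclidean_space) fed_problem \<Rightarrow> (nat \<Rightarrow> real) \<Rightarrow> (nat \<Rightarrow> real) \<Rightarrow> real" where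
  "delta_cvx P w \<theta> =
     32 / smoothness P *
       (\<Sum>i<nodes P. w i * (\<theta> i)\<^sup>2 * (vsq P i / (real (horizon P i) * real (batch P i))))
     + 16 / smoothness P *
       (\<Sum>i<nodes P. (w i)\<^sup>2 * (\<theta> i)\<^sup>2 * (vsq P i / (real (horizon P i) * real (batch P i))))"

definition chi_bar :: "('a::euclidean_space) fed_problem \<Rightarrow> real \<Rightarrow> real \<Rightarrow> real" where
  "chi_bar P \<theta>hi chi0 = max chi0 ((A_chi P + B_chi P \<theta>hi * fbar P) / (1 - C_chi \<theta>hi))"

definition d_cvx ::
    "('a::euclidean_space) fed_problem \<Rightarrow> (nat \<Rightarrow> real) \<Rightarrow> (nat \<Rightarrow> real) \<Rightarrow> real \<Rightarrow> real \<Rightarrow> real" where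
  "d_cvx P w \<theta> \<theta>hi chi0 = gamma_cvx P w \<theta> * chi_bar P \<theta>hi chi0 + delta_cvx P w \<theta>"

definition m_cvx ::
    "('a::euclidean_space) fed_problem \<Rightarrow> (nat \<Rightarrow> real) \<Rightarrow> (nat \<Rightarrow> real) \<Rightarrow> real \<Rightarrow> real \<Rightarrow> real" where
  "m_cvx P w \<theta> \<theta>hi chi0 =
     (beta_cvx P w \<theta> + sqrt ((beta_cvx P w \<theta>)\<^sup>2 + 4 * a_cvx P w \<theta> * d_cvx P w \<theta> \<theta>hi chi0))
       / (2 * a_cvx P w \<theta>)"

end

theory Submission
  imports Defs
begin

text \<open>The proof has a stochastic half and a scalar half.

\<^bold>\<open>Stochastic half.\<close> Suppose that at the start of a round the expected suboptimality is at most \<open>u\<close> and all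
control-variate errors have second moment at most \<open>chi\<close>. Then the expected suboptimality after the round is at
most the objective value \<open>J_id\<close> of the weights and amplitudes in use (\<open>expected_gap_Suc_le\<close>), and the new errors
have second moment at most \<open>A_chi + B_chi * u + C_chi * chi\<close> (\<open>next_error_le\<close>). For this the server step is
written as a weighted sum, over the nodes, of the global gradient, the control-variate bias and the shift of the
local gradients, minus the total minibatch noise. The contributions are controlled as follows.

\<^item> Minibatch noises of one round are pairwise orthogonal: those of the same node because the noise is centred
  given the local history, those of different nodes because the minibatches are independent given the
  history at the start of the round (\<open>noise_orthogonal_pairs\<close>). The total noise is moreover orthogonal to the
  gradient at the start of the round. This is why the variance enters with squared weights.
\<^item> The drift of the local iterates obeys a recursion in which the deterministic direction accumulates
  quadratically and the noise linearly in the number of steps (\<open>drift_sq_le\<close>). Convexity is not used there; the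
  factor \<open>exp (2 * \<theta>)\<close> accounts for the expansion of a gradient step.
\<^item> The condition \<open>C_chi \<theta>hi < 1\<close> makes every amplitude at most 1/16, so the quadratic term of the descent
  lemma is absorbed by half of the first-order gain (\<open>perturbed_gradient_step_le\<close>). Convexity turns the squared
  gradient into the squared gap, and Jensen's inequality turns this into the map \<open>T_map\<close>.

By induction over the rounds \<open>u t\<close> and \<open>chi t\<close> remain valid bounds (\<open>controller_certificate\<close>).

\<^bold>\<open>Scalar half.\<close> By optimality the controller does at least as well as the fixed comparator pair, whose value is
estimated term by term with \<open>exp (2 * \<theta>) \<le> 3\<close> (\<open>comparator_value_le\<close>). The errors \<open>chi t\<close> stay bounded since
their recursion contracts, so that \<open>u\<close> satisfies a quadratic recursion with constant coefficients, which is
solved in \<open>quadratic_recursion_bound\<close>.\<close>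

section \<open>Smooth and convex functions\<close>

lemma grad_unique:
  assumes "GDERIV f x :> D"
  shows "grad f x = D"
  unfolding grad_def
proof (rule the_equality)
  fix D' assume "GDERIV f x :> D'"
  then have "(\<lambda>h. h \<bullet> D') = (\<lambda>h. h \<bullet> D)"
    using assms unfolding gderiv_def by (rule has_derivative_unique)
  then have "(D' - D) \<bullet> (D' - D) = 0"
    by (metis inner_diff_right right_minus_eq)
  then show "D' = D" by simp
qed (rule assms)

lemma smooth_fun_GDERIV: "smooth_fun L f \<Longrightarrow> GDERIV f x :> grad f x"
  by (simp add: smooth_fun_def)

lemma smooth_fun_lipschitz: "smooth_fun L f \<Longrightarrow> norm (grad f x - grad f y) \<le> L * norm (x - y)"
  unfolding smooth_fun_def by (metis UNIV_I dist_norm lipschitz_onD)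

lemma smooth_fun_nonneg: "smooth_fun L f \<Longrightarrow> 0 \<le> L"
  unfolding smooth_fun_def by (metis lipschitz_on_nonneg)

lemma smooth_fun_grad_continuous: "smooth_fun L f \<Longrightarrow> continuous_on A (grad f)"
  unfolding smooth_fun_def
  by (metis continuous_on_subset lipschitz_on_continuous_on subset_UNIV)

lemma smooth_fun_grad_measurable: "smooth_fun L f \<Longrightarrow> grad f \<in> borel_measurable borel"
  by (intro borel_measurable_continuous_onI smooth_fun_grad_continuous)

lemma smooth_fun_continuous: "smooth_fun L f \<Longrightarrow> continuous_on A f"
  by (meson continuous_at_imp_continuous_on gderiv_def has_derivative_continuous smooth_fun_GDERIV)

lemma smooth_fun_mean:
  fixes f :: "nat \<Rightarrow> 'a::euclidean_space \<Rightarrow> real"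
  assumes sm: "\<And>j. j < n \<Longrightarrow> smooth_fun L (f j)" and n: "1 \<le> n"
  shows "smooth_fun L (\<lambda>x. (1 / real n) * (\<Sum>j<n. f j x))"
    and "grad (\<lambda>x. (1 / real n) * (\<Sum>j<n. f j x)) x = (1 / real n) *\<^sub>R (\<Sum>j<n. grad (f j) x)"
proof -
  let ?g = "\<lambda>x. (1 / real n) *\<^sub>R (\<Sum>j<n. grad (f j) x)"
  have G: "GDERIV (\<lambda>x. (1 / real n) * (\<Sum>j<n. f j x)) x :> ?g x" for x
  proof -
    have "((\<lambda>x. (1 / real n) * (\<Sum>j<n. f j x)) has_derivative
        (\<lambda>h. (1 / real n) * (\<Sum>j<n. h \<bullet> grad (f j) x))) (at x)"
      using sm smooth_fun_GDERIV unfolding gderiv_def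
      by (intro has_derivative_mult_right has_derivative_sum) auto
    then show ?thesis
      by (simp add: gderiv_def inner_sum_right)
  qed
  have eq: "grad (\<lambda>x. (1 / real n) * (\<Sum>j<n. f j x)) = ?g"
    using grad_unique[OF G] by auto
  then show "grad (\<lambda>x. (1 / real n) * (\<Sum>j<n. f j x)) x = ?g x" by simp
  have L: "0 \<le> L" using sm[of 0] n smooth_fun_nonneg by auto
  have "L-lipschitz_on UNIV ?g"
  proof (rule lipschitz_onI[OF _ L])
    fix x y :: 'a
    have "norm (?g x - ?g y) = (1 / real n) * norm (\<Sum>j<n. grad (f j) x - grad (f j) y)"
      by (simp add: sum_subtractf flip: scaleR_diff_right)
    also have "\<dots> \<le> (1 / real n) * (\<Sum>j<n. L * norm (x - y))"
      by (intro mult_left_mono sum_norm_le) (auto intro: smooth_fun_lipschitz sm)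
    also have "\<dots> = L * norm (x - y)" using n by simp
    finally show "dist (?g x) (?g y) \<le> L * dist x y" by (simp add: dist_norm)
  qed
  then show "smooth_fun L (\<lambda>x. (1 / real n) * (\<Sum>j<n. f j x))"
    unfolding smooth_fun_def eq using G eq by auto
qed

lemma smooth_fun_descent:
  fixes f :: "'a::euclidean_space \<Rightarrow> real"
  assumes sm: "smooth_fun L f"
  shows "f (x + v) \<le> f x + grad f x \<bullet> v + L / 2 * (norm v)\<^sup>2"
proof -
  define \<phi> where "\<phi> s = f (x + s *\<^sub>R v) - s * (grad f x \<bullet> v) - L / 2 * s\<^sup>2 * (norm v)\<^sup>2" for s :: real
  have der: "(\<phi> has_real_derivative
      (grad f (x + s *\<^sub>R v) - grad f x) \<bullet> v - L * s * (norm v)\<^sup>2) (at s)" for s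
  proof -
    have 1: "((\<lambda>s. x + s *\<^sub>R v) has_derivative (\<lambda>h. h *\<^sub>R v)) (at s)"
      by (auto intro!: derivative_eq_intros)
    have 2: "(f has_derivative (\<lambda>h. h \<bullet> grad f (x + s *\<^sub>R v))) (at (x + s *\<^sub>R v))"
      using smooth_fun_GDERIV[OF sm] by (simp add: gderiv_def)
    have "((\<lambda>s. f (x + s *\<^sub>R v)) has_derivative (\<lambda>h. (h *\<^sub>R v) \<bullet> grad f (x + s *\<^sub>R v))) (at s)"
      using has_derivative_compose[OF 1 2] by simp
    then have "((\<lambda>s. f (x + s *\<^sub>R v)) has_real_derivative v \<bullet> grad f (x + s *\<^sub>R v)) (at s)"
      by (simp add: has_field_derivative_def mult.commute[of _ "v \<bullet> _"])
    then show ?thesis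
      unfolding \<phi>_def
      by (auto intro!: derivative_eq_intros simp: inner_diff_left inner_commute algebra_simps)
  qed
  have neg: "(grad f (x + s *\<^sub>R v) - grad f x) \<bullet> v - L * s * (norm v)\<^sup>2 \<le> 0" if "0 \<le> s" for s
  proof -
    have "(grad f (x + s *\<^sub>R v) - grad f x) \<bullet> v \<le> norm (grad f (x + s *\<^sub>R v) - grad f x) * norm v"
      by (rule norm_cauchy_schwarz)
    also have "\<dots> \<le> (L * norm (x + s *\<^sub>R v - x)) * norm v"
      by (intro mult_right_mono smooth_fun_lipschitz[OF sm]) auto
    also have "\<dots> = L * s * (norm v)\<^sup>2" using that by (simp add: power2_eq_square)
    finally show ?thesis by simp
  qed
  have "\<phi> 1 \<le> \<phi> 0"
    by (rule DERIV_nonpos_imp_nonincreasing[of 0 1]) (use der neg in \<open>auto intro!: exI\<close>)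
  then show ?thesis by (simp add: \<phi>_def)
qed

lemma smooth_fun_grad_sq_le:
  fixes f :: "'a::euclidean_space \<Rightarrow> real"
  assumes sm: "smooth_fun L f" and L: "0 < L" and min: "\<And>z. f m \<le> f z"
  shows "(norm (grad f x))\<^sup>2 \<le> 2 * L * (f x - f m)"
proof -
  have "f m \<le> f (x + (- 1 / L) *\<^sub>R grad f x)" by (rule min)
  also have "\<dots> \<le> f x + grad f x \<bullet> ((- 1 / L) *\<^sub>R grad f x)
      + L / 2 * (norm ((- 1 / L) *\<^sub>R grad f x))\<^sup>2"
    by (rule smooth_fun_descent[OF sm])
  also have "\<dots> = f x - (norm (grad f x))\<^sup>2 / (2 * L)"
    using L by (simp add: power_mult_distrib field_simps power2_eq_square flip: power2_norm_eq_inner)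
  finally show ?thesis using L by (simp add: field_simps)
qed

lemma smooth_fun_gap_le:
  fixes f :: "'a::euclidean_space \<Rightarrow> real"
  assumes sm: "smooth_fun L f" and L: "0 < L" and min: "\<And>z. f m \<le> f z"
  shows "f x - f m \<le> L / 2 * (norm (x - m))\<^sup>2"
proof -
  have "grad f m = 0" using smooth_fun_grad_sq_le[OF sm L min, of m] by simp
  then show ?thesis using smooth_fun_descent[OF sm, of m "x - m"] by simp
qed

lemma convex_on_grad_ineq:
  fixes f :: "'a::euclidean_space \<Rightarrow> real"
  assumes cv: "convex_on UNIV f" and d: "GDERIV f x :> D"
  shows "f x + D \<bullet> (z - x) \<le> f z"
proof -
  let ?p = "\<lambda>s::real. f (x + s *\<^sub>R (z - x))"
  have der: "(?p has_real_derivative D \<bullet> (z - x)) (at 0)"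
  proof -
    have 1: "((\<lambda>s. x + s *\<^sub>R (z - x)) has_derivative (\<lambda>h. h *\<^sub>R (z - x))) (at 0)"
      by (auto intro!: derivative_eq_intros)
    have 2: "(f has_derivative (\<lambda>h. h \<bullet> D)) (at (x + 0 *\<^sub>R (z - x)))"
      using d by (simp add: gderiv_def)
    have "(?p has_derivative (\<lambda>h. (h *\<^sub>R (z - x)) \<bullet> D)) (at 0)"
      using has_derivative_compose[OF 1 2] by simp
    then show ?thesis
      by (simp add: has_field_derivative_def mult.commute[of _ "_ \<bullet> _"] inner_commute)
  qed
  have "((\<lambda>s. (?p s - ?p 0) / (s - 0)) \<longlongrightarrow> D \<bullet> (z - x)) (at 0)"
    using der unfolding has_field_derivative_iff by simp
  then have lim: "((\<lambda>s. (?p s - ?p 0) / (s - 0)) \<longlongrightarrow> D \<bullet> (z - x)) (at_right 0)"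
    by (rule filterlim_mono) (auto simp: at_le)
  have "eventually (\<lambda>s::real. s \<in> {0<..<1}) (at_right 0)"
    by (rule eventually_at_right_real) simp
  then have ev: "eventually (\<lambda>s. (?p s - ?p 0) / (s - 0) \<le> f z - f x) (at_right 0)"
  proof (rule eventually_mono)
    fix s :: real assume s: "s \<in> {0<..<1}"
    have "?p s = f ((1 - s) *\<^sub>R x + s *\<^sub>R z)" by (simp add: algebra_simps)
    also have "\<dots> \<le> (1 - s) * f x + s * f z"
      using s by (intro convex_onD[OF cv]) auto
    finally show "(?p s - ?p 0) / (s - 0) \<le> f z - f x"
      using s by (simp add: field_simps)
  qed
  have "D \<bullet> (z - x) \<le> f z - f x"
    using tendsto_upperbound[OF lim ev] by simp
  then show ?thesis by simp
qed

lemma convex_on_mean: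
  assumes "\<And>j. j < n \<Longrightarrow> convex_on UNIV (f j)"
  shows "convex_on UNIV (\<lambda>x. (1 / real n) * (\<Sum>j<n. f j x))"
proof -
  have "convex_on UNIV (\<lambda>x. \<Sum>j\<in>{..<n}. f j x)"
    using assms by (induction n) (auto simp: convex_on_const intro!: convex_on_add)
  then show ?thesis by (intro convex_on_cmul) auto
qed

section \<open>Inequalities for squared norms\<close>

lemma norm_add_sq_le: "(norm (a + b :: 'a::real_inner))\<^sup>2 \<le> 2 * (norm a)\<^sup>2 + 2 * (norm b)\<^sup>2"
proof -
  have "0 \<le> (norm (a - b))\<^sup>2" by simp
  then show ?thesis
    by (simp add: power2_norm_eq_inner inner_simps inner_commute)
qed

lemma norm_add_sq_le_weighted:
  assumes "0 < \<epsilon>"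
  shows "(norm (a + b :: 'a::real_inner))\<^sup>2 \<le> (1 + \<epsilon>) * (norm a)\<^sup>2 + (1 + 1 / \<epsilon>) * (norm b)\<^sup>2"
proof -
  have "0 \<le> (1 / \<epsilon>) * (norm (\<epsilon> *\<^sub>R a - b))\<^sup>2" using assms by simp
  also have "\<dots> = \<epsilon> * (norm a)\<^sup>2 - 2 * (a \<bullet> b) + (1 / \<epsilon>) * (norm b)\<^sup>2"
  proof -
    have sq: "(norm (\<epsilon> *\<^sub>R a - b))\<^sup>2 = \<epsilon>\<^sup>2 * (norm a)\<^sup>2 - 2 * \<epsilon> * (a \<bullet> b) + (norm b)\<^sup>2"
      unfolding power2_norm_eq_inner
      by (simp add: inner_simps inner_commute power2_eq_square algebra_simps)
    show ?thesis unfolding sq using assms by (simp add: field_simps power2_eq_square)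
  qed
  finally have "2 * (a \<bullet> b) \<le> \<epsilon> * (norm a)\<^sup>2 + (1 / \<epsilon>) * (norm b)\<^sup>2" by simp
  moreover have "(norm (a + b))\<^sup>2 = (norm a)\<^sup>2 + 2 * (a \<bullet> b) + (norm b)\<^sup>2"
    by (simp add: power2_norm_eq_inner inner_simps inner_commute)
  ultimately show ?thesis by (simp add: algebra_simps)
qed

lemma norm_add3_sq_le:
  "(norm (a + b + c :: 'a::real_inner))\<^sup>2 \<le> 3 * (norm a)\<^sup>2 + 3 * (norm b)\<^sup>2 + 3 * (norm c)\<^sup>2"
  using norm_add_sq_le_weighted[of "1 / 2" "a + b" c] norm_add_sq_le[of a b] by simp

lemma exp_le_3: "x \<le> (1::real) \<Longrightarrow> exp x \<le> 3"
  using exp_le by (rule order_trans[rotated]) simp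

text \<open>One step of gradient descent whose direction \<open>G\<close> is perturbed by \<open>B\<close>: for a small step size the
first-order gain \<open>\<parallel>G\<parallel>\<^sup>2\<close> outweighs the quadratic term, and half of it survives up to \<open>\<parallel>B\<parallel>\<^sup>2\<close>.\<close>

lemma perturbed_gradient_step_le:
  fixes G B :: "'a::real_inner"
  assumes "0 \<le> \<theta>" "\<theta> \<le> 1 / 16"
  shows "- (G \<bullet> (G + B)) + \<theta> * (norm (G + B))\<^sup>2 \<le> (norm B)\<^sup>2 - (norm G)\<^sup>2 / 2"
proof -
  have "0 \<le> (norm (2 *\<^sub>R G + 3 *\<^sub>R B))\<^sup>2" by simp
  also have "\<dots> = 4 * (norm G)\<^sup>2 + 12 * (G \<bullet> B) + 9 * (norm B)\<^sup>2"
    by (simp only: power2_norm_eq_inner inner_add_left inner_add_right inner_scaleR_left inner_scaleR_right)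
      (simp add: inner_commute)
  finally have "- (G \<bullet> B) \<le> (norm G)\<^sup>2 / 3 + 3 / 4 * (norm B)\<^sup>2" by simp
  moreover have "\<theta> * (norm (G + B))\<^sup>2 \<le> (1 / 16) * (2 * (norm G)\<^sup>2 + 2 * (norm B)\<^sup>2)"
    using assms by (intro mult_mono norm_add_sq_le) auto
  moreover have "G \<bullet> (G + B) = (norm G)\<^sup>2 + G \<bullet> B"
    by (simp add: inner_add_right power2_norm_eq_inner)
  moreover have "0 \<le> (norm G)\<^sup>2" "0 \<le> (norm B)\<^sup>2" by auto
  ultimately show ?thesis by argo
qed

lemma norm_weighted_mean_sq_le:
  fixes v :: "'i \<Rightarrow> 'a::real_inner"
  assumes w: "\<And>i. i \<in> I \<Longrightarrow> 0 \<le> w i" and one: "sum w I = 1"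
  shows "(norm (\<Sum>i\<in>I. w i *\<^sub>R v i))\<^sup>2 \<le> (\<Sum>i\<in>I. w i * (norm (v i))\<^sup>2)"
proof -
  define m where "m = (\<Sum>i\<in>I. w i *\<^sub>R v i)"
  have "0 \<le> (\<Sum>i\<in>I. w i * (norm (v i - m))\<^sup>2)" using w by (intro sum_nonneg) auto
  also have "\<dots> = (\<Sum>i\<in>I. w i * (norm (v i))\<^sup>2 - 2 * ((w i *\<^sub>R v i) \<bullet> m) + w i * (norm m)\<^sup>2)"
    by (intro sum.cong) (auto simp: power2_norm_eq_inner inner_simps inner_commute algebra_simps)
  also have "\<dots> = (\<Sum>i\<in>I. w i * (norm (v i))\<^sup>2) - 2 * (m \<bullet> m) + (norm m)\<^sup>2"
    by (simp add: sum.distrib sum_subtractf m_def inner_sum_left one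
        flip: sum_distrib_left sum_distrib_right)
  finally show ?thesis by (simp add: power2_norm_eq_inner m_def)
qed

lemma norm_mean_sq_le:
  fixes v :: "nat \<Rightarrow> 'a::real_inner"
  assumes "1 \<le> n"
  shows "(norm ((1 / real n) *\<^sub>R (\<Sum>i<n. v i)))\<^sup>2 \<le> (1 / real n) * (\<Sum>i<n. (norm (v i))\<^sup>2)"
  using norm_weighted_mean_sq_le[of "{..<n}" "\<lambda>_. 1 / real n" v] assms
  by (simp add: scaleR_sum_right sum_distrib_left)

section \<open>Square-integrable vectors\<close>

text \<open>Random vectors with finite second moment. A dedicated predicate keeps measurability and
integrability of \<open>\<parallel>X\<parallel>\<^sup>2\<close> together; both are closed under the vector operations used below.\<close>

definition sq_integrable :: "'w measure \<Rightarrow> ('w \<Rightarrow> 'a::euclidean_space) \<Rightarrow> bool" where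
  "sq_integrable M X \<longleftrightarrow> X \<in> borel_measurable M \<and> integrable M (\<lambda>\<omega>. (norm (X \<omega>))\<^sup>2)"

lemma sq_integrableD:
  "sq_integrable M X \<Longrightarrow> X \<in> borel_measurable M"
  "sq_integrable M X \<Longrightarrow> integrable M (\<lambda>\<omega>. (norm (X \<omega>))\<^sup>2)"
  by (auto simp: sq_integrable_def)

lemma sq_integrable_dominated:
  assumes "X \<in> borel_measurable M" "integrable M f" "AE \<omega> in M. (norm (X \<omega>))\<^sup>2 \<le> f \<omega>"
  shows "sq_integrable M X"
  unfolding sq_integrable_def
proof (intro conjI assms(1))
  show "integrable M (\<lambda>\<omega>. (norm (X \<omega>))\<^sup>2)"
    by (rule Bochner_Integration.integrable_bound[OF assms(2)]) (use assms in \<open>auto intro: order_trans\<close>)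
qed

lemma sq_integrable_zero [simp]: "sq_integrable M (\<lambda>_. 0)"
  by (simp add: sq_integrable_def)

lemma sq_integrable_add:
  assumes "sq_integrable M X" "sq_integrable M Y"
  shows "sq_integrable M (\<lambda>\<omega>. X \<omega> + Y \<omega>)"
proof (rule sq_integrable_dominated)
  show "integrable M (\<lambda>\<omega>. 2 * (norm (X \<omega>))\<^sup>2 + 2 * (norm (Y \<omega>))\<^sup>2)"
    using assms by (auto simp: sq_integrable_def)
qed (use assms norm_add_sq_le in \<open>auto simp: sq_integrable_def\<close>)

lemma sq_integrable_scaleR:
  "sq_integrable M X \<Longrightarrow> sq_integrable M (\<lambda>\<omega>. r *\<^sub>R X \<omega>)"
  by (auto simp: sq_integrable_def power_mult_distrib)

lemma sq_integrable_diff: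
  assumes "sq_integrable M X" "sq_integrable M Y"
  shows "sq_integrable M (\<lambda>\<omega>. X \<omega> - Y \<omega>)"
  using sq_integrable_add[OF assms(1) sq_integrable_scaleR[OF assms(2), of "-1"]] by simp

lemma sq_integrable_sum:
  assumes "\<And>i. i \<in> I \<Longrightarrow> sq_integrable M (X i)"
  shows "sq_integrable M (\<lambda>\<omega>. \<Sum>i\<in>I. X i \<omega>)"
  using assms by (induction I rule: infinite_finite_induct) (auto intro: sq_integrable_add)

lemma sq_integrable_inner:
  assumes "sq_integrable M X" "sq_integrable M Y"
  shows "integrable M (\<lambda>\<omega>. X \<omega> \<bullet> Y \<omega>)"
proof (rule Bochner_Integration.integrable_bound)
  show "integrable M (\<lambda>\<omega>. (norm (X \<omega>))\<^sup>2 + (norm (Y \<omega>))\<^sup>2)"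
    using assms by (auto simp: sq_integrable_def)
  show "(\<lambda>\<omega>. X \<omega> \<bullet> Y \<omega>) \<in> borel_measurable M" using assms by (auto simp: sq_integrable_def)
  have "\<bar>a \<bullet> b\<bar> \<le> (norm a)\<^sup>2 + (norm b)\<^sup>2" for a b :: 'b
  proof -
    have "\<bar>a \<bullet> b\<bar> \<le> norm a * norm b" by (rule Cauchy_Schwarz_ineq2)
    also have "\<dots> \<le> (norm a)\<^sup>2 + (norm b)\<^sup>2"
      using sum_squares_bound[of "norm a" "norm b"] mult_nonneg_nonneg[OF norm_ge_zero norm_ge_zero, of a b]
      by linarith
    finally show ?thesis .
  qed
  then show "AE \<omega> in M. norm (X \<omega> \<bullet> Y \<omega>) \<le> norm ((norm (X \<omega>))\<^sup>2 + (norm (Y \<omega>))\<^sup>2)"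
    by (intro AE_I2) simp
qed

lemma sq_integrable_cong:
  assumes "\<And>\<omega>. \<omega> \<in> space M \<Longrightarrow> X \<omega> = Y \<omega>"
  shows "sq_integrable M X \<longleftrightarrow> sq_integrable M Y"
  unfolding sq_integrable_def
  using assms by (intro conj_cong measurable_cong Bochner_Integration.integrable_cong) auto

lemma (in finite_measure) sq_integrable_bounded:
  assumes "X \<in> borel_measurable M" "AE \<omega> in M. norm (X \<omega>) \<le> K"
  shows "sq_integrable M X"
proof (rule sq_integrable_dominated[where f = "\<lambda>_. K\<^sup>2"])
  show "AE \<omega> in M. (norm (X \<omega>))\<^sup>2 \<le> K\<^sup>2"
    using assms(2) by eventually_elim (auto intro: power_mono)
qed (use assms in auto)

lemma (in finite_measure) sq_integrable_integrable:
  assumes "sq_integrable M X"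
  shows "integrable M X"
proof (rule Bochner_Integration.integrable_bound)
  show "integrable M (\<lambda>\<omega>. 1 + (norm (X \<omega>))\<^sup>2)"
    using assms by (auto simp: sq_integrable_def)
  have "r \<le> 1 + r\<^sup>2" if "0 \<le> r" for r :: real
    using zero_le_power2[of "r - 1"] that unfolding power2_diff by (simp add: power2_eq_square)
  then show "AE \<omega> in M. norm (X \<omega>) \<le> norm (1 + (norm (X \<omega>))\<^sup>2)"
    by (intro AE_I2) simp
qed (use assms in \<open>auto simp: sq_integrable_def\<close>)

lemma integral_norm_add_sq:
  assumes "sq_integrable M X" "sq_integrable M Y"
  shows "(\<integral>\<omega>. (norm (X \<omega> + Y \<omega>))\<^sup>2 \<partial>M) =
    (\<integral>\<omega>. (norm (X \<omega>))\<^sup>2 \<partial>M) + 2 * (\<integral>\<omega>. X \<omega> \<bullet> Y \<omega> \<partial>M) + (\<integral>\<omega>. (norm (Y \<omega>))\<^sup>2 \<partial>M)"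
proof -
  have "(\<integral>\<omega>. (norm (X \<omega> + Y \<omega>))\<^sup>2 \<partial>M) =
      (\<integral>\<omega>. (norm (X \<omega>))\<^sup>2 + 2 * (X \<omega> \<bullet> Y \<omega>) + (norm (Y \<omega>))\<^sup>2 \<partial>M)"
    by (intro Bochner_Integration.integral_cong)
      (auto simp: power2_norm_eq_inner inner_simps inner_commute)
  then show ?thesis
    using assms sq_integrable_inner[OF assms] by (simp add: sq_integrable_def)
qed

lemma integral_norm_sum_sq_orthogonal:
  assumes "finite I" "\<And>i. i \<in> I \<Longrightarrow> sq_integrable M (X i)"
    and "\<And>i j. i \<in> I \<Longrightarrow> j \<in> I \<Longrightarrow> i \<noteq> j \<Longrightarrow> (\<integral>\<omega>. X i \<omega> \<bullet> X j \<omega> \<partial>M) = 0"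
  shows "(\<integral>\<omega>. (norm (\<Sum>i\<in>I. X i \<omega>))\<^sup>2 \<partial>M) = (\<Sum>i\<in>I. \<integral>\<omega>. (norm (X i \<omega>))\<^sup>2 \<partial>M)"
  using assms
proof (induction I rule: finite_induct)
  case (insert i I)
  have "(\<integral>\<omega>. X i \<omega> \<bullet> (\<Sum>j\<in>I. X j \<omega>) \<partial>M) = (\<Sum>j\<in>I. \<integral>\<omega>. X i \<omega> \<bullet> X j \<omega> \<partial>M)"
    unfolding inner_sum_right
    using insert.prems by (intro Bochner_Integration.integral_sum sq_integrable_inner) auto
  also have "\<dots> = 0"
    using insert by (intro sum.neutral) auto
  finally have 0: "(\<integral>\<omega>. X i \<omega> \<bullet> (\<Sum>j\<in>I. X j \<omega>) \<partial>M) = 0" .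
  have "(\<integral>\<omega>. (norm (X i \<omega> + (\<Sum>j\<in>I. X j \<omega>)))\<^sup>2 \<partial>M) =
      (\<integral>\<omega>. (norm (X i \<omega>))\<^sup>2 \<partial>M) + (\<integral>\<omega>. (norm (\<Sum>j\<in>I. X j \<omega>))\<^sup>2 \<partial>M)"
    using insert.prems 0 by (subst integral_norm_add_sq) (auto intro: sq_integrable_sum)
  then show ?case using insert by simp
qed simp

lemma (in prob_space) square_expectation_le:
  fixes f :: "'a \<Rightarrow> real"
  assumes "integrable M f" "integrable M (\<lambda>\<omega>. (f \<omega>)\<^sup>2)"
  shows "(expectation f)\<^sup>2 \<le> expectation (\<lambda>\<omega>. (f \<omega>)\<^sup>2)"
  using variance_eq[OF assms] variance_positive[of f] by simp

section \<open>Conditional independence\<close>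

lemma measurable_mono_space:
  "sets N \<subseteq> sets N' \<Longrightarrow> space N = space N' \<Longrightarrow> f \<in> N \<rightarrow>\<^sub>M K \<Longrightarrow> f \<in> N' \<rightarrow>\<^sub>M K"
  by (auto simp: measurable_def)

lemma (in prob_space) sigma_finite_subalgebraI:
  assumes "subalgebra M G"
  shows "sigma_finite_subalgebra M G"
proof -
  interpret finite_measure_subalgebra M G
    by unfold_locales (rule assms)
  show ?thesis by unfold_locales
qed

lemma (in prob_space) AE_cond_exp_indicator_bound:
  assumes sub: "subalgebra M G" and A: "A \<in> sets M"
  shows "AE \<omega> in M. \<bar>real_cond_exp M G (indicator A) \<omega>\<bar> \<le> 1"
proof -
  interpret sigma_finite_subalgebra M G by (rule sigma_finite_subalgebraI[OF sub])
  have i: "integrable M (indicator A :: 'a \<Rightarrow> real)"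
    using A by (simp add: integrable_indicator_iff emeasure_finite less_top[symmetric])
  have "AE \<omega> in M. real_cond_exp M G (indicator A) \<omega> \<ge> 0"
    by (rule real_cond_exp_ge_c[OF i]) simp
  moreover have "AE \<omega> in M. real_cond_exp M G (indicator A) \<omega> \<le> 1"
    by (rule real_cond_exp_le_c[OF i]) (simp add: indicator_def)
  ultimately show ?thesis by eventually_elim simp
qed

text \<open>Two events about disjoint subfamilies of a conditionally independent family are conditionally
independent: the constraint \<open>UNIV\<close> on a coordinate removes it from an event.\<close>

lemma (in prob_space) cond_indep_discrete_inter:
  assumes sub: "subalgebra M G"
    and ci: "cond_indep_discrete M G X K"
    and split: "\<And>k. k \<in> K \<Longrightarrow> A1 k = UNIV \<or> A2 k = UNIV"
  shows "AE \<omega> in M.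
    real_cond_exp M G (indicator {\<omega>'\<in>space M. \<forall>k\<in>K. X k \<omega>' \<in> A1 k \<inter> A2 k}) \<omega> =
    real_cond_exp M G (indicator {\<omega>'\<in>space M. \<forall>k\<in>K. X k \<omega>' \<in> A1 k}) \<omega> *
    real_cond_exp M G (indicator {\<omega>'\<in>space M. \<forall>k\<in>K. X k \<omega>' \<in> A2 k}) \<omega>"
proof -
  interpret sigma_finite_subalgebra M G by (rule sigma_finite_subalgebraI[OF sub])
  let ?p = "\<lambda>A k \<omega>. real_cond_exp M G (indicator {\<omega>'\<in>space M. X k \<omega>' \<in> A k}) \<omega>"
  have "AE \<omega> in M. real_cond_exp M G (\<lambda>\<omega>. 1) \<omega> = 1"
    by (rule real_cond_exp_F_meas) auto
  moreover have "AE \<omega> in M. real_cond_exp M G (indicator (space M)) \<omega> = real_cond_exp M G (\<lambda>\<omega>. 1) \<omega>"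
    by (rule real_cond_exp_cong) auto
  ultimately have one: "AE \<omega> in M. real_cond_exp M G (indicator (space M)) \<omega> = 1"
    by eventually_elim simp
  have prods: "AE \<omega> in M.
        real_cond_exp M G (indicator {\<omega>'\<in>space M. \<forall>k\<in>K. X k \<omega>' \<in> A k}) \<omega> = (\<Prod>k\<in>K. ?p A k \<omega>)" for A
    using ci unfolding cond_indep_discrete_def by blast
  show ?thesis
    using prods[of "\<lambda>k. A1 k \<inter> A2 k"] prods[of A1] prods[of A2] one
  proof eventually_elim
    case (elim \<omega>)
    have "(\<Prod>k\<in>K. ?p (\<lambda>k. A1 k \<inter> A2 k) k \<omega>) = (\<Prod>k\<in>K. ?p A1 k \<omega> * ?p A2 k \<omega>)"
    proof (rule prod.cong[OF refl])
      fix k assume "k \<in> K"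
      then show "?p (\<lambda>k. A1 k \<inter> A2 k) k \<omega> = ?p A1 k \<omega> * ?p A2 k \<omega>"
        using split[of k] elim(4) by auto
    qed
    then show ?case using elim by (simp add: prod.distrib)
  qed
qed

text \<open>The events \<open>E s\<close> (\<open>s \<in> SU\<close>) and \<open>D r\<close> (\<open>r \<in> SV\<close>) stand for the values of two discrete random variables
that are independent given \<open>G\<close>. If a function of the first one, with \<open>G\<close>-measurable coefficients \<open>X\<close>,
has vanishing conditional mean given \<open>G\<close>, then it is orthogonal to every function of the second one
with \<open>G\<close>-measurable coefficients \<open>Y\<close>. Conditioning on \<open>G\<close> replaces the indicator of \<open>D r\<close> by its
conditional probability, which is again an admissible test function.\<close>

lemma (in prob_space) cond_indep_orthogonal:
  fixes X :: "'u \<Rightarrow> 'a \<Rightarrow> real" and Y :: "'v \<Rightarrow> 'a \<Rightarrow> real"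
  assumes sub: "subalgebra M G" and fin: "finite SU" "finite SV"
    and E: "\<And>s. s \<in> SU \<Longrightarrow> E s \<in> sets M" and D: "\<And>r. r \<in> SV \<Longrightarrow> D r \<in> sets M"
    and X: "\<And>s. s \<in> SU \<Longrightarrow> X s \<in> borel_measurable G"
      "\<And>s \<omega>. s \<in> SU \<Longrightarrow> \<omega> \<in> space M \<Longrightarrow> \<bar>X s \<omega>\<bar> \<le> KX"
    and Y: "\<And>r. r \<in> SV \<Longrightarrow> Y r \<in> borel_measurable G"
      "\<And>r \<omega>. r \<in> SV \<Longrightarrow> \<omega> \<in> space M \<Longrightarrow> \<bar>Y r \<omega>\<bar> \<le> KY"
    and ci: "\<And>s r. s \<in> SU \<Longrightarrow> r \<in> SV \<Longrightarrow> AE \<omega> in M.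
      real_cond_exp M G (indicator (E s \<inter> D r)) \<omega> =
      real_cond_exp M G (indicator (E s)) \<omega> * real_cond_exp M G (indicator (D r)) \<omega>"
    and centred: "\<And>W. W \<in> borel_measurable G \<Longrightarrow> integrable M W \<Longrightarrow>
      (\<integral>\<omega>. (\<Sum>s\<in>SU. indicator (E s) \<omega> * X s \<omega>) * W \<omega> \<partial>M) = 0"
  shows "(\<integral>\<omega>. (\<Sum>s\<in>SU. indicator (E s) \<omega> * X s \<omega>) * (\<Sum>r\<in>SV. indicator (D r) \<omega> * Y r \<omega>) \<partial>M) = 0"
proof -
  interpret sigma_finite_subalgebra M G by (rule sigma_finite_subalgebraI[OF sub])
  note Xm = measurable_from_subalg[OF sub X(1)] and Ym = measurable_from_subalg[OF sub Y(1)]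
  have bint: "integrable M f" if "f \<in> borel_measurable M" "AE \<omega> in M. \<bar>f \<omega>\<bar> \<le> K" for f :: "'a \<Rightarrow> real" and K
    using that by (intro integrable_const_bound[where B = K]) auto
  have KX: "0 \<le> KX" if "s \<in> SU" for s
    using X(2)[OF that] not_empty by (meson abs_ge_zero all_not_in_conv order_trans)
  have KY: "0 \<le> KY" if "r \<in> SV" for r
    using Y(2)[OF that] not_empty by (meson abs_ge_zero all_not_in_conv order_trans)
  let ?P = "\<lambda>A. real_cond_exp M G (indicator A)"
  have term_eq: "(\<integral>\<omega>. (X s \<omega> * Y r \<omega>) * indicator (E s \<inter> D r) \<omega> \<partial>M)
      = (\<integral>\<omega>. (X s \<omega> * (Y r \<omega> * ?P (D r) \<omega>)) * indicator (E s) \<omega> \<partial>M)"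
    if sr: "s \<in> SU" "r \<in> SV" for s r
  proof -
    have XY: "\<bar>X s \<omega> * Y r \<omega>\<bar> \<le> KX * KY" if "\<omega> \<in> space M" for \<omega>
      using X(2)[OF sr(1) that] Y(2)[OF sr(2) that] KX[OF sr(1)]
      by (simp add: abs_mult mult_mono)
    have "(\<integral>\<omega>. (X s \<omega> * Y r \<omega>) * indicator (E s \<inter> D r) \<omega> \<partial>M)
        = (\<integral>\<omega>. (X s \<omega> * Y r \<omega>) * ?P (E s \<inter> D r) \<omega> \<partial>M)"
    proof (rule real_cond_exp_intg(2)[symmetric])
      show "integrable M (\<lambda>\<omega>. (X s \<omega> * Y r \<omega>) * indicator (E s \<inter> D r) \<omega>)"
      proof (rule bint)
        show "AE \<omega> in M. \<bar>(X s \<omega> * Y r \<omega>) * indicator (E s \<inter> D r) \<omega>\<bar> \<le> KX * KY"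
          using XY KX[OF sr(1)] KY[OF sr(2)] by (intro AE_I2) (auto simp: indicator_def)
      qed (use sr E D Xm Ym in auto)
    qed (use sr E D X Y in auto)
    also have "\<dots> = (\<integral>\<omega>. (X s \<omega> * (Y r \<omega> * ?P (D r) \<omega>)) * ?P (E s) \<omega> \<partial>M)"
      using ci[OF sr] sr Xm Ym
      by (intro integral_cong_AE) (auto simp: algebra_simps)
    also have "\<dots> = (\<integral>\<omega>. (X s \<omega> * (Y r \<omega> * ?P (D r) \<omega>)) * indicator (E s) \<omega> \<partial>M)"
    proof (rule real_cond_exp_intg(2))
      show "integrable M (\<lambda>\<omega>. X s \<omega> * (Y r \<omega> * ?P (D r) \<omega>) * indicator (E s) \<omega>)"
      proof (rule bint)
        show "AE \<omega> in M. \<bar>X s \<omega> * (Y r \<omega> * ?P (D r) \<omega>) * indicator (E s) \<omega>\<bar> \<le> KX * KY"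
          using AE_cond_exp_indicator_bound[OF sub D[OF sr(2)]] AE_space
        proof eventually_elim
          case (elim \<omega>)
          have "\<bar>(X s \<omega> * Y r \<omega>) * ?P (D r) \<omega>\<bar> \<le> (KX * KY) * 1"
            unfolding abs_mult[of "X s \<omega> * Y r \<omega>"]
            using XY[OF elim(2)] elim(1) KX[OF sr(1)] KY[OF sr(2)] by (intro mult_mono) auto
          then show ?case using KX[OF sr(1)] KY[OF sr(2)] by (auto simp: indicator_def mult.assoc)
        qed
      qed (use sr E D Xm Ym in auto)
    qed (use sr E X Y in auto)
    finally show ?thesis .
  qed
  have ind: "indicator (E s \<inter> D r) \<omega> = indicator (E s) \<omega> * (indicator (D r) \<omega> :: real)" for s r \<omega>
    by (simp add: indicator_def)
  have int1: "integrable M (\<lambda>\<omega>. (X s \<omega> * Y r \<omega>) * indicator (E s \<inter> D r) \<omega>)" if "s \<in> SU" "r \<in> SV" for s r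
  proof (rule bint)
    show "AE \<omega> in M. \<bar>(X s \<omega> * Y r \<omega>) * indicator (E s \<inter> D r) \<omega>\<bar> \<le> KX * KY"
      using X(2)[OF that(1)] Y(2)[OF that(2)] KX[OF that(1)] KY[OF that(2)]
      by (intro AE_I2) (auto simp: indicator_def abs_mult intro!: mult_mono)
  qed (use that E D Xm Ym in auto)
  have int2: "integrable M (\<lambda>\<omega>. (X s \<omega> * (Y r \<omega> * ?P (D r) \<omega>)) * indicator (E s) \<omega>)"
    if "s \<in> SU" "r \<in> SV" for s r
  proof (rule bint)
    show "AE \<omega> in M. \<bar>X s \<omega> * (Y r \<omega> * ?P (D r) \<omega>) * indicator (E s) \<omega>\<bar> \<le> KX * KY"
      using AE_cond_exp_indicator_bound[OF sub D[OF that(2)]] AE_space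
    proof eventually_elim
      case (elim \<omega>)
      have "\<bar>X s \<omega>\<bar> * (\<bar>Y r \<omega>\<bar> * \<bar>?P (D r) \<omega>\<bar>) \<le> KX * (KY * 1)"
        using X(2)[OF that(1) elim(2)] Y(2)[OF that(2) elim(2)] elim(1) KX[OF that(1)] KY[OF that(2)]
        by (intro mult_mono) auto
      then show ?case using KX[OF that(1)] KY[OF that(2)] by (auto simp: indicator_def abs_mult)
    qed
  qed (use that E D Xm Ym in auto)
  have "(\<integral>\<omega>. (\<Sum>s\<in>SU. indicator (E s) \<omega> * X s \<omega>) * (\<Sum>r\<in>SV. indicator (D r) \<omega> * Y r \<omega>) \<partial>M)
      = (\<integral>\<omega>. (\<Sum>r\<in>SV. \<Sum>s\<in>SU. (X s \<omega> * Y r \<omega>) * indicator (E s \<inter> D r) \<omega>) \<partial>M)"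
    by (subst sum.swap) (simp add: sum_product ind mult_ac)
  also have "\<dots> = (\<Sum>r\<in>SV. \<Sum>s\<in>SU. \<integral>\<omega>. (X s \<omega> * Y r \<omega>) * indicator (E s \<inter> D r) \<omega> \<partial>M)"
    using int1 by (simp add: Bochner_Integration.integral_sum)
  also have "\<dots> = (\<Sum>r\<in>SV. \<Sum>s\<in>SU. \<integral>\<omega>. (X s \<omega> * (Y r \<omega> * ?P (D r) \<omega>)) * indicator (E s) \<omega> \<partial>M)"
    by (intro sum.cong refl term_eq)
  also have "\<dots> = (\<Sum>r\<in>SV. \<integral>\<omega>. (\<Sum>s\<in>SU. indicator (E s) \<omega> * X s \<omega>) * (Y r \<omega> * ?P (D r) \<omega>) \<partial>M)"
  proof (intro sum.cong refl)
    fix r assume r: "r \<in> SV"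
    have "(\<Sum>s\<in>SU. \<integral>\<omega>. (X s \<omega> * (Y r \<omega> * ?P (D r) \<omega>)) * indicator (E s) \<omega> \<partial>M)
        = (\<integral>\<omega>. (\<Sum>s\<in>SU. (X s \<omega> * (Y r \<omega> * ?P (D r) \<omega>)) * indicator (E s) \<omega>) \<partial>M)"
      using int2 r by (intro Bochner_Integration.integral_sum[symmetric]) auto
    also have "\<dots> = (\<integral>\<omega>. (\<Sum>s\<in>SU. indicator (E s) \<omega> * X s \<omega>) * (Y r \<omega> * ?P (D r) \<omega>) \<partial>M)"
      unfolding sum_distrib_right
      by (intro Bochner_Integration.integral_cong sum.cong refl) (simp only: mult_ac)
    finally show "(\<Sum>s\<in>SU. \<integral>\<omega>. (X s \<omega> * (Y r \<omega> * ?P (D r) \<omega>)) * indicator (E s) \<omega> \<partial>M)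
        = (\<integral>\<omega>. (\<Sum>s\<in>SU. indicator (E s) \<omega> * X s \<omega>) * (Y r \<omega> * ?P (D r) \<omega>) \<partial>M)" .
  qed
  also have "\<dots> = 0"
  proof (intro sum.neutral ballI centred)
    fix r assume r: "r \<in> SV"
    show "integrable M (\<lambda>\<omega>. Y r \<omega> * ?P (D r) \<omega>)"
    proof (rule bint)
      show "AE \<omega> in M. \<bar>Y r \<omega> * ?P (D r) \<omega>\<bar> \<le> KY"
        using AE_cond_exp_indicator_bound[OF sub D[OF r]] AE_space
      proof eventually_elim
        case (elim \<omega>)
        have "\<bar>Y r \<omega>\<bar> * \<bar>?P (D r) \<omega>\<bar> \<le> KY * 1"
          using Y(2)[OF r elim(2)] elim(1) KY[OF r] by (intro mult_mono) auto
        then show ?case by (simp add: abs_mult)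
      qed
    qed (use r D Ym in auto)
  qed (use Y in auto)
  finally show ?thesis .
qed

section \<open>A run of the algorithm\<close>

text \<open>The local iterate after \<open>l\<close> steps with step size \<open>\<eta>\<close> from the point \<open>z\<close>, as a deterministic function of
the sequence \<open>s\<close> of minibatches; \<open>v\<close> is the control-variate correction, which is constant during a round.\<close>

primrec local_iter ::
    "('a::euclidean_space) fed_problem \<Rightarrow> nat \<Rightarrow> real \<Rightarrow> 'a \<Rightarrow> 'a \<Rightarrow> (nat \<Rightarrow> nat set) \<Rightarrow> nat \<Rightarrow> 'a" where
  "local_iter P i \<eta> z v s 0 = z"
| "local_iter P i \<eta> z v s (Suc l) = local_iter P i \<eta> z v s l
     - \<eta> *\<^sub>R (minibatch_grad P i (s l) (local_iter P i \<eta> z v s l) + v)"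

lemma local_iter_cong:
  "(\<And>k. k < l \<Longrightarrow> s k = s' k) \<Longrightarrow> local_iter P i \<eta> z v s l = local_iter P i \<eta> z v s' l"
  by (induction l) auto

text \<open>A run of the algorithm with deterministic, feasible weights and amplitudes, under the standing
assumptions on the stochastic gradients. How the weights and amplitudes were chosen plays no role here.\<close>

locale hew_run = prob_space M
  for M :: "'w measure" +
  fixes P :: "('a::euclidean_space) fed_problem"
    and B :: "nat \<Rightarrow> nat \<Rightarrow> nat \<Rightarrow> 'w \<Rightarrow> nat set"
    and x :: "nat \<Rightarrow> 'w \<Rightarrow> 'a"
    and y :: "nat \<Rightarrow> nat \<Rightarrow> nat \<Rightarrow> 'w \<Rightarrow> 'a"
    and c :: "nat \<Rightarrow> nat \<Rightarrow> 'w \<Rightarrow> 'a"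
    and cs :: "nat \<Rightarrow> 'w \<Rightarrow> 'a"
    and w \<theta> :: "nat \<Rightarrow> nat \<Rightarrow> real"
    and \<theta>lo \<theta>hi :: real
  assumes problem: "convex_smooth_problem P"
    and amplitudes: "0 < \<theta>lo" "\<theta>lo \<le> \<theta>hi" "\<theta>hi \<le> 1"
    and contraction: "C_chi \<theta>hi < 1"
    and x0_measurable: "x 0 \<in> borel_measurable M"
    and c0_measurable: "\<And>i. i < nodes P \<Longrightarrow> c i 0 \<in> borel_measurable M"
    and minibatch_measurable: "\<And>i t l. i < nodes P \<Longrightarrow> l < horizon P i \<Longrightarrow>
      B i t l \<in> M \<rightarrow>\<^sub>M count_space (Pow {..<samples P i})"
    and algorithm: "\<And>\<omega>. \<omega> \<in> space M \<Longrightarrow>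
      hew_local_sgd P w \<theta> (\<lambda>i t l. B i t l \<omega>) (\<lambda>t. x t \<omega>) (\<lambda>i t l. y i t l \<omega>)
        (\<lambda>i t. c i t \<omega>) (\<lambda>t. cs t \<omega>)"
    and in_ball: "AE \<omega> in M. \<forall>t. x t \<omega> \<in> trust_ball P \<and>
      (\<forall>i<nodes P. \<forall>l\<le>horizon P i. y i t l \<omega> \<in> trust_ball P)"
    and independent: "\<And>i t l. i < nodes P \<Longrightarrow> l < horizon P i \<Longrightarrow>
      cond_indep_discrete M (local_history P M (x 0) (\<lambda>i. c i 0) B i t l)
        (\<lambda>(j, k). B j t k) {(j, k). j < nodes P \<and> k < horizon P j}"
    and unbiased: "\<And>i t l. i < nodes P \<Longrightarrow> l < horizon P i \<Longrightarrow>
      AE \<omega> in M. vec_cond_exp M (local_history P M (x 0) (\<lambda>i. c i 0) B i t l)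
        (\<lambda>\<omega>. minibatch_grad P i (B i t l \<omega>) (y i t l \<omega>)) \<omega> = grad (node_obj P i) (y i t l \<omega>)"
    and variance: "\<And>i t l. i < nodes P \<Longrightarrow> l < horizon P i \<Longrightarrow>
      AE \<omega> in M. real_cond_exp M (local_history P M (x 0) (\<lambda>i. c i 0) B i t l)
        (\<lambda>\<omega>'. (norm (minibatch_grad P i (B i t l \<omega>') (y i t l \<omega>')
          - grad (node_obj P i) (y i t l \<omega>')))\<^sup>2) \<omega>
        \<le> vsq P i / real (batch P i)"
    and weights: "\<And>t. feasible P \<theta>lo \<theta>hi (w t, \<theta> t)"
begin

text \<open>\<open>gF\<close> and \<open>gf i\<close> are the gradients of the global and of the local objectives, \<open>rh\<close> and \<open>lh\<close> the round and local
histories, and \<open>sg\<close> the minibatch gradients.\<close>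

abbreviation "n \<equiv> nodes P"
abbreviation "L \<equiv> smoothness P"
abbreviation "H \<equiv> horizon P"
abbreviation "gF \<equiv> grad (global_obj P)"
abbreviation "gf i \<equiv> grad (node_obj P i)"
abbreviation "\<eta> i t \<equiv> stepsize P \<theta> i t"
abbreviation "rh t \<equiv> round_history P M (x 0) (\<lambda>i. c i 0) B t"
abbreviation "lh i t l \<equiv> local_history P M (x 0) (\<lambda>i. c i 0) B i t l"
abbreviation "sg i t l \<omega> \<equiv> minibatch_grad P i (B i t l \<omega>) (y i t l \<omega>)"

text \<open>The noise of the minibatch gradient that node \<open>i\<close> uses in local step \<open>l\<close> of round \<open>t\<close>.\<close>

definition \<xi> :: "nat \<Rightarrow> nat \<Rightarrow> nat \<Rightarrow> 'w \<Rightarrow> 'a" where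
  "\<xi> i t l \<omega> = sg i t l \<omega> - gf i (y i t l \<omega>)"

text \<open>The error of the control variate of node \<open>i\<close> as an estimate of the gradient of its objective at \<open>x t\<close>.\<close>

definition e :: "nat \<Rightarrow> nat \<Rightarrow> 'w \<Rightarrow> 'a" where
  "e i t \<omega> = c i t \<omega> - gf i (x t \<omega>)"

text \<open>The direction that node \<open>i\<close> would follow in a local step at the point \<open>x t\<close> with exact gradients.\<close>

definition q :: "nat \<Rightarrow> nat \<Rightarrow> 'w \<Rightarrow> 'a" where
  "q i t \<omega> = gf i (x t \<omega>) - c i t \<omega> + cs t \<omega>"

lemma n_pos: "1 \<le> n" and L_pos: "0 < L" and R_pos: "0 < radius P"
  and H_pos: "i < n \<Longrightarrow> 1 \<le> H i" and samples_pos: "i < n \<Longrightarrow> 1 \<le> samples P i"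
  and batch_pos: "i < n \<Longrightarrow> 1 \<le> batch P i"
  and loss_smooth: "i < n \<Longrightarrow> j < samples P i \<Longrightarrow> smooth_fun L (loss P i j)"
  and loss_convex: "i < n \<Longrightarrow> j < samples P i \<Longrightarrow> convex_on UNIV (loss P i j)"
  and global_min: "global_obj P (minimizer P) \<le> global_obj P z"
  using problem by (auto simp: convex_smooth_problem_def is_arg_min_def not_less)

lemma node_smooth: "i < n \<Longrightarrow> smooth_fun L (node_obj P i)"
  using smooth_fun_mean(1)[where f = "loss P i" and n = "samples P i", OF loss_smooth samples_pos]
  by (simp add: node_obj_def[abs_def])

lemma global_smooth: "smooth_fun L (global_obj P)"
  and gF_eq: "gF z = (1 / real n) *\<^sub>R (\<Sum>i<n. gf i z)"
  using smooth_fun_mean[where f = "node_obj P" and n = n, OF node_smooth n_pos]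
  by (simp_all add: global_obj_def[abs_def])

lemma global_convex: "convex_on UNIV (global_obj P)"
proof -
  have "convex_on UNIV (node_obj P i)" if "i < n" for i
    unfolding node_obj_def[abs_def] using that by (intro convex_on_mean loss_convex)
  then show ?thesis unfolding global_obj_def[abs_def] by (intro convex_on_mean)
qed

lemma w_nonneg: "i < n \<Longrightarrow> 0 \<le> w t i" and w_sum: "(\<Sum>i<n. w t i) = 1"
  and \<theta>_ge: "i < n \<Longrightarrow> \<theta>lo \<le> \<theta> t i" and \<theta>_le: "i < n \<Longrightarrow> \<theta> t i \<le> \<theta>hi"
  using weights[of t] by (auto simp: feasible_def)

lemma \<theta>_pos: "i < n \<Longrightarrow> 0 < \<theta> t i"
  using \<theta>_ge[of i t] amplitudes by simp

text \<open>The contraction hypothesis on \<open>C_chi\<close> bounds all amplitudes by an absolute constant. The one-round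
estimates below rest on this smallness.\<close>

lemma \<theta>hi_sq: "\<theta>hi\<^sup>2 < 1 / 288"
  using contraction by (simp add: C_chi_def)

lemma \<theta>hi_small: "\<theta>hi \<le> 1 / 16"
proof (rule power2_le_imp_le)
  show "\<theta>hi\<^sup>2 \<le> (1 / 16)\<^sup>2" using \<theta>hi_sq by (simp add: power2_eq_square)
qed simp

lemma \<eta>_pos: "i < n \<Longrightarrow> 0 < \<eta> i t"
  using \<theta>_pos[of i t] L_pos H_pos[of i] by (simp add: stepsize_def)

lemma \<eta>_H: "i < n \<Longrightarrow> \<eta> i t * real (H i) = \<theta> t i / L"
  using H_pos[of i] L_pos by (simp add: stepsize_def field_simps)

lemma y_0: "\<omega> \<in> space M \<Longrightarrow> i < n \<Longrightarrow> y i t 0 \<omega> = x t \<omega>"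
  and y_Suc: "\<omega> \<in> space M \<Longrightarrow> i < n \<Longrightarrow> l < H i \<Longrightarrow>
    y i t (Suc l) \<omega> = y i t l \<omega> - \<eta> i t *\<^sub>R (sg i t l \<omega> - c i t \<omega> + cs t \<omega>)"
  and x_Suc: "\<omega> \<in> space M \<Longrightarrow>
    x (Suc t) \<omega> = x t \<omega> + (\<Sum>i<n. w t i *\<^sub>R (y i t (H i) \<omega> - x t \<omega>))"
  using algorithm[of \<omega>] by (simp_all add: hew_local_sgd_def)

lemma cs_mean:
  assumes "\<omega> \<in> space M"
  shows "cs t \<omega> = (1 / real n) *\<^sub>R (\<Sum>i<n. c i t \<omega>)"
proof (induction t)
  case 0
  then show ?case using algorithm[OF assms] by (simp add: hew_local_sgd_def)
next
  case (Suc t)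
  have "cs (Suc t) \<omega> = cs t \<omega> + (1 / real n) *\<^sub>R (\<Sum>i<n. c i (Suc t) \<omega> - c i t \<omega>)"
    using algorithm[OF assms] by (simp add: hew_local_sgd_def)
  then show ?case by (simp add: Suc sum_subtractf algebra_simps)
qed

lemma y_displacement:
  assumes "\<omega> \<in> space M" "i < n" "l \<le> H i"
  shows "y i t l \<omega> - x t \<omega> = - \<eta> i t *\<^sub>R (\<Sum>k<l. sg i t k \<omega> - c i t \<omega> + cs t \<omega>)"
  using assms(3)
proof (induction l)
  case 0
  then show ?case using assms by (simp add: y_0)
next
  case (Suc l)
  then have "y i t (Suc l) \<omega> - x t \<omega> = (y i t l \<omega> - x t \<omega>)
      - \<eta> i t *\<^sub>R (sg i t l \<omega> - c i t \<omega> + cs t \<omega>)"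
    using assms y_Suc[of \<omega> i l t] by simp
  then show ?case using Suc by (simp add: scaleR_add_right)
qed

text \<open>The new control variate is the average of the minibatch gradients of the round: the corrections
cancel.\<close>

lemma c_Suc:
  assumes "\<omega> \<in> space M" "i < n"
  shows "c i (Suc t) \<omega> = (1 / real (H i)) *\<^sub>R (\<Sum>l<H i. sg i t l \<omega>)"
proof -
  let ?S = "\<Sum>l<H i. sg i t l \<omega>"
  have H: "real (H i) \<noteq> 0" using H_pos[OF assms(2)] by simp
  have "x t \<omega> - y i t (H i) \<omega> = \<eta> i t *\<^sub>R (\<Sum>k<H i. sg i t k \<omega> - c i t \<omega> + cs t \<omega>)"
    using arg_cong[OF y_displacement[OF assms order_refl, of t], of uminus] by simp
  also have "\<dots> = \<eta> i t *\<^sub>R (?S - real (H i) *\<^sub>R (c i t \<omega> - cs t \<omega>))"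
  proof -
    have "(\<Sum>k<H i. sg i t k \<omega> - c i t \<omega> + cs t \<omega>) = (\<Sum>k<H i. sg i t k \<omega> - (c i t \<omega> - cs t \<omega>))"
      by (intro sum.cong) auto
    also have "\<dots> = ?S - real (H i) *\<^sub>R (c i t \<omega> - cs t \<omega>)"
      by (simp only: sum_subtractf sum_constant_scaleR card_lessThan scaleR_diff_right)
    finally show ?thesis by (rule arg_cong)
  qed
  finally have "(1 / (real (H i) * \<eta> i t)) *\<^sub>R (x t \<omega> - y i t (H i) \<omega>)
      = (1 / real (H i)) *\<^sub>R ?S - (c i t \<omega> - cs t \<omega>)"
    using H \<eta>_pos[OF assms(2), of t] by (simp add: scaleR_diff_right[of "_ / _"])
  moreover have "c i (Suc t) \<omega> = c i t \<omega> - cs t \<omega>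
      + (1 / (real (H i) * \<eta> i t)) *\<^sub>R (x t \<omega> - y i t (H i) \<omega>)"
    using algorithm[OF assms(1)] assms(2) by (simp add: hew_local_sgd_def)
  ultimately show ?thesis by simp
qed

text \<open>The average of the control-variate errors appears because the server variate is the mean of the
nodes' variates and the global gradient is the mean of the nodes' gradients.\<close>

lemma q_eq:
  assumes "\<omega> \<in> space M"
  shows "q i t \<omega> = gF (x t \<omega>) + ((1 / real n) *\<^sub>R (\<Sum>j<n. e j t \<omega>) - e i t \<omega>)"
  using cs_mean[OF assms, of t]
  by (simp add: q_def e_def gF_eq sum_subtractf scaleR_diff_right)

lemma y_eq_local_iter:
  assumes "\<omega> \<in> space M" "i < n" "l \<le> H i"
  shows "y i t l \<omega> = local_iter P i (\<eta> i t) (x t \<omega>) (cs t \<omega> - c i t \<omega>) (\<lambda>k. B i t k \<omega>) l"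
  using assms(3)
proof (induction l)
  case 0
  then show ?case using assms by (simp add: y_0)
next
  case (Suc l)
  then show ?case using assms y_Suc[of \<omega> i l t] by (simp add: algebra_simps)
qed

section \<open>Measurability of the run\<close>

lemma B_subset: "i < n \<Longrightarrow> l < H i \<Longrightarrow> \<omega> \<in> space M \<Longrightarrow> B i t l \<omega> \<subseteq> {..<samples P i}"
  using measurable_space[OF minibatch_measurable[of i l t]] by auto

lemma B_event:
  assumes "i < n" "l < H i"
  shows "B i t l -` A \<inter> space M \<in> sets M"
proof -
  have "B i t l -` A \<inter> space M = B i t l -` (A \<inter> Pow {..<samples P i}) \<inter> space M"
    using B_subset[OF assms] by auto
  also have "\<dots> \<in> sets M"
    by (rule measurable_sets[OF minibatch_measurable[OF assms]]) auto
  finally show ?thesis .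
qed

lemma space_rh [simp]: "space (rh t) = space M"
  unfolding round_history_def by (rule space_measure_of) auto

lemma space_lh [simp]: "space (lh i t l) = space M"
  unfolding local_history_def using sets.space_closed[of "rh t"]
  by (intro space_measure_of) auto

lemma sets_rh: "sets (rh t) = sigma_sets (space M)
     ({x 0 -` A \<inter> space M | A. A \<in> sets borel} \<union>
      {c i 0 -` A \<inter> space M | i A. i < n \<and> A \<in> sets borel} \<union>
      {B i s l -` A \<inter> space M | i s l A. i < n \<and> s < t \<and> l < H i})"
  unfolding round_history_def by (rule sets_measure_of) auto

lemma sets_lh: "sets (lh i t l) = sigma_sets (space M)
     (sets (rh t) \<union> {B i t k -` A \<inter> space M | k A. k < l})"
  unfolding local_history_def using sets.space_closed[of "rh t"]
  by (intro sets_measure_of) auto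

lemma rh_subset_M: "sets (rh t) \<subseteq> sets M"
  unfolding sets_rh
  using B_event measurable_sets[OF x0_measurable] measurable_sets[OF c0_measurable]
  by (intro sets.sigma_sets_subset) auto

lemma lh_subset_M: "i < n \<Longrightarrow> l \<le> H i \<Longrightarrow> sets (lh i t l) \<subseteq> sets M"
  unfolding sets_lh using B_event rh_subset_M by (intro sets.sigma_sets_subset) auto

lemma rh_subset_lh: "sets (rh t) \<subseteq> sets (lh i t l)"
  unfolding sets_lh by (auto intro: sigma_sets.Basic)

lemma lh_mono: "l \<le> l' \<Longrightarrow> sets (lh i t l) \<subseteq> sets (lh i t l')"
  unfolding sets_lh by (intro sigma_sets_mono' Un_mono order_refl) fastforce

lemma rh_mono: "sets (rh t) \<subseteq> sets (rh (Suc t))"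
  unfolding sets_rh by (intro sigma_sets_mono' Un_mono order_refl) fastforce

lemma lh_subset_rh_Suc:
  assumes "i < n" "l \<le> H i"
  shows "sets (lh i t l) \<subseteq> sets (rh (Suc t))"
proof -
  have "sigma_sets (space (rh (Suc t))) (sets (rh t) \<union> {B i t k -` A \<inter> space M | k A. k < l})
      \<subseteq> sets (rh (Suc t))"
  proof (intro sets.sigma_sets_subset Un_least rh_mono subsetI)
    fix E assume "E \<in> {B i t k -` A \<inter> space M | k A. k < l}"
    then obtain k A where "E = B i t k -` A \<inter> space M" "k < l" by auto
    then have "E \<in> {B i s l -` A \<inter> space M | i s l A. i < n \<and> s < Suc t \<and> l < H i}"
      using assms less_le_trans by blast
    then show "E \<in> sets (rh (Suc t))"
      unfolding sets_rh by (intro sigma_sets.Basic UnI2)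
  qed
  then show ?thesis unfolding sets_lh by simp
qed

lemma subalgebra_lh: "i < n \<Longrightarrow> l \<le> H i \<Longrightarrow> subalgebra M (lh i t l)"
  using lh_subset_M by (simp add: subalgebra_def)

lemma B_lh_measurable: "k < l \<Longrightarrow> B i t k \<in> lh i t l \<rightarrow>\<^sub>M count_space UNIV"
  by (auto simp: measurable_def sets_lh intro!: sigma_sets.Basic)

lemma minibatch_grad_eq:
  assumes "S \<subseteq> {..<samples P i}"
  shows "minibatch_grad P i S z = (1 / real (batch P i)) *\<^sub>R
    (\<Sum>j<samples P i. if j \<in> S then grad (loss P i j) z else 0)"
  using assms unfolding minibatch_grad_def
  by (simp add: sum.If_cases Int_absorb1)

lemma minibatch_grad_measurable:
  assumes i: "i < n" and b: "b \<in> N \<rightarrow>\<^sub>M count_space UNIV" and z: "z \<in> borel_measurable N"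
    and sub: "\<And>\<omega>. \<omega> \<in> space N \<Longrightarrow> b \<omega> \<subseteq> {..<samples P i}"
  shows "(\<lambda>\<omega>. minibatch_grad P i (b \<omega>) (z \<omega>)) \<in> borel_measurable N"
proof -
  have "(\<lambda>\<omega>. (1 / real (batch P i)) *\<^sub>R
      (\<Sum>j<samples P i. if j \<in> b \<omega> then grad (loss P i j) (z \<omega>) else 0)) \<in> borel_measurable N"
  proof (intro borel_measurable_scaleR borel_measurable_sum borel_measurable_const)
    fix j assume "j \<in> {..<samples P i}"
    then have g: "grad (loss P i j) \<in> borel_measurable borel"
      using smooth_fun_grad_measurable[OF loss_smooth[OF i]] by simp
    have "b -` {S. j \<in> S} \<inter> space N \<in> sets N" by (rule measurable_sets[OF b]) auto
    then have "{\<omega> \<in> space N. j \<in> b \<omega>} \<in> sets N"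
      by (simp add: vimage_def Int_def conj_commute)
    then show "(\<lambda>\<omega>. if j \<in> b \<omega> then grad (loss P i j) (z \<omega>) else 0) \<in> borel_measurable N"
      by (intro measurable_If measurable_compose[OF z g]) auto
  qed
  then show ?thesis
    using sub by (subst measurable_cong[OF minibatch_grad_eq]) auto
qed

lemma local_iter_measurable:
  assumes i: "i < n" and z: "z \<in> borel_measurable N" and v: "v \<in> borel_measurable N"
    and b: "\<And>k. k < l \<Longrightarrow> b k \<in> N \<rightarrow>\<^sub>M count_space UNIV"
    and sub: "\<And>k \<omega>. k < l \<Longrightarrow> \<omega> \<in> space N \<Longrightarrow> b k \<omega> \<subseteq> {..<samples P i}"
  shows "(\<lambda>\<omega>. local_iter P i h (z \<omega>) (v \<omega>) (\<lambda>k. b k \<omega>) l) \<in> borel_measurable N"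
  using b sub
proof (induction l)
  case 0
  then show ?case using z by simp
next
  case (Suc l)
  have IH: "(\<lambda>\<omega>. local_iter P i h (z \<omega>) (v \<omega>) (\<lambda>k. b k \<omega>) l) \<in> borel_measurable N"
    using Suc by simp
  have "(\<lambda>\<omega>. minibatch_grad P i (b l \<omega>) (local_iter P i h (z \<omega>) (v \<omega>) (\<lambda>k. b k \<omega>) l))
      \<in> borel_measurable N"
    using Suc.prems by (intro minibatch_grad_measurable[OF i _ IH]) auto
  then show ?case using IH v by simp
qed

lemma y_measurable_if:
  assumes i: "i < n" and l: "l \<le> H i" and x: "x t \<in> borel_measurable (rh t)"
    and cc: "c i t \<in> borel_measurable (rh t)" "cs t \<in> borel_measurable (rh t)"
  shows "y i t l \<in> borel_measurable (lh i t l)"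
proof -
  have lift: "f \<in> borel_measurable (lh i t l)" if "f \<in> borel_measurable (rh t)" for f :: "'w \<Rightarrow> 'a"
    by (rule measurable_mono_space[OF rh_subset_lh _ that]) simp
  have "(\<lambda>\<omega>. local_iter P i (\<eta> i t) (x t \<omega>) (cs t \<omega> - c i t \<omega>) (\<lambda>k. B i t k \<omega>) l)
      \<in> borel_measurable (lh i t l)"
    using l B_subset[OF i] lift[OF x] lift[OF cc(1)] lift[OF cc(2)]
    by (intro local_iter_measurable[OF i] B_lh_measurable borel_measurable_diff) auto
  then show ?thesis
    using i l by (subst measurable_cong[OF y_eq_local_iter]) auto
qed

lemma sg_measurable_if:
  assumes i: "i < n" and l: "k < l" "l \<le> H i" and y: "y i t k \<in> borel_measurable (lh i t k)"
  shows "sg i t k \<in> borel_measurable (lh i t l)"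
proof (rule minibatch_grad_measurable[OF i B_lh_measurable[OF l(1)]])
  show "y i t k \<in> borel_measurable (lh i t l)"
    by (rule measurable_mono_space[OF lh_mono _ y]) (use l in auto)
  show "B i t k \<omega> \<subseteq> {..<samples P i}" if "\<omega> \<in> space (lh i t l)" for \<omega>
    using that l by (intro B_subset[OF i]) auto
qed

lemma state_measurable:
  "x t \<in> borel_measurable (rh t) \<and> cs t \<in> borel_measurable (rh t) \<and>
   (\<forall>i<n. c i t \<in> borel_measurable (rh t))"
proof (induction t)
  case 0
  have x: "x 0 \<in> borel_measurable (rh 0)"
    by (auto simp: measurable_def sets_rh intro!: sigma_sets.Basic)
  have c: "c i 0 \<in> borel_measurable (rh 0)" if "i < n" for i
    using that by (auto simp: measurable_def sets_rh intro!: sigma_sets.Basic)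
  have "(\<lambda>\<omega>. (1 / real n) *\<^sub>R (\<Sum>i<n. c i 0 \<omega>)) \<in> borel_measurable (rh 0)"
    using c by (intro borel_measurable_scaleR borel_measurable_sum) auto
  then have "cs 0 \<in> borel_measurable (rh 0)" by (subst measurable_cong[OF cs_mean]) auto
  then show ?case using x c by simp
next
  case (Suc t)
  let ?N = "rh (Suc t)"
  have lift: "f \<in> borel_measurable ?N" if "f \<in> borel_measurable (lh i t (H i))" "i < n"
    for f :: "'w \<Rightarrow> 'a" and i
    by (rule measurable_mono_space[OF lh_subset_rh_Suc _ that(1)]) (use that in auto)
  have y: "y i t l \<in> borel_measurable (lh i t l)" if "i < n" "l \<le> H i" for i l
    using y_measurable_if[OF that] Suc that by simp
  have c: "c i (Suc t) \<in> borel_measurable ?N" if "i < n" for i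
  proof -
    have "(\<lambda>\<omega>. (1 / real (H i)) *\<^sub>R (\<Sum>l<H i. sg i t l \<omega>)) \<in> borel_measurable ?N"
      using that by (intro borel_measurable_scaleR borel_measurable_sum borel_measurable_const
        lift[of _ i] sg_measurable_if y) auto
    then show ?thesis using that by (subst measurable_cong[OF c_Suc]) auto
  qed
  have x: "x (Suc t) \<in> borel_measurable ?N"
  proof -
    have "x t \<in> borel_measurable ?N"
      by (rule measurable_mono_space[OF rh_mono]) (use Suc in auto)
    then have "(\<lambda>\<omega>. x t \<omega> + (\<Sum>i<n. w t i *\<^sub>R (y i t (H i) \<omega> - x t \<omega>))) \<in> borel_measurable ?N"
      by (intro borel_measurable_add borel_measurable_sum borel_measurable_scaleR
        borel_measurable_diff borel_measurable_const lift[OF y]) auto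
    then show ?thesis by (subst measurable_cong[OF x_Suc]) auto
  qed
  have "(\<lambda>\<omega>. (1 / real n) *\<^sub>R (\<Sum>i<n. c i (Suc t) \<omega>)) \<in> borel_measurable ?N"
    using c by (intro borel_measurable_scaleR borel_measurable_sum) auto
  then have "cs (Suc t) \<in> borel_measurable ?N" by (subst measurable_cong[OF cs_mean]) auto
  then show ?case using x c by simp
qed

lemma lift_rh: "f \<in> borel_measurable (rh t) \<Longrightarrow> f \<in> borel_measurable (lh i t l)"
  by (rule measurable_mono_space[OF rh_subset_lh]) auto

lemma lift_M: "i < n \<Longrightarrow> l \<le> H i \<Longrightarrow> f \<in> borel_measurable (lh i t l) \<Longrightarrow> f \<in> borel_measurable M"
  by (rule measurable_mono_space[OF lh_subset_M]) auto

lemma x_meas: "x t \<in> borel_measurable (rh t)" and cs_meas: "cs t \<in> borel_measurable (rh t)"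
  and c_meas: "i < n \<Longrightarrow> c i t \<in> borel_measurable (rh t)"
  using state_measurable by auto

lemma rh_M: "f \<in> borel_measurable (rh t) \<Longrightarrow> f \<in> borel_measurable M"
  by (rule measurable_mono_space[OF rh_subset_M]) auto

lemmas x_measM = rh_M[OF x_meas] and cs_measM = rh_M[OF cs_meas] and c_measM = rh_M[OF c_meas]

lemma y_meas: "i < n \<Longrightarrow> l \<le> H i \<Longrightarrow> y i t l \<in> borel_measurable (lh i t l)"
  by (intro y_measurable_if x_meas cs_meas c_meas)

lemma y_measM: "i < n \<Longrightarrow> l \<le> H i \<Longrightarrow> y i t l \<in> borel_measurable M"
  by (rule lift_M[OF _ _ y_meas])

lemma sg_meas: "i < n \<Longrightarrow> k < l \<Longrightarrow> l \<le> H i \<Longrightarrow> sg i t k \<in> borel_measurable (lh i t l)"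
  by (intro sg_measurable_if y_meas) auto

lemma gf_meas: "i < n \<Longrightarrow> z \<in> borel_measurable N \<Longrightarrow> (\<lambda>\<omega>. gf i (z \<omega>)) \<in> borel_measurable N"
  using smooth_fun_grad_measurable[OF node_smooth] by (rule measurable_compose[rotated])

lemma gF_meas: "z \<in> borel_measurable N \<Longrightarrow> (\<lambda>\<omega>. gF (z \<omega>)) \<in> borel_measurable N"
  using smooth_fun_grad_measurable[OF global_smooth] by (rule measurable_compose[rotated])

lemma \<xi>_meas:
  assumes "i < n" "k < l" "l \<le> H i"
  shows "\<xi> i t k \<in> borel_measurable (lh i t l)"
proof -
  have "y i t k \<in> borel_measurable (lh i t l)"
    by (rule measurable_mono_space[OF lh_mono _ y_meas]) (use assms in auto)
  then show ?thesis unfolding \<xi>_def[abs_def]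
    by (intro borel_measurable_diff sg_meas gf_meas assms)
qed

lemma \<xi>_measM: "i < n \<Longrightarrow> k < H i \<Longrightarrow> \<xi> i t k \<in> borel_measurable M"
  by (rule lift_M[OF _ order_refl \<xi>_meas]) auto

lemma sg_measM: "i < n \<Longrightarrow> k < H i \<Longrightarrow> sg i t k \<in> borel_measurable M"
  by (rule lift_M[OF _ order_refl sg_meas]) auto

lemma q_meas: "i < n \<Longrightarrow> q i t \<in> borel_measurable (rh t)"
  unfolding q_def[abs_def]
  by (intro borel_measurable_add borel_measurable_diff gf_meas x_meas cs_meas c_meas)

lemma e_meas: "i < n \<Longrightarrow> e i t \<in> borel_measurable (rh t)"
  unfolding e_def[abs_def] by (intro borel_measurable_diff gf_meas x_meas c_meas)

section \<open>Boundedness on the trust ball\<close>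

lemma AE_x_ball: "AE \<omega> in M. x t \<omega> \<in> trust_ball P"
  using in_ball by eventually_elim simp

lemma AE_y_ball: "i < n \<Longrightarrow> l \<le> H i \<Longrightarrow> AE \<omega> in M. y i t l \<omega> \<in> trust_ball P"
  using in_ball by eventually_elim simp

lemma smooth_grad_bound:
  assumes "smooth_fun L f" "z \<in> trust_ball P"
  shows "norm (grad f z) \<le> norm (grad f (minimizer P)) + L * radius P"
proof -
  have "norm (z - minimizer P) \<le> radius P"
    using assms(2) by (simp add: trust_ball_def dist_norm norm_minus_commute)
  then have "L * norm (z - minimizer P) \<le> L * radius P"
    using L_pos by (intro mult_left_mono) auto
  moreover have "norm (grad f z) \<le> norm (grad f (minimizer P)) + norm (grad f z - grad f (minimizer P))"
    by (rule norm_triangle_sub)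
  ultimately show ?thesis
    using smooth_fun_lipschitz[OF assms(1), of z "minimizer P"] by linarith
qed

lemma gradient_bounds:
  assumes i: "i < n"
  shows "\<exists>K\<ge>0. (\<forall>z\<in>trust_ball P. norm (gf i z) \<le> K) \<and>
    (\<forall>S z. S \<subseteq> {..<samples P i} \<longrightarrow> z \<in> trust_ball P \<longrightarrow> norm (minibatch_grad P i S z) \<le> K)"
proof (intro exI conjI ballI allI impI)
  let ?b = "\<lambda>f :: 'a \<Rightarrow> real. norm (grad f (minimizer P)) + L * radius P"
  let ?K1 = "?b (node_obj P i)"
  let ?K2 = "(1 / real (batch P i)) * (\<Sum>j<samples P i. ?b (loss P i j))"
  have p: "0 \<le> ?b f" for f using L_pos R_pos by simp
  have p2: "0 \<le> ?K2" using p by (intro mult_nonneg_nonneg sum_nonneg) auto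
  show "0 \<le> ?K1 + ?K2" using p[of "node_obj P i"] p2 by linarith
  show "norm (gf i z) \<le> ?K1 + ?K2" if "z \<in> trust_ball P" for z
    using smooth_grad_bound[OF node_smooth[OF i] that] p2 by linarith
  show "norm (minibatch_grad P i S z) \<le> ?K1 + ?K2"
    if S: "S \<subseteq> {..<samples P i}" and z: "z \<in> trust_ball P" for S z
  proof -
    have "norm (minibatch_grad P i S z) = (1 / real (batch P i)) * norm (\<Sum>j\<in>S. grad (loss P i j) z)"
      by (simp add: minibatch_grad_def)
    also have "\<dots> \<le> (1 / real (batch P i)) * (\<Sum>j\<in>S. ?b (loss P i j))"
      using S z by (intro mult_left_mono sum_norm_le smooth_grad_bound loss_smooth[OF i]) auto
    also have "\<dots> \<le> ?K2"
      using S p by (intro mult_left_mono sum_mono2) auto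
    finally show ?thesis using p[of "node_obj P i"] by linarith
  qed
qed

lemma sg_bounded:
  assumes "i < n" "l < H i"
  shows "\<exists>K. (AE \<omega> in M. norm (sg i t l \<omega>) \<le> K) \<and> (AE \<omega> in M. norm (gf i (y i t l \<omega>)) \<le> K)"
proof -
  obtain K where K: "\<forall>z\<in>trust_ball P. norm (gf i z) \<le> K"
    "\<forall>S z. S \<subseteq> {..<samples P i} \<longrightarrow> z \<in> trust_ball P \<longrightarrow> norm (minibatch_grad P i S z) \<le> K"
    using gradient_bounds[OF assms(1)] by blast
  have "AE \<omega> in M. norm (sg i t l \<omega>) \<le> K"
    using AE_y_ball[OF assms(1) less_imp_le[OF assms(2)], of t] AE_space
  proof eventually_elim
    case (elim \<omega>)
    show ?case using K(2) elim(1) B_subset[OF assms elim(2)] by blast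
  qed
  moreover have "AE \<omega> in M. norm (gf i (y i t l \<omega>)) \<le> K"
    using AE_y_ball[OF assms(1) less_imp_le[OF assms(2)], of t]
  proof eventually_elim
    case (elim \<omega>)
    show ?case by (rule K(1)[rule_format, OF elim])
  qed
  ultimately show ?thesis by (intro exI[of _ K] conjI)
qed

lemma sq_integrable_sg:
  assumes "i < n" "l < H i"
  shows "sq_integrable M (sg i t l)"
proof -
  obtain K where "AE \<omega> in M. norm (sg i t l \<omega>) \<le> K"
    using sg_bounded[OF assms, of t] by blast
  then show ?thesis by (rule sq_integrable_bounded[OF sg_measM[OF assms]])
qed

lemma sq_integrable_gf_y:
  assumes "i < n" "l < H i"
  shows "sq_integrable M (\<lambda>\<omega>. gf i (y i t l \<omega>))"
proof -
  obtain K where "AE \<omega> in M. norm (gf i (y i t l \<omega>)) \<le> K"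
    using sg_bounded[OF assms, of t] by blast
  then show ?thesis
    by (rule sq_integrable_bounded[OF gf_meas[OF assms(1) y_measM[OF assms(1) less_imp_le[OF assms(2)]]]])
qed

lemma sq_integrable_\<xi>: "i < n \<Longrightarrow> l < H i \<Longrightarrow> sq_integrable M (\<xi> i t l)"
  unfolding \<xi>_def[abs_def] by (intro sq_integrable_diff sq_integrable_sg sq_integrable_gf_y)

lemma sq_integrable_gf_x: "i < n \<Longrightarrow> sq_integrable M (\<lambda>\<omega>. gf i (x t \<omega>))"
proof -
  assume i: "i < n"
  obtain K where K: "\<forall>z\<in>trust_ball P. norm (gf i z) \<le> K"
    using gradient_bounds[OF i] by blast
  show ?thesis
    by (rule sq_integrable_bounded[where K = K])
      (use AE_x_ball[of t] K gf_meas[OF i x_measM] in auto)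
qed

lemma sq_integrable_gF_x: "sq_integrable M (\<lambda>\<omega>. gF (x t \<omega>))"
  unfolding gF_eq by (intro sq_integrable_scaleR sq_integrable_sum sq_integrable_gf_x) auto

section \<open>Minibatch noise within one node\<close>

text \<open>The noise is centred given the local history, hence orthogonal to everything that is measurable
with respect to it. Integrability of \<open>Z\<close> suffices because the noise is almost surely bounded.\<close>

lemma noise_orthogonal:
  assumes i: "i < n" and l: "l < H i" and Z: "Z \<in> borel_measurable (lh i t l)" "integrable M Z"
  shows "(\<integral>\<omega>. \<xi> i t l \<omega> \<bullet> Z \<omega> \<partial>M) = 0"
proof -
  let ?G = "lh i t l"
  have sub: "subalgebra M ?G" using subalgebra_lh[OF i] l by simp
  interpret G: sigma_finite_subalgebra M ?G by (rule sigma_finite_subalgebraI[OF sub])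
  obtain K where K: "AE \<omega> in M. norm (sg i t l \<omega>) \<le> K" "AE \<omega> in M. norm (gf i (y i t l \<omega>)) \<le> K"
    using sg_bounded[OF i l, of t] by blast
  have ZM: "Z \<in> borel_measurable M" using Z by auto
  have gy: "(\<lambda>\<omega>. gf i (y i t l \<omega>)) \<in> borel_measurable M"
    using sq_integrable_gf_y[OF i l] by (rule sq_integrableD)
  have int: "integrable M (\<lambda>\<omega>. (Z \<omega> \<bullet> b) * (f \<omega> \<bullet> b))"
    if f: "f \<in> borel_measurable M" "AE \<omega> in M. norm (f \<omega>) \<le> K" and b: "b \<in> Basis" for f b
  proof (rule Bochner_Integration.integrable_bound)
    show "integrable M (\<lambda>\<omega>. K * norm (Z \<omega>))" using Z by simp
    show "AE \<omega> in M. norm ((Z \<omega> \<bullet> b) * (f \<omega> \<bullet> b)) \<le> norm (K * norm (Z \<omega>))"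
      using f(2)
    proof eventually_elim
      case (elim \<omega>)
      have "\<bar>Z \<omega> \<bullet> b\<bar> * \<bar>f \<omega> \<bullet> b\<bar> \<le> norm (Z \<omega>) * K"
        using elim Basis_le_norm[OF b, of "Z \<omega>"] Basis_le_norm[OF b, of "f \<omega>"]
        by (intro mult_mono) auto
      moreover have "0 \<le> K" using elim norm_ge_zero order_trans by blast
      ultimately show ?case by (simp add: abs_mult mult.commute)
    qed
  qed (use ZM f(1) in measurable)
  have zero: "(\<integral>\<omega>. (Z \<omega> \<bullet> b) * (\<xi> i t l \<omega> \<bullet> b) \<partial>M) = 0"
    and intb: "integrable M (\<lambda>\<omega>. (Z \<omega> \<bullet> b) * (\<xi> i t l \<omega> \<bullet> b))" if b: "b \<in> Basis" for b
  proof -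
    have sgm: "(\<lambda>\<omega>. sg i t l \<omega> \<bullet> b) \<in> borel_measurable M" using sg_measM[OF i l] by measurable
    have Zb: "(\<lambda>\<omega>. Z \<omega> \<bullet> b) \<in> borel_measurable ?G" using Z(1) by measurable
    note i1 = int[OF sg_measM[OF i l] K(1) b] and i2 = int[OF gy K(2) b]
    have "(\<integral>\<omega>. (Z \<omega> \<bullet> b) * (sg i t l \<omega> \<bullet> b) \<partial>M)
        = (\<integral>\<omega>. (Z \<omega> \<bullet> b) * real_cond_exp M ?G (\<lambda>\<omega>. sg i t l \<omega> \<bullet> b) \<omega> \<partial>M)"
      by (rule G.real_cond_exp_intg(2)[OF i1 Zb sgm, symmetric])
    also have "\<dots> = (\<integral>\<omega>. (Z \<omega> \<bullet> b) * (gf i (y i t l \<omega>) \<bullet> b) \<partial>M)"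
    proof (rule integral_cong_AE)
      show "AE \<omega> in M. (Z \<omega> \<bullet> b) * real_cond_exp M ?G (\<lambda>\<omega>. sg i t l \<omega> \<bullet> b) \<omega>
          = (Z \<omega> \<bullet> b) * (gf i (y i t l \<omega>) \<bullet> b)"
        using unbiased[OF i l, of t]
      proof eventually_elim
        case (elim \<omega>)
        have "vec_cond_exp M ?G (sg i t l) \<omega> \<bullet> b = real_cond_exp M ?G (\<lambda>\<omega>. sg i t l \<omega> \<bullet> b) \<omega>"
          unfolding vec_cond_exp_def using b by simp
        then show ?case using elim by simp
      qed
    qed (use ZM gy in measurable)
    finally show "(\<integral>\<omega>. (Z \<omega> \<bullet> b) * (\<xi> i t l \<omega> \<bullet> b) \<partial>M) = 0"
      using i1 i2 by (simp add: \<xi>_def inner_diff_left right_diff_distrib)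
    show "integrable M (\<lambda>\<omega>. (Z \<omega> \<bullet> b) * (\<xi> i t l \<omega> \<bullet> b))"
      using i1 i2 by (simp add: \<xi>_def inner_diff_left right_diff_distrib)
  qed
  have eq: "\<xi> i t l \<omega> \<bullet> Z \<omega> = (\<Sum>b\<in>Basis. (Z \<omega> \<bullet> b) * (\<xi> i t l \<omega> \<bullet> b))" for \<omega>
    by (subst euclidean_inner) (simp add: mult.commute)
  show "(\<integral>\<omega>. \<xi> i t l \<omega> \<bullet> Z \<omega> \<partial>M) = 0"
    unfolding eq using zero intb by (simp add: Bochner_Integration.integral_sum)
qed

lemma noise_variance:
  assumes i: "i < n" and l: "l < H i"
  shows "(\<integral>\<omega>. (norm (\<xi> i t l \<omega>))\<^sup>2 \<partial>M) \<le> vsq P i / real (batch P i)"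
proof -
  let ?G = "lh i t l"
  have sub: "subalgebra M ?G" using subalgebra_lh[OF i] l by simp
  interpret G: sigma_finite_subalgebra M ?G by (rule sigma_finite_subalgebraI[OF sub])
  have int: "integrable M (\<lambda>\<omega>. (norm (\<xi> i t l \<omega>))\<^sup>2)"
    using sq_integrable_\<xi>[OF i l] by (rule sq_integrableD)
  have "(\<integral>\<omega>. (norm (\<xi> i t l \<omega>))\<^sup>2 \<partial>M) = (\<integral>\<omega>. real_cond_exp M ?G (\<lambda>\<omega>. (norm (\<xi> i t l \<omega>))\<^sup>2) \<omega> \<partial>M)"
    using G.real_cond_exp_int(2)[OF int] by simp
  also have "\<dots> \<le> (\<integral>\<omega>. vsq P i / real (batch P i) \<partial>M)"
    using G.real_cond_exp_int(1)[OF int] variance[OF i l, of t]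
    by (intro integral_mono_AE) (auto simp: \<xi>_def)
  also have "\<dots> = vsq P i / real (batch P i)" by (simp add: prob_space)
  finally show ?thesis .
qed

text \<open>Nonnegativity of the variance bound follows from the bound itself; no property of the supremum
that defines \<open>vsq\<close> is needed.\<close>

lemma variance_bound_nonneg: "i < n \<Longrightarrow> 0 \<le> vsq P i / real (batch P i)"
  using order_trans[OF Bochner_Integration.integral_nonneg noise_variance[of i 0 0]] H_pos[of i]
  by (simp add: Suc_le_eq)

section \<open>Minibatch noise across nodes\<close>

text \<open>The possible sequences of minibatches of node \<open>i\<close> up to and including local step \<open>l\<close> of a round. They
are extensional functions, so that there are finitely many.\<close>

definition paths :: "nat \<Rightarrow> nat \<Rightarrow> (nat \<Rightarrow> nat set) set" where
  "paths i l = (\<Pi>\<^sub>E k\<in>{..l}. Pow {..<samples P i})"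

text \<open>The event that the minibatches of the round follow the sequence \<open>s\<close>.\<close>

definition path_event :: "nat \<Rightarrow> nat \<Rightarrow> nat \<Rightarrow> (nat \<Rightarrow> nat set) \<Rightarrow> 'w set" where
  "path_event i t l s = {\<omega> \<in> space M. \<forall>k\<le>l. B i t k \<omega> = s k}"

text \<open>The local iterate that results from the sequence \<open>s\<close>, defined on the whole probability space and not
only where \<open>s\<close> is drawn. Its randomness is that of the state at the beginning of the round.\<close>

definition path_iter :: "nat \<Rightarrow> nat \<Rightarrow> nat \<Rightarrow> (nat \<Rightarrow> nat set) \<Rightarrow> 'w \<Rightarrow> 'a" where
  "path_iter i t l s \<omega> = local_iter P i (\<eta> i t) (x t \<omega>) (cs t \<omega> - c i t \<omega>) s l"

text \<open>The noise in step \<open>l\<close> along the sequence \<open>s\<close>. Off the event that \<open>s\<close> is drawn the iterate may leave the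
trust ball; truncation there makes the noise bounded.\<close>

definition path_noise :: "nat \<Rightarrow> nat \<Rightarrow> nat \<Rightarrow> (nat \<Rightarrow> nat set) \<Rightarrow> 'w \<Rightarrow> 'a" where
  "path_noise i t l s \<omega> = (if path_iter i t l s \<omega> \<in> trust_ball P
     then minibatch_grad P i (s l) (path_iter i t l s \<omega>) - gf i (path_iter i t l s \<omega>) else 0)"

lemma finite_paths: "finite (paths i l)"
  unfolding paths_def by (intro finite_PiE) auto

lemma paths_subset: "s \<in> paths i l \<Longrightarrow> k \<le> l \<Longrightarrow> s k \<subseteq> {..<samples P i}"
  unfolding paths_def by (auto dest: PiE_mem)

lemma path_noise_measurable:
  assumes i: "i < n" and s: "s \<in> paths i l"
  shows "path_noise i t l s \<in> borel_measurable (rh t)"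
proof -
  have sub: "s k \<subseteq> {..<samples P i}" if "k \<le> l" for k by (rule paths_subset[OF s that])
  have it: "path_iter i t l s \<in> borel_measurable (rh t)"
    unfolding path_iter_def[abs_def]
    using sub i
    by (intro local_iter_measurable[where b = "\<lambda>k _. s k"] borel_measurable_diff x_meas cs_meas c_meas) auto
  have ball: "{\<omega> \<in> space (rh t). path_iter i t l s \<omega> \<in> trust_ball P} \<in> sets (rh t)"
    using measurable_sets[OF it, of "trust_ball P"]
    by (simp add: trust_ball_def vimage_def Int_def conj_commute)
  show ?thesis
    unfolding path_noise_def[abs_def]
    using sub[of l] i
    by (intro measurable_If ball borel_measurable_diff gf_meas it
        minibatch_grad_measurable[where b = "\<lambda>_. s l"]) auto
qed

lemma path_noise_bounded:
  assumes i: "i < n"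
  shows "\<exists>K. \<forall>s\<in>paths i l. \<forall>\<omega>. norm (path_noise i t l s \<omega>) \<le> K"
proof -
  obtain K where K0: "0 \<le> K" and K: "\<forall>z\<in>trust_ball P. norm (gf i z) \<le> K"
    "\<forall>S z. S \<subseteq> {..<samples P i} \<longrightarrow> z \<in> trust_ball P \<longrightarrow> norm (minibatch_grad P i S z) \<le> K"
    using gradient_bounds[OF i] by blast
  have "norm (path_noise i t l s \<omega>) \<le> K + K" if "s \<in> paths i l" for s \<omega>
  proof (cases "path_iter i t l s \<omega> \<in> trust_ball P")
    case True
    have "norm (path_noise i t l s \<omega>) \<le>
        norm (minibatch_grad P i (s l) (path_iter i t l s \<omega>)) + norm (gf i (path_iter i t l s \<omega>))"
      using True by (simp add: path_noise_def norm_triangle_ineq4)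
    also have "\<dots> \<le> K + K"
      using K True paths_subset[OF that order_refl] by (intro add_mono) auto
    finally show ?thesis .
  qed (use K0 in \<open>simp add: path_noise_def\<close>)
  then show ?thesis by blast
qed

lemma path_event_sets:
  assumes "i < n" "l < H i"
  shows "path_event i t l s \<in> sets M"
proof -
  have "path_event i t l s = (\<Inter>k\<in>{..l}. B i t k -` {s k} \<inter> space M)"
    by (auto simp: path_event_def)
  also have "\<dots> \<in> sets M" using assms B_event by (intro sets.finite_INT) auto
  finally show ?thesis .
qed

lemma noise_path_decomposition:
  assumes i: "i < n" and l: "l < H i"
  shows "AE \<omega> in M. \<xi> i t l \<omega> =
    (\<Sum>s\<in>paths i l. indicator (path_event i t l s) \<omega> *\<^sub>R path_noise i t l s \<omega>)"
  using AE_y_ball[OF i less_imp_le[OF l], of t] AE_space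
proof eventually_elim
  case (elim \<omega>)
  define s0 where "s0 = restrict (\<lambda>k. B i t k \<omega>) {..l}"
  have s0: "s0 \<in> paths i l"
    using B_subset[OF i _ elim(2)] l by (auto simp: s0_def paths_def)
  have ev: "\<omega> \<in> path_event i t l s \<longleftrightarrow> s = s0" if "s \<in> paths i l" for s
  proof
    assume "\<omega> \<in> path_event i t l s"
    then show "s = s0"
      using that s0 unfolding paths_def
      by (intro PiE_ext[of s "{..l}" _ s0]) (auto simp: path_event_def s0_def)
  qed (use elim in \<open>auto simp: path_event_def s0_def\<close>)
  have y: "path_iter i t l s0 \<omega> = y i t l \<omega>"
    unfolding path_iter_def y_eq_local_iter[OF elim(2) i less_imp_le[OF l]]
    by (intro local_iter_cong) (simp add: s0_def)
  have "(\<Sum>s\<in>paths i l. indicator (path_event i t l s) \<omega> *\<^sub>R path_noise i t l s \<omega>)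
      = (\<Sum>s\<in>paths i l. if s = s0 then path_noise i t l s0 \<omega> else 0)"
    using ev by (intro sum.cong) auto
  also have "\<dots> = path_noise i t l s0 \<omega>"
    using s0 finite_paths by simp
  also have "\<dots> = \<xi> i t l \<omega>"
  proof -
    have "s0 l = B i t l \<omega>" by (simp add: s0_def)
    then show ?thesis unfolding path_noise_def y \<xi>_def using elim(1) by simp
  qed
  finally show ?case by (rule sym)
qed

lemma path_events_cond_indep:
  assumes i: "i < n" "l < H i" and j: "j < n" "k < H j" and ij: "i \<noteq> j"
  shows "AE \<omega> in M.
    real_cond_exp M (lh i t 0) (indicator (path_event i t l s \<inter> path_event j t k r)) \<omega> =
    real_cond_exp M (lh i t 0) (indicator (path_event i t l s)) \<omega> *
    real_cond_exp M (lh i t 0) (indicator (path_event j t k r)) \<omega>"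
proof -
  let ?K = "{(j, k). j < n \<and> k < H j}" and ?X = "\<lambda>(j, k). B j t k"
  \<comment> \<open>Only the coordinates of node \<open>i'\<close> up to step \<open>l'\<close> are constrained.\<close>
  define A where "A i' l' s' = (\<lambda>(j', k'). if j' = i' \<and> k' \<le> l' then {s' k'} else UNIV)"
    for i' l' :: nat and s' :: "nat \<Rightarrow> nat set"
  have ev: "{\<omega> \<in> space M. \<forall>p\<in>?K. ?X p \<omega> \<in> A i' l' s' p} = path_event i' t l' s'"
    if "i' < n" "l' < H i'" for i' l' s'
    using that by (auto simp: A_def path_event_def)
  have ev2: "{\<omega> \<in> space M. \<forall>p\<in>?K. ?X p \<omega> \<in> A i l s p \<inter> A j k r p}
      = path_event i t l s \<inter> path_event j t k r"
    using ev[OF i, of s] ev[OF j, of r] by blast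
  have "A i l s p = UNIV \<or> A j k r p = UNIV" for p
    using ij by (auto simp: A_def split: prod.splits)
  moreover have "subalgebra M (lh i t 0)" using subalgebra_lh[OF i(1)] by simp
  moreover have "cond_indep_discrete M (lh i t 0) ?X ?K"
    using independent[of i 0 t] i by simp
  ultimately have "AE \<omega> in M.
      real_cond_exp M (lh i t 0) (indicator {\<omega>'\<in>space M. \<forall>p\<in>?K. ?X p \<omega>' \<in> A i l s p \<inter> A j k r p}) \<omega> =
      real_cond_exp M (lh i t 0) (indicator {\<omega>'\<in>space M. \<forall>p\<in>?K. ?X p \<omega>' \<in> A i l s p}) \<omega> *
      real_cond_exp M (lh i t 0) (indicator {\<omega>'\<in>space M. \<forall>p\<in>?K. ?X p \<omega>' \<in> A j k r p}) \<omega>"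
    by (intro cond_indep_discrete_inter) auto
  then show ?thesis unfolding ev[OF i] ev[OF j] ev2 .
qed

text \<open>Noise terms of different nodes are functions of minibatches that are independent given the history
at the beginning of the round, with coefficients measurable with respect to that history.\<close>

lemma noise_orthogonal_nodes:
  assumes i: "i < n" "l < H i" and j: "j < n" "k < H j" and ij: "i \<noteq> j"
  shows "(\<integral>\<omega>. \<xi> i t l \<omega> \<bullet> \<xi> j t k \<omega> \<partial>M) = 0"
proof -
  let ?G = "lh i t 0"
  obtain KX where KX: "\<forall>s\<in>paths i l. \<forall>\<omega>. norm (path_noise i t l s \<omega>) \<le> KX"
    using path_noise_bounded[OF i(1)] by blast
  obtain KY where KY: "\<forall>s\<in>paths j k. \<forall>\<omega>. norm (path_noise j t k s \<omega>) \<le> KY"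
    using path_noise_bounded[OF j(1)] by blast
  note \<xi>M = \<xi>_measM[OF i, of t] \<xi>_measM[OF j, of t]
  have comp: "AE \<omega> in M. \<xi> i' t l' \<omega> \<bullet> b =
      (\<Sum>s\<in>paths i' l'. indicator (path_event i' t l' s) \<omega> * (path_noise i' t l' s \<omega> \<bullet> b))"
    if "i' < n" "l' < H i'" for i' l' b
    using noise_path_decomposition[OF that, of t]
    by eventually_elim (simp add: inner_sum_left)
  have zero: "(\<integral>\<omega>. (\<xi> i t l \<omega> \<bullet> b) * (\<xi> j t k \<omega> \<bullet> b) \<partial>M) = 0" if b: "b \<in> Basis" for b
  proof -
    have meas: "(\<lambda>\<omega>. path_noise i' t l' s \<omega> \<bullet> b) \<in> borel_measurable ?G"
      if "i' < n" "s \<in> paths i' l'" for i' l' s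
      using lift_rh[OF path_noise_measurable[OF that]] by measurable
    have sumM: "(\<lambda>\<omega>. \<Sum>s\<in>paths i' l'. indicator (path_event i' t l' s) \<omega> * (path_noise i' t l' s \<omega> \<bullet> b))
        \<in> borel_measurable M" if "i' < n" "l' < H i'" for i' l'
      using that path_event_sets[OF that]
      by (intro borel_measurable_sum borel_measurable_times borel_measurable_indicator
          lift_M[OF i(1) _ meas]) auto
    have "(\<integral>\<omega>. (\<xi> i t l \<omega> \<bullet> b) * (\<xi> j t k \<omega> \<bullet> b) \<partial>M) =
      (\<integral>\<omega>. (\<Sum>s\<in>paths i l. indicator (path_event i t l s) \<omega> * (path_noise i t l s \<omega> \<bullet> b)) *
        (\<Sum>s\<in>paths j k. indicator (path_event j t k s) \<omega> * (path_noise j t k s \<omega> \<bullet> b)) \<partial>M)"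
    proof (rule integral_cong_AE)
      show "AE \<omega> in M. (\<xi> i t l \<omega> \<bullet> b) * (\<xi> j t k \<omega> \<bullet> b) =
        (\<Sum>s\<in>paths i l. indicator (path_event i t l s) \<omega> * (path_noise i t l s \<omega> \<bullet> b)) *
        (\<Sum>s\<in>paths j k. indicator (path_event j t k s) \<omega> * (path_noise j t k s \<omega> \<bullet> b))"
        using comp[OF i, of b] comp[OF j, of b] by eventually_elim (simp only:)
      show "(\<lambda>\<omega>. (\<xi> i t l \<omega> \<bullet> b) * (\<xi> j t k \<omega> \<bullet> b)) \<in> borel_measurable M"
        using \<xi>M by measurable
    qed (intro borel_measurable_times sumM i j)
    also have "\<dots> = 0"
    proof (rule cond_indep_orthogonal[where G = ?G and KX = KX and KY = KY])
      show "subalgebra M ?G" using subalgebra_lh[OF i(1)] by simp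
      show "\<bar>path_noise i t l s \<omega> \<bullet> b\<bar> \<le> KX" if "s \<in> paths i l" for s \<omega>
        using KX that Basis_le_norm[OF b] order_trans by blast
      show "\<bar>path_noise j t k s \<omega> \<bullet> b\<bar> \<le> KY" if "s \<in> paths j k" for s \<omega>
        using KY that Basis_le_norm[OF b] order_trans by blast
      show "(\<integral>\<omega>. (\<Sum>s\<in>paths i l. indicator (path_event i t l s) \<omega> * (path_noise i t l s \<omega> \<bullet> b)) * W \<omega> \<partial>M) = 0"
        if W: "W \<in> borel_measurable ?G" "integrable M W" for W
      proof -
        have "(\<integral>\<omega>. (\<Sum>s\<in>paths i l. indicator (path_event i t l s) \<omega> * (path_noise i t l s \<omega> \<bullet> b)) * W \<omega> \<partial>M)
            = (\<integral>\<omega>. \<xi> i t l \<omega> \<bullet> (W \<omega> *\<^sub>R b) \<partial>M)"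
        proof (rule integral_cong_AE)
          show "AE \<omega> in M. (\<Sum>s\<in>paths i l. indicator (path_event i t l s) \<omega> * (path_noise i t l s \<omega> \<bullet> b)) * W \<omega>
              = \<xi> i t l \<omega> \<bullet> (W \<omega> *\<^sub>R b)"
            using comp[OF i, of b] by eventually_elim simp
          show "(\<lambda>\<omega>. \<xi> i t l \<omega> \<bullet> (W \<omega> *\<^sub>R b)) \<in> borel_measurable M"
            using \<xi>M W(2) by measurable
        qed (intro borel_measurable_times sumM i borel_measurable_integrable[OF W(2)])
        also have "\<dots> = 0"
        proof (rule noise_orthogonal[OF i])
          have "W \<in> borel_measurable (lh i t l)"
            by (rule measurable_mono_space[OF lh_mono _ W(1)]) auto
          then show "(\<lambda>\<omega>. W \<omega> *\<^sub>R b) \<in> borel_measurable (lh i t l)" by measurable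
        qed (use W in simp)
        finally show ?thesis .
      qed
    qed (use finite_paths path_event_sets i j meas path_events_cond_indep[OF i j ij] in auto)
    finally show ?thesis .
  qed
  have int: "integrable M (\<lambda>\<omega>. (\<xi> i t l \<omega> \<bullet> b) * (\<xi> j t k \<omega> \<bullet> b))" if b: "b \<in> Basis" for b
  proof -
    have "sq_integrable M (\<lambda>\<omega>. \<xi> i' t l' \<omega> \<bullet> b)" if "i' < n" "l' < H i'" for i' l'
    proof (rule sq_integrable_dominated)
      show "integrable M (\<lambda>\<omega>. (norm (\<xi> i' t l' \<omega>))\<^sup>2)"
        using sq_integrable_\<xi>[OF that] by (rule sq_integrableD)
      show "(\<lambda>\<omega>. \<xi> i' t l' \<omega> \<bullet> b) \<in> borel_measurable M"
        using \<xi>_measM[OF that] by measurable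
      show "AE \<omega> in M. (norm (\<xi> i' t l' \<omega> \<bullet> b))\<^sup>2 \<le> (norm (\<xi> i' t l' \<omega>))\<^sup>2"
        using Basis_le_norm[OF b] by (intro AE_I2 power_mono) auto
    qed
    from sq_integrable_inner[OF this[OF i] this[OF j]] show ?thesis by simp
  qed
  have "(\<integral>\<omega>. \<xi> i t l \<omega> \<bullet> \<xi> j t k \<omega> \<partial>M) = (\<integral>\<omega>. (\<Sum>b\<in>Basis. (\<xi> i t l \<omega> \<bullet> b) * (\<xi> j t k \<omega> \<bullet> b)) \<partial>M)"
    by (subst euclidean_inner) simp
  also have "\<dots> = 0"
    using int zero by (simp add: Bochner_Integration.integral_sum)
  finally show ?thesis .
qed

lemma noise_orthogonal_pairs:
  assumes i: "i < n" "l < H i" and j: "j < n" "k < H j" and ne: "(i, l) \<noteq> (j, k)"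
  shows "(\<integral>\<omega>. \<xi> i t l \<omega> \<bullet> \<xi> j t k \<omega> \<partial>M) = 0"
proof -
  have same: "(\<integral>\<omega>. \<xi> i t l \<omega> \<bullet> \<xi> i t k \<omega> \<partial>M) = 0" if "k < l" "l < H i" for k l
    using that i(1)
    by (intro noise_orthogonal \<xi>_meas sq_integrable_integrable[OF sq_integrable_\<xi>]) auto
  show ?thesis
  proof (cases "i = j")
    case True
    then show ?thesis
      using same[of k l] same[of l k] i j ne
      by (cases k l rule: linorder_cases) (auto simp: inner_commute)
  qed (rule noise_orthogonal_nodes[OF i j])
qed

lemma noise_sum_sq_le:
  fixes a :: "nat \<Rightarrow> real"
  assumes "I \<subseteq> {..<n}"
  shows "(\<integral>\<omega>. (norm (\<Sum>i\<in>I. a i *\<^sub>R (\<Sum>l<H i. \<xi> i t l \<omega>)))\<^sup>2 \<partial>M)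
    \<le> (\<Sum>i\<in>I. (a i)\<^sup>2 * (real (H i) * (vsq P i / real (batch P i))))"
proof -
  let ?K = "SIGMA i:I. {..<H i}"
  let ?X = "\<lambda>(i, l) \<omega>. a i *\<^sub>R \<xi> i t l \<omega>"
  have finI: "finite I" using assms finite_subset by blast
  have eq: "(\<Sum>i\<in>I. a i *\<^sub>R (\<Sum>l<H i. \<xi> i t l \<omega>)) = (\<Sum>p\<in>?K. ?X p \<omega>)" for \<omega>
    by (simp add: scaleR_sum_right sum.Sigma[OF finI] split_def)
  have "(\<integral>\<omega>. (norm (\<Sum>p\<in>?K. ?X p \<omega>))\<^sup>2 \<partial>M) = (\<Sum>p\<in>?K. \<integral>\<omega>. (norm (?X p \<omega>))\<^sup>2 \<partial>M)"
  proof (rule integral_norm_sum_sq_orthogonal)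
    show "finite ?K" using finI by auto
    show "sq_integrable M (?X p)" if "p \<in> ?K" for p
      using that assms by (auto intro!: sq_integrable_scaleR sq_integrable_\<xi>)
    show "(\<integral>\<omega>. ?X p \<omega> \<bullet> ?X p' \<omega> \<partial>M) = 0" if "p \<in> ?K" "p' \<in> ?K" "p \<noteq> p'" for p p'
    proof -
      obtain i l j k where p: "p = (i, l)" "p' = (j, k)" by (cases p, cases p') auto
      have "(\<integral>\<omega>. \<xi> i t l \<omega> \<bullet> \<xi> j t k \<omega> \<partial>M) = 0"
        using that assms unfolding p by (intro noise_orthogonal_pairs) auto
      then show ?thesis by (simp add: p)
    qed
  qed
  also have "\<dots> \<le> (\<Sum>p\<in>?K. (\<lambda>(i, l). (a i)\<^sup>2 * (vsq P i / real (batch P i))) p)"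
  proof (rule sum_mono)
    fix p assume "p \<in> ?K"
    then obtain i l where p: "p = (i, l)" "i < n" "l < H i" using assms by auto
    have "(\<integral>\<omega>. (norm (?X p \<omega>))\<^sup>2 \<partial>M) = (a i)\<^sup>2 * (\<integral>\<omega>. (norm (\<xi> i t l \<omega>))\<^sup>2 \<partial>M)"
      by (simp add: p power_mult_distrib)
    also have "\<dots> \<le> (a i)\<^sup>2 * (vsq P i / real (batch P i))"
      by (intro mult_left_mono noise_variance p) simp
    finally show "(\<integral>\<omega>. (norm (?X p \<omega>))\<^sup>2 \<partial>M) \<le> (\<lambda>(i, l). (a i)\<^sup>2 * (vsq P i / real (batch P i))) p"
      by (simp add: p)
  qed
  also have "\<dots> = (\<Sum>i\<in>I. (a i)\<^sup>2 * (real (H i) * (vsq P i / real (batch P i))))"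
    by (simp add: sum.Sigma[OF finI, symmetric] mult.left_commute)
  finally show ?thesis unfolding eq .
qed

section \<open>Client drift\<close>

text \<open>The displacement of node \<open>i\<close> from the start of the round after \<open>l\<close> local steps.\<close>

definition drift :: "nat \<Rightarrow> nat \<Rightarrow> nat \<Rightarrow> 'w \<Rightarrow> 'a" where
  "drift i t l \<omega> = y i t l \<omega> - x t \<omega>"

text \<open>The error that the control variates contribute to the direction of node \<open>i\<close>.\<close>

definition bias :: "nat \<Rightarrow> nat \<Rightarrow> 'w \<Rightarrow> 'a" where
  "bias i t \<omega> = (1 / real n) *\<^sub>R (\<Sum>j<n. e j t \<omega>) - e i t \<omega>"

text \<open>The average change of the gradient of node \<open>i\<close> along its local trajectory.\<close>

definition grad_shift :: "nat \<Rightarrow> nat \<Rightarrow> 'w \<Rightarrow> 'a" where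
  "grad_shift i t \<omega> = (1 / real (H i)) *\<^sub>R (\<Sum>l<H i. gf i (y i t l \<omega>) - gf i (x t \<omega>))"

text \<open>The bound on the variance of the average of the \<open>H i\<close> minibatch gradients of a round.\<close>

definition noise_level :: "nat \<Rightarrow> real" where
  "noise_level i = vsq P i / (real (H i) * real (batch P i))"

text \<open>The suboptimality of the server iterate.\<close>

definition gap :: "nat \<Rightarrow> 'w \<Rightarrow> real" where
  "gap t \<omega> = global_obj P (x t \<omega>) - global_obj P (minimizer P)"

lemma noise_level_nonneg: "i < n \<Longrightarrow> 0 \<le> noise_level i"
  using variance_bound_nonneg[of i] H_pos[of i] divide_nonneg_nonneg[of "vsq P i / real (batch P i)" "real (H i)"]
  by (simp add: noise_level_def mult.commute)

lemma gf_lipschitz: "i < n \<Longrightarrow> norm (gf i z - gf i z') \<le> L * norm (z - z')"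
  by (rule smooth_fun_lipschitz[OF node_smooth])

lemma gf_lipschitz_sq: "i < n \<Longrightarrow> (norm (gf i z - gf i z'))\<^sup>2 \<le> L\<^sup>2 * (norm (z - z'))\<^sup>2"
  using power_mono[OF gf_lipschitz[of i z z'], of 2] by (simp add: power_mult_distrib)

lemma drift_measurable: "i < n \<Longrightarrow> l \<le> H i \<Longrightarrow> drift i t l \<in> borel_measurable (lh i t l)"
  unfolding drift_def[abs_def] by (intro borel_measurable_diff y_meas lift_rh x_meas)

lemma sq_integrable_drift:
  assumes "i < n" "l \<le> H i"
  shows "sq_integrable M (drift i t l)"
proof (rule sq_integrable_bounded)
  show "drift i t l \<in> borel_measurable M"
    by (rule lift_M[OF assms drift_measurable[OF assms]])
  show "AE \<omega> in M. norm (drift i t l \<omega>) \<le> 2 * radius P"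
    using AE_y_ball[OF assms, of t] AE_x_ball[of t]
  proof eventually_elim
    case (elim \<omega>)
    have "dist (y i t l \<omega>) (x t \<omega>) \<le> dist (y i t l \<omega>) (minimizer P) + dist (x t \<omega>) (minimizer P)"
      by (rule dist_triangle2)
    then show ?case using elim by (simp add: trust_ball_def drift_def dist_norm norm_minus_commute)
  qed
qed

lemma sq_integrable_bias:
  assumes "\<And>j. j < n \<Longrightarrow> sq_integrable M (e j t)" "i < n"
  shows "sq_integrable M (bias i t)"
  unfolding bias_def[abs_def]
  using assms by (intro sq_integrable_diff sq_integrable_scaleR sq_integrable_sum) auto

lemma q_bias: "\<omega> \<in> space M \<Longrightarrow> q i t \<omega> = gF (x t \<omega>) + bias i t \<omega>"
  by (simp add: q_eq bias_def)

lemma sq_integrable_q: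
  assumes "\<And>j. j < n \<Longrightarrow> sq_integrable M (e j t)" "i < n"
  shows "sq_integrable M (q i t)"
proof -
  have "sq_integrable M (\<lambda>\<omega>. gF (x t \<omega>) + bias i t \<omega>)"
    by (intro sq_integrable_add sq_integrable_gF_x sq_integrable_bias assms)
  moreover have "sq_integrable M (q i t) \<longleftrightarrow> sq_integrable M (\<lambda>\<omega>. gF (x t \<omega>) + bias i t \<omega>)"
    by (rule sq_integrable_cong) (rule q_bias)
  ultimately show ?thesis by blast
qed

lemma bias_sq_le:
  assumes e: "\<And>j. j < n \<Longrightarrow> sq_integrable M (e j t)"
    and X: "\<And>j. j < n \<Longrightarrow> (\<integral>\<omega>. (norm (e j t \<omega>))\<^sup>2 \<partial>M) \<le> chi" and i: "i < n"
  shows "(\<integral>\<omega>. (norm (bias i t \<omega>))\<^sup>2 \<partial>M) \<le> 4 * chi"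
proof -
  note eI = sq_integrableD(2)[OF e]
  have n0: "0 < real n" using n_pos by simp
  have "(\<integral>\<omega>. (norm (bias i t \<omega>))\<^sup>2 \<partial>M)
      \<le> (\<integral>\<omega>. 2 * ((1 / real n) * (\<Sum>j<n. (norm (e j t \<omega>))\<^sup>2)) + 2 * (norm (e i t \<omega>))\<^sup>2 \<partial>M)"
  proof (rule integral_mono)
    show "integrable M (\<lambda>\<omega>. (norm (bias i t \<omega>))\<^sup>2)"
      by (rule sq_integrableD(2)[OF sq_integrable_bias[OF e i]])
    show "integrable M (\<lambda>\<omega>. 2 * ((1 / real n) * (\<Sum>j<n. (norm (e j t \<omega>))\<^sup>2)) + 2 * (norm (e i t \<omega>))\<^sup>2)"
      using i by (intro Bochner_Integration.integrable_add integrable_mult_right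
          Bochner_Integration.integrable_sum eI) auto
    fix \<omega>
    let ?m = "(1 / real n) *\<^sub>R (\<Sum>j<n. e j t \<omega>)"
    have "(norm (bias i t \<omega>))\<^sup>2 \<le> 2 * (norm ?m)\<^sup>2 + 2 * (norm (e i t \<omega>))\<^sup>2"
      using norm_add_sq_le[of ?m "- e i t \<omega>"] by (simp add: bias_def)
    then show "(norm (bias i t \<omega>))\<^sup>2
        \<le> 2 * ((1 / real n) * (\<Sum>j<n. (norm (e j t \<omega>))\<^sup>2)) + 2 * (norm (e i t \<omega>))\<^sup>2"
      using norm_mean_sq_le[OF n_pos, of "\<lambda>j. e j t \<omega>"] by linarith
  qed
  also have "\<dots> = 2 * ((1 / real n) * (\<Sum>j<n. \<integral>\<omega>. (norm (e j t \<omega>))\<^sup>2 \<partial>M))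
      + 2 * (\<integral>\<omega>. (norm (e i t \<omega>))\<^sup>2 \<partial>M)"
  proof -
    define S where "S \<omega> = (1 / real n) * (\<Sum>j<n. (norm (e j t \<omega>))\<^sup>2)" for \<omega>
    have "integrable M S"
      unfolding S_def by (intro integrable_mult_right Bochner_Integration.integrable_sum eI) auto
    moreover have "integral\<^sup>L M S = (1 / real n) * (\<Sum>j<n. \<integral>\<omega>. (norm (e j t \<omega>))\<^sup>2 \<partial>M)"
      unfolding S_def integral_mult_right_zero
      by (subst Bochner_Integration.integral_sum) (auto intro: eI)
    ultimately show ?thesis
      unfolding S_def[symmetric] using eI[OF i] by simp
  qed
  also have "\<dots> \<le> 2 * ((1 / real n) * (\<Sum>j<n. chi)) + 2 * chi"
    using X i n0 by (intro add_mono mult_left_mono sum_mono) auto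
  also have "\<dots> = 4 * chi" using n0 by simp
  finally show ?thesis .
qed

lemma gap_nonneg: "0 \<le> gap t \<omega>"
  using global_min by (simp add: gap_def)

lemma gap_measurable: "gap t \<in> borel_measurable M"
proof -
  have "global_obj P \<in> borel_measurable borel"
    by (intro borel_measurable_continuous_onI smooth_fun_continuous[OF global_smooth])
  then show ?thesis
    unfolding gap_def[abs_def]
    by (intro borel_measurable_diff measurable_compose[OF x_measM] borel_measurable_const)
qed

lemma gap_le_fbar:
  assumes "x t \<omega> \<in> trust_ball P"
  shows "gap t \<omega> \<le> fbar P"
proof -
  have "norm (x t \<omega> - minimizer P) \<le> radius P"
    using assms by (simp add: trust_ball_def dist_norm norm_minus_commute)
  then have "L / 2 * (norm (x t \<omega> - minimizer P))\<^sup>2 \<le> L / 2 * (radius P)\<^sup>2"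
    using L_pos by (intro mult_left_mono power_mono) auto
  then show ?thesis
    using smooth_fun_gap_le[OF global_smooth L_pos global_min, of "x t \<omega>"]
    by (simp add: gap_def fbar_def)
qed

lemma AE_gap_le: "AE \<omega> in M. gap t \<omega> \<le> fbar P"
  using AE_x_ball[of t] by eventually_elim (rule gap_le_fbar)

lemma sq_integrable_gap: "sq_integrable M (gap t)"
proof (rule sq_integrable_bounded[OF gap_measurable])
  show "AE \<omega> in M. norm (gap t \<omega>) \<le> fbar P"
    using AE_gap_le[of t] by eventually_elim (simp add: gap_nonneg)
qed

lemma gap_integrable: "integrable M (gap t)"
  by (rule sq_integrable_integrable[OF sq_integrable_gap])

lemma gap_sq_integrable: "integrable M (\<lambda>\<omega>. (gap t \<omega>)\<^sup>2)"
  using sq_integrableD(2)[OF sq_integrable_gap] by simp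

lemma expected_gap_bounds: "0 \<le> expectation (gap t)" "expectation (gap t) \<le> fbar P"
proof -
  show "0 \<le> expectation (gap t)" by (simp add: gap_nonneg)
  have "expectation (gap t) \<le> (\<integral>\<omega>. fbar P \<partial>M)"
    by (rule integral_mono_AE[OF gap_integrable _ AE_gap_le]) simp
  then show "expectation (gap t) \<le> fbar P" by (simp add: prob_space)
qed

lemma gF_sq_expectation_le:
  "(\<integral>\<omega>. (norm (gF (x t \<omega>)))\<^sup>2 \<partial>M) \<le> 2 * L * expectation (gap t)"
proof -
  have "(\<integral>\<omega>. (norm (gF (x t \<omega>)))\<^sup>2 \<partial>M) \<le> (\<integral>\<omega>. 2 * L * gap t \<omega> \<partial>M)"
    using smooth_fun_grad_sq_le[OF global_smooth L_pos global_min]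
    by (intro integral_mono sq_integrableD(2)[OF sq_integrable_gF_x]) (auto simp: gap_def gap_integrable[unfolded gap_def])
  then show ?thesis by simp
qed

lemma gap_le_gradient:
  assumes "x t \<omega> \<in> trust_ball P"
  shows "(gap t \<omega>)\<^sup>2 \<le> (radius P)\<^sup>2 * (norm (gF (x t \<omega>)))\<^sup>2"
proof -
  have "global_obj P (x t \<omega>) + gF (x t \<omega>) \<bullet> (minimizer P - x t \<omega>) \<le> global_obj P (minimizer P)"
    by (rule convex_on_grad_ineq[OF global_convex smooth_fun_GDERIV[OF global_smooth]])
  then have "gap t \<omega> \<le> gF (x t \<omega>) \<bullet> (x t \<omega> - minimizer P)"
    by (simp add: gap_def inner_diff_right)
  also have "\<dots> \<le> norm (gF (x t \<omega>)) * norm (x t \<omega> - minimizer P)"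
    by (rule norm_cauchy_schwarz)
  also have "\<dots> \<le> norm (gF (x t \<omega>)) * radius P"
    using assms by (intro mult_left_mono) (auto simp: trust_ball_def dist_norm norm_minus_commute)
  finally have "gap t \<omega> \<le> radius P * norm (gF (x t \<omega>))" by (simp add: mult.commute)
  then have "(gap t \<omega>)\<^sup>2 \<le> (radius P * norm (gF (x t \<omega>)))\<^sup>2"
    by (rule power_mono) (rule gap_nonneg)
  then show ?thesis by (simp add: power_mult_distrib)
qed

text \<open>One local step: Young's inequality with parameter \<open>\<epsilon>\<close> separates the previous displacement, which
grows by the Lipschitz factor, from the direction \<open>q\<close>; the fresh noise only adds its variance.\<close>

lemma drift_step:
  assumes i: "i < n" and l: "l < H i" and sq: "sq_integrable M (q i t)" and \<epsilon>: "0 < \<epsilon>"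
  shows "(\<integral>\<omega>. (norm (drift i t (Suc l) \<omega>))\<^sup>2 \<partial>M) \<le>
      (1 + \<epsilon>) * ((1 + \<theta> t i / real (H i))\<^sup>2 * (\<integral>\<omega>. (norm (drift i t l \<omega>))\<^sup>2 \<partial>M))
      + (1 + 1 / \<epsilon>) * ((\<eta> i t)\<^sup>2 * (\<integral>\<omega>. (norm (q i t \<omega>))\<^sup>2 \<partial>M))
      + (\<eta> i t)\<^sup>2 * (vsq P i / real (batch P i))"
proof -
  let ?h = "\<eta> i t"
  define G where "G \<omega> = drift i t l \<omega> - ?h *\<^sub>R (gf i (y i t l \<omega>) - gf i (x t \<omega>))" for \<omega>
  define W where "W \<omega> = G \<omega> + (- ?h) *\<^sub>R q i t \<omega>" for \<omega>
  have l': "l \<le> H i" using l by simp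
  have hL: "?h * L = \<theta> t i / real (H i)"
    using L_pos by (simp add: stepsize_def)
  have Gm: "G \<in> borel_measurable (lh i t l)"
    unfolding G_def[abs_def]
    by (intro borel_measurable_diff borel_measurable_scaleR borel_measurable_const
        drift_measurable gf_meas y_meas lift_rh x_meas i l')
  have Wm: "W \<in> borel_measurable (lh i t l)"
    unfolding W_def[abs_def]
    by (intro borel_measurable_add borel_measurable_scaleR borel_measurable_const Gm lift_rh q_meas i)
  have Gsq: "sq_integrable M G"
    unfolding G_def[abs_def]
    by (intro sq_integrable_diff sq_integrable_scaleR sq_integrable_drift sq_integrable_gf_y
        sq_integrable_gf_x i l l')
  have Wsq: "sq_integrable M W"
    unfolding W_def[abs_def] by (intro sq_integrable_add sq_integrable_scaleR Gsq sq)
  have step: "drift i t (Suc l) \<omega> = W \<omega> + (- ?h) *\<^sub>R \<xi> i t l \<omega>" if "\<omega> \<in> space M" for \<omega>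
    using y_Suc[OF that i l, of t]
    by (simp add: drift_def W_def G_def \<xi>_def q_def algebra_simps)
  have "(\<integral>\<omega>. W \<omega> \<bullet> ((- ?h) *\<^sub>R \<xi> i t l \<omega>) \<partial>M) = 0"
    using noise_orthogonal[OF i l Wm sq_integrable_integrable[OF Wsq]]
    by (simp add: inner_commute)
  then have "(\<integral>\<omega>. (norm (W \<omega> + (- ?h) *\<^sub>R \<xi> i t l \<omega>))\<^sup>2 \<partial>M) =
      (\<integral>\<omega>. (norm (W \<omega>))\<^sup>2 \<partial>M) + (\<integral>\<omega>. (norm ((- ?h) *\<^sub>R \<xi> i t l \<omega>))\<^sup>2 \<partial>M)"
    by (subst integral_norm_add_sq[OF Wsq sq_integrable_scaleR[OF sq_integrable_\<xi>[OF i l]]]) simp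
  also have "(\<integral>\<omega>. (norm ((- ?h) *\<^sub>R \<xi> i t l \<omega>))\<^sup>2 \<partial>M) = ?h\<^sup>2 * (\<integral>\<omega>. (norm (\<xi> i t l \<omega>))\<^sup>2 \<partial>M)"
    by (simp add: power_mult_distrib)
  finally have 1: "(\<integral>\<omega>. (norm (drift i t (Suc l) \<omega>))\<^sup>2 \<partial>M) =
      (\<integral>\<omega>. (norm (W \<omega>))\<^sup>2 \<partial>M) + ?h\<^sup>2 * (\<integral>\<omega>. (norm (\<xi> i t l \<omega>))\<^sup>2 \<partial>M)"
    using step by (simp cong: Bochner_Integration.integral_cong)
  have 2: "?h\<^sup>2 * (\<integral>\<omega>. (norm (\<xi> i t l \<omega>))\<^sup>2 \<partial>M) \<le> ?h\<^sup>2 * (vsq P i / real (batch P i))"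
    by (intro mult_left_mono noise_variance i l) simp
  have "(\<integral>\<omega>. (norm (W \<omega>))\<^sup>2 \<partial>M) \<le>
      (\<integral>\<omega>. (1 + \<epsilon>) * ((1 + \<theta> t i / real (H i))\<^sup>2 * (norm (drift i t l \<omega>))\<^sup>2)
        + (1 + 1 / \<epsilon>) * (?h\<^sup>2 * (norm (q i t \<omega>))\<^sup>2) \<partial>M)"
  proof (rule integral_mono)
    show "integrable M (\<lambda>\<omega>. (norm (W \<omega>))\<^sup>2)" by (rule sq_integrableD(2)[OF Wsq])
    show "integrable M (\<lambda>\<omega>. (1 + \<epsilon>) * ((1 + \<theta> t i / real (H i))\<^sup>2 * (norm (drift i t l \<omega>))\<^sup>2)
        + (1 + 1 / \<epsilon>) * (?h\<^sup>2 * (norm (q i t \<omega>))\<^sup>2))"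
      by (intro Bochner_Integration.integrable_add integrable_mult_right
          sq_integrableD(2)[OF sq_integrable_drift[OF i l']] sq_integrableD(2)[OF sq])
    fix \<omega>
    have "norm (G \<omega>) \<le> norm (drift i t l \<omega>) + norm (?h *\<^sub>R (gf i (y i t l \<omega>) - gf i (x t \<omega>)))"
      unfolding G_def by (rule norm_triangle_ineq4)
    also have "norm (?h *\<^sub>R (gf i (y i t l \<omega>) - gf i (x t \<omega>))) \<le> ?h * (L * norm (drift i t l \<omega>))"
      using \<eta>_pos[OF i, of t] gf_lipschitz[OF i] by (simp add: drift_def)
    finally have "norm (G \<omega>) \<le> (1 + \<theta> t i / real (H i)) * norm (drift i t l \<omega>)"
      by (simp add: hL[symmetric] algebra_simps)
    then have "(norm (G \<omega>))\<^sup>2 \<le> (1 + \<theta> t i / real (H i))\<^sup>2 * (norm (drift i t l \<omega>))\<^sup>2"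
      unfolding power_mult_distrib[symmetric] by (rule power_mono) simp
    then have "(1 + \<epsilon>) * (norm (G \<omega>))\<^sup>2
        \<le> (1 + \<epsilon>) * ((1 + \<theta> t i / real (H i))\<^sup>2 * (norm (drift i t l \<omega>))\<^sup>2)"
      using \<epsilon> by (intro mult_left_mono) auto
    moreover have "(norm (W \<omega>))\<^sup>2 \<le> (1 + \<epsilon>) * (norm (G \<omega>))\<^sup>2 + (1 + 1 / \<epsilon>) * (?h\<^sup>2 * (norm (q i t \<omega>))\<^sup>2)"
      using norm_add_sq_le_weighted[OF \<epsilon>, of "G \<omega>" "(- ?h) *\<^sub>R q i t \<omega>"]
      by (simp add: W_def power_mult_distrib)
    ultimately show "(norm (W \<omega>))\<^sup>2 \<le>
        (1 + \<epsilon>) * ((1 + \<theta> t i / real (H i))\<^sup>2 * (norm (drift i t l \<omega>))\<^sup>2)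
        + (1 + 1 / \<epsilon>) * (?h\<^sup>2 * (norm (q i t \<omega>))\<^sup>2)" by linarith
  qed
  also have "\<dots> = (1 + \<epsilon>) * ((1 + \<theta> t i / real (H i))\<^sup>2 * (\<integral>\<omega>. (norm (drift i t l \<omega>))\<^sup>2 \<partial>M))
      + (1 + 1 / \<epsilon>) * (?h\<^sup>2 * (\<integral>\<omega>. (norm (q i t \<omega>))\<^sup>2 \<partial>M))"
    using sq_integrableD(2)[OF sq_integrable_drift[OF i l']] sq_integrableD(2)[OF sq] by simp
  finally show ?thesis using 1 2 by linarith
qed

text \<open>Second moments grow quadratically in the number of steps through \<open>q\<close> but only linearly through the
noise, up to the accumulated Lipschitz factor.\<close>

lemma drift_growth:
  assumes i: "i < n" and sq: "sq_integrable M (q i t)" and l: "l \<le> H i"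
  defines "Q \<equiv> \<integral>\<omega>. (norm (q i t \<omega>))\<^sup>2 \<partial>M" and "s \<equiv> vsq P i / real (batch P i)"
  shows "(\<integral>\<omega>. (norm (drift i t l \<omega>))\<^sup>2 \<partial>M) \<le>
    ((1 + \<theta> t i / real (H i))\<^sup>2) ^ l * (2 * (real l)\<^sup>2 * ((\<eta> i t)\<^sup>2 * Q) + 2 * real l * ((\<eta> i t)\<^sup>2 * s))"
  using l
proof (induction l)
  case 0
  have "(\<integral>\<omega>. (norm (drift i t 0 \<omega>))\<^sup>2 \<partial>M) = (\<integral>\<omega>. 0 \<partial>M)"
    by (intro Bochner_Integration.integral_cong) (auto simp: drift_def y_0[OF _ i])
  then show ?case by simp
next
  case (Suc l)
  define r where "r = (1 + \<theta> t i / real (H i))\<^sup>2"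
  define A where "A = (\<eta> i t)\<^sup>2 * Q"
  define S where "S = (\<eta> i t)\<^sup>2 * s"
  define D where "D k = (\<integral>\<omega>. (norm (drift i t k \<omega>))\<^sup>2 \<partial>M)" for k
  have A0: "0 \<le> A" unfolding A_def Q_def by simp
  have S0: "0 \<le> S" unfolding S_def s_def using variance_bound_nonneg[OF i] by (intro mult_nonneg_nonneg) auto
  have "1 \<le> (1 + \<theta> t i / real (H i))" using \<theta>_pos[OF i, of t] by simp
  then have r1: "1 \<le> r" unfolding r_def by (rule one_le_power)
  have rl: "1 \<le> r ^ Suc l" by (rule one_le_power[OF r1])
  have IH: "D l \<le> r ^ l * (2 * (real l)\<^sup>2 * A + 2 * real l * S)"
    using Suc by (simp add: D_def r_def A_def S_def)
  have step: "D (Suc l) \<le> (1 + \<epsilon>) * (r * D l) + (1 + 1 / \<epsilon>) * A + S" if "0 < \<epsilon>" for \<epsilon>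
    using drift_step[OF i _ sq that, of l] Suc.prems
    by (simp add: D_def r_def A_def S_def Q_def s_def)
  have "D (Suc l) \<le> r ^ Suc l * (2 * (real (Suc l))\<^sup>2 * A + 2 * real (Suc l) * S)"
  proof (cases "l = 0")
    case True
    \<comment> \<open>In the first step there is no displacement yet, and any parameter will do.\<close>
    have "D 0 = 0"
      using IH True by (simp add: D_def order_antisym)
    then have "D (Suc l) \<le> 2 * A + S" using step[of 1] True by simp
    also have "\<dots> \<le> 1 * (2 * A + 2 * S)" using S0 by simp
    also have "\<dots> \<le> r ^ Suc l * (2 * A + 2 * S)"
      using rl A0 S0 by (intro mult_right_mono) auto
    finally show ?thesis using True by simp
  next
    case False
    then have l0: "0 < real l" by simp
    \<comment> \<open>The parameter is chosen so that the relative growth of \<open>D l\<close> leaves room for both \<open>A\<close> and \<open>S\<close>.\<close>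
    have "D (Suc l) \<le> (1 + 1 / (2 * real l)) * (r * D l) + (1 + 2 * real l) * A + S"
      using step[of "1 / (2 * real l)"] l0 by simp
    also have "\<dots> \<le> (1 + 1 / (2 * real l)) * (r * (r ^ l * (2 * (real l)\<^sup>2 * A + 2 * real l * S)))
        + ((1 + 2 * real l) * A + S)"
      using IH r1 l0 by (simp add: mult_left_mono)
    also have "\<dots> = r ^ Suc l * ((2 * (real l)\<^sup>2 + real l) * A + (2 * real l + 1) * S) + 1 * ((1 + 2 * real l) * A + S)"
      using l0 by (simp add: field_simps power2_eq_square)
    also have "\<dots> \<le> r ^ Suc l * ((2 * (real l)\<^sup>2 + real l) * A + (2 * real l + 1) * S)
        + r ^ Suc l * ((1 + 2 * real l) * A + S)"
      using rl A0 S0 l0 by (intro add_left_mono mult_right_mono) auto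
    also have "\<dots> = r ^ Suc l * ((2 * (real l)\<^sup>2 + 3 * real l + 1) * A + 2 * real (Suc l) * S)"
      by (simp add: algebra_simps)
    also have "\<dots> \<le> r ^ Suc l * (2 * (real (Suc l))\<^sup>2 * A + 2 * real (Suc l) * S)"
    proof (intro mult_left_mono add_right_mono mult_right_mono A0)
      show "2 * (real l)\<^sup>2 + 3 * real l + 1 \<le> 2 * (real (Suc l))\<^sup>2"
        using l0 by (simp add: power2_eq_square algebra_simps)
    qed (use rl in simp)
    finally show ?thesis .
  qed
  then show ?case by (simp only: D_def r_def A_def S_def)
qed

lemma drift_sq_le:
  assumes i: "i < n" and sq: "sq_integrable M (q i t)" and l: "l \<le> H i"
  shows "(\<integral>\<omega>. (norm (drift i t l \<omega>))\<^sup>2 \<partial>M) \<le>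
    exp (2 * \<theta> t i) * (2 * (\<theta> t i / L)\<^sup>2 * ((\<integral>\<omega>. (norm (q i t \<omega>))\<^sup>2 \<partial>M) + noise_level i))"
proof -
  define Q where "Q = (\<integral>\<omega>. (norm (q i t \<omega>))\<^sup>2 \<partial>M)"
  define s where "s = vsq P i / real (batch P i)"
  have Q0: "0 \<le> Q" by (simp add: Q_def)
  have s0: "0 \<le> s" using variance_bound_nonneg[OF i] by (simp add: s_def)
  have H0: "0 < real (H i)" using H_pos[OF i] by simp
  have lH: "real l \<le> real (H i)" using l by simp
  have th: "0 < \<theta> t i" by (rule \<theta>_pos[OF i])
  have "((1 + \<theta> t i / real (H i))\<^sup>2) ^ l \<le> ((exp (\<theta> t i / real (H i)))\<^sup>2) ^ l"
    using th H0 by (intro power_mono exp_ge_add_one_self) auto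
  also have "\<dots> = exp (real (2 * l) * (\<theta> t i / real (H i)))"
    by (simp only: exp_of_nat_mult power_mult)
  also have "\<dots> \<le> exp (2 * \<theta> t i)"
    using lH H0 th by (simp add: divide_simps mult_right_mono)
  finally have ex: "((1 + \<theta> t i / real (H i))\<^sup>2) ^ l \<le> exp (2 * \<theta> t i)" .
  have "2 * (real l)\<^sup>2 * ((\<eta> i t)\<^sup>2 * Q) + 2 * real l * ((\<eta> i t)\<^sup>2 * s)
      \<le> 2 * (real (H i))\<^sup>2 * ((\<eta> i t)\<^sup>2 * Q) + 2 * real (H i) * ((\<eta> i t)\<^sup>2 * s)"
    using lH Q0 s0 by (intro add_mono mult_right_mono mult_left_mono power_mono) auto
  also have "\<dots> = 2 * (\<eta> i t * real (H i))\<^sup>2 * (Q + s / real (H i))"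
    using H0 by (simp add: field_simps power2_eq_square)
  also have "\<dots> = 2 * (\<theta> t i / L)\<^sup>2 * (Q + noise_level i)"
    unfolding \<eta>_H[OF i] by (simp add: s_def noise_level_def mult.commute)
  finally have p: "2 * (real l)\<^sup>2 * ((\<eta> i t)\<^sup>2 * Q) + 2 * real l * ((\<eta> i t)\<^sup>2 * s)
      \<le> 2 * (\<theta> t i / L)\<^sup>2 * (Q + noise_level i)" .
  have "((1 + \<theta> t i / real (H i))\<^sup>2) ^ l * (2 * (real l)\<^sup>2 * ((\<eta> i t)\<^sup>2 * Q) + 2 * real l * ((\<eta> i t)\<^sup>2 * s))
      \<le> exp (2 * \<theta> t i) * (2 * (\<theta> t i / L)\<^sup>2 * (Q + noise_level i))"
    using ex p Q0 s0 by (intro mult_mono) auto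
  then show ?thesis
    using drift_growth[OF i sq l] unfolding Q_def s_def by linarith
qed

text \<open>The bound on the second moment of the drift in terms of a bound \<open>u\<close> on the expected suboptimality and
a bound \<open>chi\<close> on the second moments of the control-variate errors.\<close>

definition drift_bound :: "nat \<Rightarrow> nat \<Rightarrow> real \<Rightarrow> real \<Rightarrow> real" where
  "drift_bound i t u chi = exp (2 * \<theta> t i) * (2 * (\<theta> t i / L)\<^sup>2 * (4 * L * u + 8 * chi + noise_level i))"

end

text \<open>A round \<open>t\<close> at whose beginning \<open>u\<close> and \<open>chi\<close> are valid bounds.\<close>

locale hew_round = hew_run +
  fixes t :: nat and u chi :: real
  assumes gap_le: "expectation (gap t) \<le> u"
    and e_sq: "\<And>j. j < n \<Longrightarrow> sq_integrable M (e j t)"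
    and e_le: "\<And>j. j < n \<Longrightarrow> (\<integral>\<omega>. (norm (e j t \<omega>))\<^sup>2 \<partial>M) \<le> chi"
begin

lemma u_nonneg: "0 \<le> u"
  using expected_gap_bounds(1)[of t] gap_le by linarith

lemma chi_nonneg: "0 \<le> chi"
  using e_le[of 0] n_pos order_trans[OF Bochner_Integration.integral_nonneg e_le[of 0]]
  by (simp add: Suc_le_eq)

lemma q_sq_le:
  assumes i: "i < n"
  shows "(\<integral>\<omega>. (norm (q i t \<omega>))\<^sup>2 \<partial>M) \<le> 4 * L * u + 8 * chi"
proof -
  note bI = sq_integrableD(2)[OF sq_integrable_bias[OF e_sq i]]
  note gI = sq_integrableD(2)[OF sq_integrable_gF_x[of t]]
  have "(\<integral>\<omega>. (norm (q i t \<omega>))\<^sup>2 \<partial>M) \<le> (\<integral>\<omega>. 2 * (norm (gF (x t \<omega>)))\<^sup>2 + 2 * (norm (bias i t \<omega>))\<^sup>2 \<partial>M)"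
    using norm_add_sq_le bI gI
    by (intro integral_mono sq_integrableD(2)[OF sq_integrable_q[OF e_sq i]]) (auto simp: q_bias)
  also have "\<dots> = 2 * (\<integral>\<omega>. (norm (gF (x t \<omega>)))\<^sup>2 \<partial>M) + 2 * (\<integral>\<omega>. (norm (bias i t \<omega>))\<^sup>2 \<partial>M)"
    using bI gI by simp
  also have "\<dots> \<le> 2 * (2 * L * u) + 2 * (4 * chi)"
  proof (intro add_mono mult_left_mono)
    have "2 * L * expectation (gap t) \<le> 2 * L * u" using gap_le L_pos by simp
    then show "(\<integral>\<omega>. (norm (gF (x t \<omega>)))\<^sup>2 \<partial>M) \<le> 2 * L * u"
      using gF_sq_expectation_le[of t] by linarith
  qed (use bias_sq_le[OF e_sq e_le i] in auto)
  finally show ?thesis by simp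
qed

lemma drift_le:
  assumes i: "i < n" and l: "l \<le> H i"
  shows "(\<integral>\<omega>. (norm (drift i t l \<omega>))\<^sup>2 \<partial>M) \<le> drift_bound i t u chi"
proof -
  have "exp (2 * \<theta> t i) * (2 * (\<theta> t i / L)\<^sup>2 * ((\<integral>\<omega>. (norm (q i t \<omega>))\<^sup>2 \<partial>M) + noise_level i))
      \<le> drift_bound i t u chi"
    unfolding drift_bound_def using q_sq_le[OF i] by (intro mult_left_mono add_right_mono) auto
  then show ?thesis using drift_sq_le[OF i sq_integrable_q[OF e_sq i] l] by linarith
qed

lemma sq_integrable_grad_shift: "i < n \<Longrightarrow> sq_integrable M (grad_shift i t)"
  unfolding grad_shift_def[abs_def]
  by (intro sq_integrable_scaleR sq_integrable_sum sq_integrable_diff sq_integrable_gf_y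
      sq_integrable_gf_x) auto

lemma grad_shift_le:
  assumes i: "i < n"
  shows "(\<integral>\<omega>. (norm (grad_shift i t \<omega>))\<^sup>2 \<partial>M) \<le> L\<^sup>2 * drift_bound i t u chi"
proof -
  have H0: "0 < real (H i)" using H_pos[OF i] by simp
  have dI: "integrable M (\<lambda>\<omega>. (norm (drift i t l \<omega>))\<^sup>2)" if "l < H i" for l
    using that by (intro sq_integrableD(2)[OF sq_integrable_drift[OF i]]) simp
  have "(\<integral>\<omega>. (norm (grad_shift i t \<omega>))\<^sup>2 \<partial>M)
      \<le> (\<integral>\<omega>. (1 / real (H i)) * (\<Sum>l<H i. L\<^sup>2 * (norm (drift i t l \<omega>))\<^sup>2) \<partial>M)"
  proof (rule integral_mono)
    show "integrable M (\<lambda>\<omega>. (norm (grad_shift i t \<omega>))\<^sup>2)"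
      by (rule sq_integrableD(2)[OF sq_integrable_grad_shift[OF i]])
    show "integrable M (\<lambda>\<omega>. (1 / real (H i)) * (\<Sum>l<H i. L\<^sup>2 * (norm (drift i t l \<omega>))\<^sup>2))"
      using dI by (intro integrable_mult_right Bochner_Integration.integrable_sum) auto
    fix \<omega>
    have "(norm (grad_shift i t \<omega>))\<^sup>2
        \<le> (1 / real (H i)) * (\<Sum>l<H i. (norm (gf i (y i t l \<omega>) - gf i (x t \<omega>)))\<^sup>2)"
      unfolding grad_shift_def by (rule norm_mean_sq_le[OF H_pos[OF i]])
    also have "\<dots> \<le> (1 / real (H i)) * (\<Sum>l<H i. L\<^sup>2 * (norm (drift i t l \<omega>))\<^sup>2)"
      unfolding drift_def using gf_lipschitz_sq[OF i] by (intro mult_left_mono sum_mono) auto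
    finally show "(norm (grad_shift i t \<omega>))\<^sup>2 \<le> (1 / real (H i)) * (\<Sum>l<H i. L\<^sup>2 * (norm (drift i t l \<omega>))\<^sup>2)" .
  qed
  also have "\<dots> = (1 / real (H i)) * (\<Sum>l<H i. L\<^sup>2 * (\<integral>\<omega>. (norm (drift i t l \<omega>))\<^sup>2 \<partial>M))"
    using dI H0 by simp
  also have "\<dots> \<le> (1 / real (H i)) * (\<Sum>l<H i. L\<^sup>2 * drift_bound i t u chi)"
    using drift_le[OF i] by (intro mult_left_mono sum_mono) auto
  also have "\<dots> = L\<^sup>2 * drift_bound i t u chi" using H0 by simp
  finally show ?thesis .
qed

end

section \<open>One round\<close>

context hew_run
begin

text \<open>In this form the value of a round is visibly increasing in \<open>u\<close> and \<open>chi\<close>.\<close>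

lemma J_id_eq:
  "J_id P (w t) (\<theta> t) u chi =
    (\<Sum>i<n. w t i * T_map (A_coef P (\<theta> t i)) u) + (\<Sum>i<n. w t i * rho P i (\<theta> t i) u chi)
    + L / 2 * (\<Sum>i<n. (w t i)\<^sup>2 * kappa P i (\<theta> t i) u chi)"
proof -
  have "(\<Sum>i<n. w t i * mu P i (\<theta> t i) u chi) =
      (\<Sum>i<n. w t i * u - w t i * T_map (A_coef P (\<theta> t i)) u - w t i * rho P i (\<theta> t i) u chi)"
    by (intro sum.cong) (auto simp: mu_def s_gain_def algebra_simps)
  also have "\<dots> = u - (\<Sum>i<n. w t i * T_map (A_coef P (\<theta> t i)) u) - (\<Sum>i<n. w t i * rho P i (\<theta> t i) u chi)"
    using w_sum[of t] by (simp add: sum_subtractf flip: sum_distrib_right)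
  finally show ?thesis by (simp add: J_id_def)
qed

lemma e_Suc:
  assumes \<omega>: "\<omega> \<in> space M" and i: "i < n"
  shows "e i (Suc t) \<omega> = (1 / real (H i)) *\<^sub>R (\<Sum>l<H i. \<xi> i t l \<omega>) + grad_shift i t \<omega>
    + (gf i (x t \<omega>) - gf i (x (Suc t) \<omega>))"
proof -
  have "(\<Sum>l<H i. sg i t l \<omega>)
      = (\<Sum>l<H i. \<xi> i t l \<omega> + (gf i (y i t l \<omega>) - gf i (x t \<omega>)) + gf i (x t \<omega>))"
    by (intro sum.cong) (auto simp: \<xi>_def)
  also have "\<dots> = (\<Sum>l<H i. \<xi> i t l \<omega>) + (\<Sum>l<H i. gf i (y i t l \<omega>) - gf i (x t \<omega>))
      + real (H i) *\<^sub>R gf i (x t \<omega>)"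
    by (simp only: sum.distrib sum_constant_scaleR card_lessThan)
  finally have "c i (Suc t) \<omega> = (1 / real (H i)) *\<^sub>R ((\<Sum>l<H i. \<xi> i t l \<omega>)
      + (\<Sum>l<H i. gf i (y i t l \<omega>) - gf i (x t \<omega>)) + real (H i) *\<^sub>R gf i (x t \<omega>))"
    using c_Suc[OF \<omega> i] by simp
  then show ?thesis
    using H_pos[OF i] by (simp add: e_def grad_shift_def scaleR_add_right)
qed

lemma sq_integrable_e_Suc:
  assumes i: "i < n"
  shows "sq_integrable M (e i (Suc t))"
proof -
  have "sq_integrable M (\<lambda>\<omega>. (1 / real (H i)) *\<^sub>R (\<Sum>l<H i. sg i t l \<omega>) - gf i (x (Suc t) \<omega>))"
    by (intro sq_integrable_diff sq_integrable_scaleR sq_integrable_sum sq_integrable_sg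
        sq_integrable_gf_x i) auto
  moreover have "sq_integrable M (e i (Suc t)) \<longleftrightarrow>
      sq_integrable M (\<lambda>\<omega>. (1 / real (H i)) *\<^sub>R (\<Sum>l<H i. sg i t l \<omega>) - gf i (x (Suc t) \<omega>))"
    by (rule sq_integrable_cong) (simp add: e_def c_Suc[OF _ i])
  ultimately show ?thesis by blast
qed

lemma y_end_displacement:
  assumes \<omega>: "\<omega> \<in> space M" and i: "i < n"
  shows "y i t (H i) \<omega> - x t \<omega> = - (\<theta> t i / L) *\<^sub>R (gF (x t \<omega>) + (bias i t \<omega> + grad_shift i t \<omega>))
    - \<eta> i t *\<^sub>R (\<Sum>l<H i. \<xi> i t l \<omega>)"
proof -
  have H0: "real (H i) \<noteq> 0" using H_pos[OF i] by simp
  have "(\<Sum>l<H i. sg i t l \<omega> - c i t \<omega> + cs t \<omega>)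
      = (\<Sum>l<H i. \<xi> i t l \<omega> + (gf i (y i t l \<omega>) - gf i (x t \<omega>)) + q i t \<omega>)"
    by (intro sum.cong) (auto simp: \<xi>_def q_def)
  also have "\<dots> = (\<Sum>l<H i. \<xi> i t l \<omega>) + (\<Sum>l<H i. gf i (y i t l \<omega>) - gf i (x t \<omega>))
      + real (H i) *\<^sub>R q i t \<omega>"
    by (simp only: sum.distrib sum_constant_scaleR card_lessThan)
  also have "(\<Sum>l<H i. gf i (y i t l \<omega>) - gf i (x t \<omega>)) = real (H i) *\<^sub>R grad_shift i t \<omega>"
    using H0 by (simp add: grad_shift_def)
  finally have "y i t (H i) \<omega> - x t \<omega> = - \<eta> i t *\<^sub>R ((\<Sum>l<H i. \<xi> i t l \<omega>)
      + real (H i) *\<^sub>R (gF (x t \<omega>) + bias i t \<omega> + grad_shift i t \<omega>))"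
    using y_displacement[OF \<omega> i order_refl, of t] by (simp add: q_bias[OF \<omega>] algebra_simps)
  also have "\<dots> = - (\<eta> i t * real (H i)) *\<^sub>R (gF (x t \<omega>) + (bias i t \<omega> + grad_shift i t \<omega>))
      - \<eta> i t *\<^sub>R (\<Sum>l<H i. \<xi> i t l \<omega>)"
    by (simp add: algebra_simps)
  finally show ?thesis by (simp only: \<eta>_H[OF i])
qed

text \<open>The total noise that a round contributes to the server iterate.\<close>

definition round_noise :: "nat \<Rightarrow> 'w \<Rightarrow> 'a" where
  "round_noise t \<omega> = (\<Sum>i<n. (w t i * \<eta> i t) *\<^sub>R (\<Sum>l<H i. \<xi> i t l \<omega>))"

lemma sq_integrable_round_noise: "sq_integrable M (round_noise t)"
  unfolding round_noise_def[abs_def]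
  by (intro sq_integrable_sum sq_integrable_scaleR sq_integrable_\<xi>) auto

text \<open>All noise terms of a round are pairwise orthogonal, which yields the squared weights.\<close>

lemma round_noise_sq_le:
  "L * (\<integral>\<omega>. (norm (round_noise t \<omega>))\<^sup>2 \<partial>M) \<le> (\<Sum>i<n. (w t i)\<^sup>2 * ((\<theta> t i)\<^sup>2 / L * noise_level i))"
proof -
  have "L * (\<integral>\<omega>. (norm (round_noise t \<omega>))\<^sup>2 \<partial>M)
      \<le> L * (\<Sum>i<n. (w t i * \<eta> i t)\<^sup>2 * (real (H i) * (vsq P i / real (batch P i))))"
    unfolding round_noise_def using L_pos by (intro mult_left_mono noise_sum_sq_le) auto
  also have "\<dots> = (\<Sum>i<n. (w t i)\<^sup>2 * ((\<theta> t i)\<^sup>2 / L * noise_level i))"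
    unfolding sum_distrib_left
  proof (intro sum.cong refl)
    fix i assume "i \<in> {..<n}"
    then have "H i \<noteq> 0" using H_pos[of i] by simp
    then show "L * ((w t i * \<eta> i t)\<^sup>2 * (real (H i) * (vsq P i / real (batch P i))))
        = (w t i)\<^sup>2 * ((\<theta> t i)\<^sup>2 / L * noise_level i)"
      using L_pos by (simp add: stepsize_def noise_level_def power2_eq_square)
  qed
  finally show ?thesis .
qed

lemma round_noise_orthogonal: "(\<integral>\<omega>. gF (x t \<omega>) \<bullet> round_noise t \<omega> \<partial>M) = 0"
proof -
  have z: "(\<integral>\<omega>. gF (x t \<omega>) \<bullet> \<xi> i t l \<omega> \<partial>M) = 0" if "i < n" "l < H i" for i l
    using noise_orthogonal[OF that lift_rh[OF gF_meas[OF x_meas]]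
        sq_integrable_integrable[OF sq_integrable_gF_x]]
    by (simp add: inner_commute)
  have int: "integrable M (\<lambda>\<omega>. gF (x t \<omega>) \<bullet> \<xi> i t l \<omega>)" if "i < n" "l < H i" for i l
    by (rule sq_integrable_inner[OF sq_integrable_gF_x sq_integrable_\<xi>[OF that]])
  have "(\<integral>\<omega>. gF (x t \<omega>) \<bullet> round_noise t \<omega> \<partial>M)
      = (\<integral>\<omega>. (\<Sum>i<n. (w t i * \<eta> i t) * (\<Sum>l<H i. gF (x t \<omega>) \<bullet> \<xi> i t l \<omega>)) \<partial>M)"
    by (simp add: round_noise_def inner_sum_right)
  also have "\<dots> = (\<Sum>i<n. \<integral>\<omega>. (w t i * \<eta> i t) * (\<Sum>l<H i. gF (x t \<omega>) \<bullet> \<xi> i t l \<omega>) \<partial>M)"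
    using int by (intro Bochner_Integration.integral_sum integrable_mult_right
        Bochner_Integration.integrable_sum) auto
  also have "\<dots> = 0"
  proof (intro sum.neutral ballI)
    fix i assume i: "i \<in> {..<n}"
    have "(\<integral>\<omega>. (\<Sum>l<H i. gF (x t \<omega>) \<bullet> \<xi> i t l \<omega>) \<partial>M) = (\<Sum>l<H i. \<integral>\<omega>. gF (x t \<omega>) \<bullet> \<xi> i t l \<omega> \<partial>M)"
      using int i by (intro Bochner_Integration.integral_sum) auto
    also have "\<dots> = 0" using z i by simp
    finally show "(\<integral>\<omega>. (w t i * \<eta> i t) * (\<Sum>l<H i. gF (x t \<omega>) \<bullet> \<xi> i t l \<omega>) \<partial>M) = 0"
      by (simp only: integral_mult_right_zero mult_zero_right)
  qed
  finally show ?thesis .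
qed

text \<open>Descent along one sample path. The noise is kept apart from the rest of the server step, so that
its inner product with the gradient at the \<open>t\<close>-th iterate vanishes in expectation.\<close>

lemma gap_Suc_le:
  assumes \<omega>: "\<omega> \<in> space M" and ball: "x t \<omega> \<in> trust_ball P"
  shows "gap (Suc t) \<omega> \<le> gap t \<omega> - gF (x t \<omega>) \<bullet> round_noise t \<omega> + L * (norm (round_noise t \<omega>))\<^sup>2
    + (\<Sum>i<n. w t i * (\<theta> t i / L * ((norm (bias i t \<omega> + grad_shift i t \<omega>))\<^sup>2
        - (gap t \<omega>)\<^sup>2 / (2 * (radius P)\<^sup>2))))"
proof -
  let ?G = "gF (x t \<omega>)" and ?N = "round_noise t \<omega>"
  define b where "b i = bias i t \<omega> + grad_shift i t \<omega>" for i
  define V where "V = (\<Sum>i<n. w t i *\<^sub>R (- (\<theta> t i / L) *\<^sub>R (?G + b i)))"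
  have "(\<Sum>i<n. w t i *\<^sub>R (y i t (H i) \<omega> - x t \<omega>))
      = (\<Sum>i<n. w t i *\<^sub>R (- (\<theta> t i / L) *\<^sub>R (?G + b i)) - (w t i * \<eta> i t) *\<^sub>R (\<Sum>l<H i. \<xi> i t l \<omega>))"
    using y_end_displacement[OF \<omega>] by (intro sum.cong) (auto simp: b_def scaleR_diff_right)
  also have "\<dots> = V - ?N"
    by (simp only: sum_subtractf V_def round_noise_def)
  finally have xS: "x (Suc t) \<omega> = x t \<omega> + (V - ?N)" using x_Suc[OF \<omega>] by simp
  have 1: "gap (Suc t) \<omega> \<le> gap t \<omega> + ?G \<bullet> (V - ?N) + L / 2 * (norm (V - ?N))\<^sup>2"
    using smooth_fun_descent[OF global_smooth, of "x t \<omega>" "V - ?N"] by (simp add: gap_def xS)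
  \<comment> \<open>The factor 2 costs nothing: the variance part of \<open>kappa\<close> provides for it.\<close>
  have "(norm (V - ?N))\<^sup>2 \<le> 2 * (norm V)\<^sup>2 + 2 * (norm ?N)\<^sup>2"
    using norm_add_sq_le[of V "- ?N"] by simp
  then have 2: "L / 2 * (norm (V - ?N))\<^sup>2 \<le> L / 2 * (2 * (norm V)\<^sup>2 + 2 * (norm ?N)\<^sup>2)"
    using L_pos by (intro mult_left_mono) auto
  have "(norm V)\<^sup>2 \<le> (\<Sum>i<n. w t i * (norm (- (\<theta> t i / L) *\<^sub>R (?G + b i)))\<^sup>2)"
    unfolding V_def by (rule norm_weighted_mean_sq_le) (auto simp: w_nonneg w_sum)
  then have 3: "L * (norm V)\<^sup>2 \<le> L * (\<Sum>i<n. w t i * (norm (- (\<theta> t i / L) *\<^sub>R (?G + b i)))\<^sup>2)"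
    using L_pos by (intro mult_left_mono) auto
  have "?G \<bullet> V + L * (\<Sum>i<n. w t i * (norm (- (\<theta> t i / L) *\<^sub>R (?G + b i)))\<^sup>2)
      = (\<Sum>i<n. w t i * (\<theta> t i / L * (- (?G \<bullet> (?G + b i)) + \<theta> t i * (norm (?G + b i))\<^sup>2)))"
    unfolding V_def inner_sum_right sum_distrib_left sum.distrib[symmetric]
  proof (intro sum.cong refl)
    fix i
    have "(norm (- (\<theta> t i / L) *\<^sub>R (?G + b i)))\<^sup>2 = (\<theta> t i / L)\<^sup>2 * (norm (?G + b i))\<^sup>2"
      by (simp add: power_mult_distrib power_divide)
    then show "?G \<bullet> w t i *\<^sub>R (- (\<theta> t i / L) *\<^sub>R (?G + b i))
        + L * (w t i * (norm (- (\<theta> t i / L) *\<^sub>R (?G + b i)))\<^sup>2)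
        = w t i * (\<theta> t i / L * (- (?G \<bullet> (?G + b i)) + \<theta> t i * (norm (?G + b i))\<^sup>2))"
      using L_pos by (simp only: inner_scaleR_right) (simp add: field_simps power2_eq_square)
  qed
  also have "\<dots> \<le> (\<Sum>i<n. w t i * (\<theta> t i / L * ((norm (b i))\<^sup>2 - (gap t \<omega>)\<^sup>2 / (2 * (radius P)\<^sup>2))))"
  proof (intro sum_mono mult_left_mono)
    fix i assume "i \<in> {..<n}"
    then have i: "i < n" by simp
    have "(gap t \<omega>)\<^sup>2 / (2 * (radius P)\<^sup>2) \<le> (norm ?G)\<^sup>2 / 2"
      using gap_le_gradient[OF ball] R_pos by (simp add: field_simps)
    moreover have "- (?G \<bullet> (?G + b i)) + \<theta> t i * (norm (?G + b i))\<^sup>2 \<le> (norm (b i))\<^sup>2 - (norm ?G)\<^sup>2 / 2"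
      using \<theta>_pos[OF i, of t] \<theta>_le[OF i, of t] \<theta>hi_small by (intro perturbed_gradient_step_le) auto
    ultimately show "- (?G \<bullet> (?G + b i)) + \<theta> t i * (norm (?G + b i))\<^sup>2
        \<le> (norm (b i))\<^sup>2 - (gap t \<omega>)\<^sup>2 / (2 * (radius P)\<^sup>2)" by linarith
    show "0 \<le> \<theta> t i / L" using \<theta>_pos[OF i, of t] L_pos by simp
  qed (simp add: w_nonneg)
  finally have 4: "?G \<bullet> V + L * (\<Sum>i<n. w t i * (norm (- (\<theta> t i / L) *\<^sub>R (?G + b i)))\<^sup>2)
      \<le> (\<Sum>i<n. w t i * (\<theta> t i / L * ((norm (b i))\<^sup>2 - (gap t \<omega>)\<^sup>2 / (2 * (radius P)\<^sup>2))))" .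
  have "?G \<bullet> (V - ?N) = ?G \<bullet> V - ?G \<bullet> ?N" by (rule inner_diff_right)
  moreover have "L / 2 * (2 * (norm V)\<^sup>2 + 2 * (norm ?N)\<^sup>2) = L * (norm V)\<^sup>2 + L * (norm ?N)\<^sup>2"
    by (simp add: algebra_simps)
  ultimately show ?thesis using 1 2 3 4 unfolding b_def by linarith
qed

end

context hew_round
begin

lemma drift_bound_le:
  assumes i: "i < n" and V: "noise_level i \<le> V"
  shows "L\<^sup>2 * drift_bound i t u chi \<le> 6 * \<theta>hi\<^sup>2 * (4 * L * u + 8 * chi + V)"
proof -
  have th: "0 < \<theta> t i" "\<theta> t i \<le> \<theta>hi" using \<theta>_pos[OF i] \<theta>_le[OF i] by auto
  have nn: "0 \<le> 4 * L * u + 8 * chi + noise_level i"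
    using noise_level_nonneg[OF i] u_nonneg chi_nonneg L_pos by simp
  have "L\<^sup>2 * drift_bound i t u chi = exp (2 * \<theta> t i) * (2 * (\<theta> t i)\<^sup>2 * (4 * L * u + 8 * chi + noise_level i))"
    using L_pos by (simp add: drift_bound_def power_divide)
  also have "\<dots> \<le> 3 * (2 * \<theta>hi\<^sup>2 * (4 * L * u + 8 * chi + V))"
    using th V nn \<theta>hi_small by (intro mult_mono exp_le_3 power_mono) auto
  finally show ?thesis by simp
qed

text \<open>The new control-variate error consists of averaged noise, of the gradient shift along the local
trajectory, and of the gradient change caused by the move of the server.\<close>

lemma next_error_le:
  assumes i: "i < n" and V: "\<And>j. j < n \<Longrightarrow> noise_level j \<le> V"
  shows "(\<integral>\<omega>. (norm (e i (Suc t) \<omega>))\<^sup>2 \<partial>M) \<le> 6 * V + 144 * L * \<theta>hi\<^sup>2 * u + 288 * \<theta>hi\<^sup>2 * chi"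
proof -
  define K where "K = 6 * \<theta>hi\<^sup>2 * (4 * L * u + 8 * chi + V)"
  define N where "N \<omega> = (1 / real (H i)) *\<^sub>R (\<Sum>l<H i. \<xi> i t l \<omega>)" for \<omega>
  have V0: "0 \<le> V" using noise_level_nonneg[OF i] V[OF i] by linarith
  have H0: "real (H i) \<noteq> 0" using H_pos[OF i] by simp
  have Nsq: "sq_integrable M N"
    unfolding N_def[abs_def] by (intro sq_integrable_scaleR sq_integrable_sum sq_integrable_\<xi> i) auto
  have dI: "integrable M (\<lambda>\<omega>. (norm (drift j t (H j) \<omega>))\<^sup>2)" if "j < n" for j
    by (rule sq_integrableD(2)[OF sq_integrable_drift[OF that order_refl]])
  have DI: "integrable M (\<lambda>\<omega>. L\<^sup>2 * (\<Sum>j<n. w t j * (norm (drift j t (H j) \<omega>))\<^sup>2))"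
    using dI by (intro integrable_mult_right Bochner_Integration.integrable_sum) auto
  have NI: "integrable M (\<lambda>\<omega>. (norm (N \<omega>))\<^sup>2)" by (rule sq_integrableD(2)[OF Nsq])
  have SI: "integrable M (\<lambda>\<omega>. (norm (grad_shift i t \<omega>))\<^sup>2)"
    by (rule sq_integrableD(2)[OF sq_integrable_grad_shift[OF i]])
  have N_le: "(\<integral>\<omega>. (norm (N \<omega>))\<^sup>2 \<partial>M) \<le> V"
  proof -
    have "(\<integral>\<omega>. (norm (N \<omega>))\<^sup>2 \<partial>M) \<le> (1 / real (H i))\<^sup>2 * (real (H i) * (vsq P i / real (batch P i)))"
      using noise_sum_sq_le[of "{i}" "\<lambda>_. 1 / real (H i)" t] i by (simp add: N_def)
    also have "\<dots> = noise_level i"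
      using H0 by (simp add: noise_level_def power2_eq_square)
    finally show ?thesis using V[OF i] by linarith
  qed
  have S_le: "(\<integral>\<omega>. (norm (grad_shift i t \<omega>))\<^sup>2 \<partial>M) \<le> K"
    using grad_shift_le[OF i] drift_bound_le[OF i V[OF i]] unfolding K_def by linarith
  have D_le: "(\<integral>\<omega>. L\<^sup>2 * (\<Sum>j<n. w t j * (norm (drift j t (H j) \<omega>))\<^sup>2) \<partial>M) \<le> K"
  proof -
    have "(\<integral>\<omega>. L\<^sup>2 * (\<Sum>j<n. w t j * (norm (drift j t (H j) \<omega>))\<^sup>2) \<partial>M)
        = (\<Sum>j<n. w t j * (L\<^sup>2 * (\<integral>\<omega>. (norm (drift j t (H j) \<omega>))\<^sup>2 \<partial>M)))"
      using dI by (simp add: sum_distrib_left mult.left_commute)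
    also have "\<dots> \<le> (\<Sum>j<n. w t j * K)"
    proof (intro sum_mono mult_left_mono)
      fix j assume "j \<in> {..<n}"
      then have j: "j < n" by simp
      have "L\<^sup>2 * (\<integral>\<omega>. (norm (drift j t (H j) \<omega>))\<^sup>2 \<partial>M) \<le> L\<^sup>2 * drift_bound j t u chi"
        by (intro mult_left_mono drift_le j) auto
      then show "L\<^sup>2 * (\<integral>\<omega>. (norm (drift j t (H j) \<omega>))\<^sup>2 \<partial>M) \<le> K"
        using drift_bound_le[OF j V[OF j]] unfolding K_def by linarith
    qed (simp add: w_nonneg)
    also have "\<dots> = K" by (simp add: w_sum flip: sum_distrib_right)
    finally show ?thesis .
  qed
  have "(\<integral>\<omega>. (norm (e i (Suc t) \<omega>))\<^sup>2 \<partial>M) \<le>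
      (\<integral>\<omega>. 3 * (norm (N \<omega>))\<^sup>2 + 3 * (norm (grad_shift i t \<omega>))\<^sup>2
        + 3 * (L\<^sup>2 * (\<Sum>j<n. w t j * (norm (drift j t (H j) \<omega>))\<^sup>2)) \<partial>M)"
  proof (rule integral_mono)
    show "integrable M (\<lambda>\<omega>. (norm (e i (Suc t) \<omega>))\<^sup>2)"
      by (rule sq_integrableD(2)[OF sq_integrable_e_Suc[OF i]])
    show "integrable M (\<lambda>\<omega>. 3 * (norm (N \<omega>))\<^sup>2 + 3 * (norm (grad_shift i t \<omega>))\<^sup>2
        + 3 * (L\<^sup>2 * (\<Sum>j<n. w t j * (norm (drift j t (H j) \<omega>))\<^sup>2)))"
      by (intro Bochner_Integration.integrable_add) (rule integrable_mult_right, rule NI SI DI)+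
    fix \<omega> assume \<omega>: "\<omega> \<in> space M"
    have "(norm (x (Suc t) \<omega> - x t \<omega>))\<^sup>2 \<le> (\<Sum>j<n. w t j * (norm (drift j t (H j) \<omega>))\<^sup>2)"
      using norm_weighted_mean_sq_le[of "{..<n}" "w t" "\<lambda>j. drift j t (H j) \<omega>"] w_nonneg w_sum
      by (simp add: x_Suc[OF \<omega>] drift_def)
    then have "L\<^sup>2 * (norm (x t \<omega> - x (Suc t) \<omega>))\<^sup>2 \<le> L\<^sup>2 * (\<Sum>j<n. w t j * (norm (drift j t (H j) \<omega>))\<^sup>2)"
      by (intro mult_left_mono) (simp_all add: norm_minus_commute)
    then have "(norm (gf i (x t \<omega>) - gf i (x (Suc t) \<omega>)))\<^sup>2
        \<le> L\<^sup>2 * (\<Sum>j<n. w t j * (norm (drift j t (H j) \<omega>))\<^sup>2)"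
      using gf_lipschitz_sq[OF i, of "x t \<omega>" "x (Suc t) \<omega>"] by linarith
    then show "(norm (e i (Suc t) \<omega>))\<^sup>2 \<le> 3 * (norm (N \<omega>))\<^sup>2 + 3 * (norm (grad_shift i t \<omega>))\<^sup>2
        + 3 * (L\<^sup>2 * (\<Sum>j<n. w t j * (norm (drift j t (H j) \<omega>))\<^sup>2))"
      using norm_add3_sq_le[of "N \<omega>" "grad_shift i t \<omega>" "gf i (x t \<omega>) - gf i (x (Suc t) \<omega>)"]
      unfolding e_Suc[OF \<omega> i] N_def by linarith
  qed
  also have "\<dots> = 3 * (\<integral>\<omega>. (norm (N \<omega>))\<^sup>2 \<partial>M) + 3 * (\<integral>\<omega>. (norm (grad_shift i t \<omega>))\<^sup>2 \<partial>M)
        + 3 * (\<integral>\<omega>. L\<^sup>2 * (\<Sum>j<n. w t j * (norm (drift j t (H j) \<omega>))\<^sup>2) \<partial>M)"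
    using NI SI DI
    by (simp only: Bochner_Integration.integral_add Bochner_Integration.integrable_add
        integrable_mult_right integral_mult_right_zero)
  also have "\<dots> \<le> 3 * V + 6 * K" using N_le S_le D_le by linarith
  also have "\<dots> = 3 * V + 36 * (\<theta>hi\<^sup>2 * V) + 144 * L * \<theta>hi\<^sup>2 * u + 288 * \<theta>hi\<^sup>2 * chi"
    by (simp add: K_def algebra_simps)
  also have "\<dots> \<le> 6 * V + 144 * L * \<theta>hi\<^sup>2 * u + 288 * \<theta>hi\<^sup>2 * chi"
  proof -
    \<comment> \<open>The contraction hypothesis absorbs the noise that enters through the drift.\<close>
    have "\<theta>hi\<^sup>2 * V \<le> (1 / 288) * V" using \<theta>hi_sq V0 by (intro mult_right_mono) auto
    then show ?thesis using V0 by linarith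
  qed
  finally show ?thesis .
qed

lemma node_budget:
  assumes i: "i < n"
  shows "\<theta> t i / L * (8 * chi + 2 * (L\<^sup>2 * drift_bound i t u chi)) \<le> rho P i (\<theta> t i) u chi"
proof -
  let ?\<theta> = "\<theta> t i"
  define E where "E = exp (2 * ?\<theta>) * ?\<theta> ^ 3"
  have th: "0 < ?\<theta>" by (rule \<theta>_pos[OF i])
  have E0: "0 \<le> E" using th by (simp add: E_def)
  have nl: "0 \<le> noise_level i" by (rule noise_level_nonneg[OF i])
  have "?\<theta> / L * (8 * chi + 2 * (L\<^sup>2 * drift_bound i t u chi))
      = 8 * (?\<theta> / L * chi) + 16 * (E * u) + 32 * (E / L * chi) + 4 * (E / L * noise_level i)"
    using L_pos by (simp add: drift_bound_def E_def field_simps power2_eq_square power3_eq_cube)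
  moreover have "rho P i ?\<theta> u chi
      = 32 * (E * u) + 16 * (?\<theta> / L * chi) + 64 * (E / L * chi) + 8 * (E / L * noise_level i)"
    using L_pos by (simp add: rho_def E_def noise_level_def field_simps)
  moreover have "0 \<le> E * u" "0 \<le> ?\<theta> / L * chi" "0 \<le> E / L * chi" "0 \<le> E / L * noise_level i"
    using E0 th nl u_nonneg chi_nonneg L_pos by auto
  ultimately show ?thesis by linarith
qed

lemma noise_budget:
  assumes i: "i < n"
  shows "(\<theta> t i)\<^sup>2 / L * noise_level i \<le> L / 2 * kappa P i (\<theta> t i) u chi"
proof -
  let ?\<theta> = "\<theta> t i"
  define E where "E = exp (2 * ?\<theta>) * ?\<theta> ^ 4"
  have E0: "0 \<le> E" using \<theta>_pos[OF i, of t] by (simp add: E_def)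
  have nl: "0 \<le> noise_level i" by (rule noise_level_nonneg[OF i])
  have "L / 2 * kappa P i ?\<theta> u chi
      = 8 * (E * u) + 16 * (E / L * chi) + 2 * (E / L * noise_level i) + ?\<theta>\<^sup>2 / L * noise_level i"
    using L_pos H_pos[OF i] batch_pos[OF i]
    by (simp add: kappa_def E_def noise_level_def field_simps power2_eq_square)
  moreover have "0 \<le> E * u" "0 \<le> E / L * chi" "0 \<le> E / L * noise_level i"
    using E0 nl u_nonneg chi_nonneg L_pos by auto
  ultimately show ?thesis by linarith
qed

text \<open>Jensen's inequality passes to the expected gap, \<open>g - A g\<^sup>2 \<le> g / (1 + A g)\<close>, and the right-hand side is
increasing in \<open>g\<close>.\<close>

lemma contraction_step:
  assumes i: "i < n"
  shows "expectation (gap t) - \<theta> t i / L * (expectation (\<lambda>\<omega>. (gap t \<omega>)\<^sup>2) / (2 * (radius P)\<^sup>2))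
    \<le> T_map (A_coef P (\<theta> t i)) u"
proof -
  define A where "A = A_coef P (\<theta> t i)"
  define g where "g = expectation (gap t)"
  have A0: "0 \<le> A"
    using \<theta>_pos[OF i, of t] L_pos R_pos by (simp add: A_def A_coef_def)
  have g0: "0 \<le> g" and gu: "g \<le> u"
    using expected_gap_bounds(1)[of t] gap_le by (simp_all add: g_def)
  have "A * g\<^sup>2 \<le> A * expectation (\<lambda>\<omega>. (gap t \<omega>)\<^sup>2)"
    unfolding g_def using A0 by (intro mult_left_mono square_expectation_le gap_integrable gap_sq_integrable)
  moreover have "A * expectation (\<lambda>\<omega>. (gap t \<omega>)\<^sup>2)
      = \<theta> t i / L * (expectation (\<lambda>\<omega>. (gap t \<omega>)\<^sup>2) / (2 * (radius P)\<^sup>2))"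
    by (simp add: A_def A_coef_def)
  moreover have "g - A * g\<^sup>2 \<le> u / (1 + A * u)"
  proof -
    have p: "0 < 1 + A * g" "0 < 1 + A * u" using A0 g0 gu by (auto intro!: add_pos_nonneg)
    have "(g - A * g\<^sup>2) * (1 + A * g) = g - A\<^sup>2 * g ^ 3"
      by (simp add: algebra_simps power2_eq_square power3_eq_cube)
    also have "\<dots> \<le> g" using g0 by simp
    finally have "g - A * g\<^sup>2 \<le> g / (1 + A * g)" using p by (simp add: pos_le_divide_eq)
    also have "\<dots> \<le> u / (1 + A * u)"
    proof -
      have "g * (1 + A * u) \<le> u * (1 + A * g)" using gu by (simp add: algebra_simps)
      then have "g * (1 + A * u) / (1 + A * g) \<le> u" using p by (simp add: pos_divide_le_eq)
      then show ?thesis by (simp add: pos_le_divide_eq[OF p(2)])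
    qed
    finally show ?thesis .
  qed
  ultimately show ?thesis unfolding T_map_def A_def[symmetric] g_def[symmetric] by linarith
qed

lemma expected_gap_Suc_le: "expectation (gap (Suc t)) \<le> J_id P (w t) (\<theta> t) u chi"
proof -
  let ?b = "\<lambda>i \<omega>. bias i t \<omega> + grad_shift i t \<omega>"
  let ?R = "\<lambda>\<omega>. (gap t \<omega>)\<^sup>2 / (2 * (radius P)\<^sup>2)"
  have bI: "integrable M (\<lambda>\<omega>. (norm (?b i \<omega>))\<^sup>2)" if "i < n" for i
    by (intro sq_integrableD(2) sq_integrable_add sq_integrable_bias sq_integrable_grad_shift e_sq that)
  have b_le: "(\<integral>\<omega>. (norm (?b i \<omega>))\<^sup>2 \<partial>M) \<le> 8 * chi + 2 * (L\<^sup>2 * drift_bound i t u chi)" if i: "i < n" for i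
  proof -
    note I1 = sq_integrableD(2)[OF sq_integrable_bias[OF e_sq i]]
    note I2 = sq_integrableD(2)[OF sq_integrable_grad_shift[OF i]]
    have "(\<integral>\<omega>. (norm (?b i \<omega>))\<^sup>2 \<partial>M)
        \<le> (\<integral>\<omega>. 2 * (norm (bias i t \<omega>))\<^sup>2 + 2 * (norm (grad_shift i t \<omega>))\<^sup>2 \<partial>M)"
      using I1 I2 bI[OF i] by (intro integral_mono norm_add_sq_le) auto
    also have "\<dots> = 2 * (\<integral>\<omega>. (norm (bias i t \<omega>))\<^sup>2 \<partial>M) + 2 * (\<integral>\<omega>. (norm (grad_shift i t \<omega>))\<^sup>2 \<partial>M)"
      using I1 I2 by simp
    finally show ?thesis using bias_sq_le[OF e_sq e_le i] grad_shift_le[OF i] by linarith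
  qed
  have RI: "integrable M ?R" using gap_sq_integrable by simp
  have tI: "integrable M (\<lambda>\<omega>. w t i * (\<theta> t i / L * ((norm (?b i \<omega>))\<^sup>2 - ?R \<omega>)))" if "i < n" for i
    by (intro integrable_mult_right Bochner_Integration.integrable_diff bI that RI)
  have sI: "integrable M (\<lambda>\<omega>. \<Sum>i<n. w t i * (\<theta> t i / L * ((norm (?b i \<omega>))\<^sup>2 - ?R \<omega>)))"
    using tI by (intro Bochner_Integration.integrable_sum) auto
  have cI: "integrable M (\<lambda>\<omega>. gF (x t \<omega>) \<bullet> round_noise t \<omega>)"
    by (rule sq_integrable_inner[OF sq_integrable_gF_x sq_integrable_round_noise])
  have nI: "integrable M (\<lambda>\<omega>. L * (norm (round_noise t \<omega>))\<^sup>2)"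
    by (intro integrable_mult_right sq_integrableD(2)[OF sq_integrable_round_noise])
  have "expectation (gap (Suc t)) \<le> (\<integral>\<omega>. gap t \<omega> - gF (x t \<omega>) \<bullet> round_noise t \<omega>
      + L * (norm (round_noise t \<omega>))\<^sup>2 + (\<Sum>i<n. w t i * (\<theta> t i / L * ((norm (?b i \<omega>))\<^sup>2 - ?R \<omega>))) \<partial>M)"
  proof (rule integral_mono_AE[OF gap_integrable])
    show "integrable M (\<lambda>\<omega>. gap t \<omega> - gF (x t \<omega>) \<bullet> round_noise t \<omega>
      + L * (norm (round_noise t \<omega>))\<^sup>2 + (\<Sum>i<n. w t i * (\<theta> t i / L * ((norm (?b i \<omega>))\<^sup>2 - ?R \<omega>))))"
      by (intro Bochner_Integration.integrable_add Bochner_Integration.integrable_diff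
          gap_integrable cI nI sI)
    show "AE \<omega> in M. gap (Suc t) \<omega> \<le> gap t \<omega> - gF (x t \<omega>) \<bullet> round_noise t \<omega>
      + L * (norm (round_noise t \<omega>))\<^sup>2 + (\<Sum>i<n. w t i * (\<theta> t i / L * ((norm (?b i \<omega>))\<^sup>2 - ?R \<omega>)))"
      using AE_x_ball[of t] AE_space by eventually_elim (rule gap_Suc_le)
  qed
  also have "\<dots> = expectation (gap t) - (\<integral>\<omega>. gF (x t \<omega>) \<bullet> round_noise t \<omega> \<partial>M)
      + (\<integral>\<omega>. L * (norm (round_noise t \<omega>))\<^sup>2 \<partial>M)
      + (\<integral>\<omega>. (\<Sum>i<n. w t i * (\<theta> t i / L * ((norm (?b i \<omega>))\<^sup>2 - ?R \<omega>))) \<partial>M)"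
    using cI nI sI gap_integrable[of t]
    by (simp only: Bochner_Integration.integral_add Bochner_Integration.integral_diff
        Bochner_Integration.integrable_add Bochner_Integration.integrable_diff)
  also have "\<dots> = expectation (gap t) + L * (\<integral>\<omega>. (norm (round_noise t \<omega>))\<^sup>2 \<partial>M)
      + (\<Sum>i<n. w t i * (\<theta> t i / L * ((\<integral>\<omega>. (norm (?b i \<omega>))\<^sup>2 \<partial>M)
          - expectation (\<lambda>\<omega>. (gap t \<omega>)\<^sup>2) / (2 * (radius P)\<^sup>2))))"
  proof -
    have "(\<integral>\<omega>. (\<Sum>i<n. w t i * (\<theta> t i / L * ((norm (?b i \<omega>))\<^sup>2 - ?R \<omega>))) \<partial>M)
        = (\<Sum>i<n. \<integral>\<omega>. w t i * (\<theta> t i / L * ((norm (?b i \<omega>))\<^sup>2 - ?R \<omega>)) \<partial>M)"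
      using tI by (intro Bochner_Integration.integral_sum) auto
    also have "\<dots> = (\<Sum>i<n. w t i * (\<theta> t i / L * ((\<integral>\<omega>. (norm (?b i \<omega>))\<^sup>2 \<partial>M)
          - expectation (\<lambda>\<omega>. (gap t \<omega>)\<^sup>2) / (2 * (radius P)\<^sup>2))))"
    proof (intro sum.cong refl)
      fix i assume "i \<in> {..<n}"
      then show "(\<integral>\<omega>. w t i * (\<theta> t i / L * ((norm (?b i \<omega>))\<^sup>2 - ?R \<omega>)) \<partial>M)
        = w t i * (\<theta> t i / L * ((\<integral>\<omega>. (norm (?b i \<omega>))\<^sup>2 \<partial>M)
          - expectation (\<lambda>\<omega>. (gap t \<omega>)\<^sup>2) / (2 * (radius P)\<^sup>2)))"
        using bI[of i] RI
        by (simp only: integral_mult_right_zero Bochner_Integration.integral_diff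
            integral_divide_zero lessThan_iff)
    qed
    finally show ?thesis by (simp add: round_noise_orthogonal)
  qed
  also have "\<dots> \<le> expectation (gap t) + (\<Sum>i<n. (w t i)\<^sup>2 * (L / 2 * kappa P i (\<theta> t i) u chi))
      + (\<Sum>i<n. w t i * (T_map (A_coef P (\<theta> t i)) u - expectation (gap t) + rho P i (\<theta> t i) u chi))"
  proof (intro add_mono order_refl)
    show "L * (\<integral>\<omega>. (norm (round_noise t \<omega>))\<^sup>2 \<partial>M) \<le> (\<Sum>i<n. (w t i)\<^sup>2 * (L / 2 * kappa P i (\<theta> t i) u chi))"
    proof -
      have "(\<Sum>i<n. (w t i)\<^sup>2 * ((\<theta> t i)\<^sup>2 / L * noise_level i))
          \<le> (\<Sum>i<n. (w t i)\<^sup>2 * (L / 2 * kappa P i (\<theta> t i) u chi))"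
        by (intro sum_mono mult_left_mono noise_budget) (simp_all only: lessThan_iff zero_le_power2)
      then show ?thesis using round_noise_sq_le[of t] by linarith
    qed
    show "(\<Sum>i<n. w t i * (\<theta> t i / L * ((\<integral>\<omega>. (norm (?b i \<omega>))\<^sup>2 \<partial>M)
          - expectation (\<lambda>\<omega>. (gap t \<omega>)\<^sup>2) / (2 * (radius P)\<^sup>2))))
      \<le> (\<Sum>i<n. w t i * (T_map (A_coef P (\<theta> t i)) u - expectation (gap t) + rho P i (\<theta> t i) u chi))"
    proof (intro sum_mono mult_left_mono)
      fix i assume "i \<in> {..<n}"
      then have i: "i < n" by simp
      have "\<theta> t i / L * (\<integral>\<omega>. (norm (?b i \<omega>))\<^sup>2 \<partial>M)
          \<le> \<theta> t i / L * (8 * chi + 2 * (L\<^sup>2 * drift_bound i t u chi))"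
        using b_le[OF i] \<theta>_pos[OF i, of t] L_pos by (intro mult_left_mono) auto
      then show "\<theta> t i / L * ((\<integral>\<omega>. (norm (?b i \<omega>))\<^sup>2 \<partial>M)
          - expectation (\<lambda>\<omega>. (gap t \<omega>)\<^sup>2) / (2 * (radius P)\<^sup>2))
          \<le> T_map (A_coef P (\<theta> t i)) u - expectation (gap t) + rho P i (\<theta> t i) u chi"
        using node_budget[OF i] contraction_step[OF i] unfolding right_diff_distrib by linarith
    qed (simp add: w_nonneg)
  qed
  also have "\<dots> = J_id P (w t) (\<theta> t) u chi"
  proof -
    have "(\<Sum>i<n. w t i * (T_map (A_coef P (\<theta> t i)) u - expectation (gap t) + rho P i (\<theta> t i) u chi))
        = (\<Sum>i<n. w t i * T_map (A_coef P (\<theta> t i)) u) - expectation (gap t)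
          + (\<Sum>i<n. w t i * rho P i (\<theta> t i) u chi)"
      using w_sum[of t]
      by (simp add: distrib_left right_diff_distrib sum.distrib sum_subtractf flip: sum_distrib_right)
    then show ?thesis
      unfolding J_id_eq by (simp add: sum_distrib_left mult.left_commute)
  qed
  finally show ?thesis .
qed

end

section \<open>Scalar recursions\<close>

text \<open>The excess over the fixed point \<open>m\<close> of \<open>z \<mapsto> z - a z\<^sup>2 + \<beta> z + d\<close> satisfies \<open>\<epsilon>' \<le> \<epsilon> - a \<epsilon>\<^sup>2 \<le> \<epsilon> / (1 + a \<epsilon>)\<close>,
so that its reciprocal grows by at least \<open>a\<close> in each step. The hypothesis \<open>2 a m \<le> 1 + \<beta>\<close> says that the map is
increasing on \<open>(-\<infinity>, m]\<close>; it prevents iterates below \<open>m\<close> from jumping above \<open>m\<close>.\<close>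

lemma quadratic_recursion_bound:
  fixes u :: "nat \<Rightarrow> real"
  assumes a: "0 < a" and \<beta>: "0 \<le> \<beta>" and d: "0 \<le> d"
    and step: "\<And>t. u (Suc t) \<le> u t - a * (u t)\<^sup>2 + \<beta> * u t + d"
    and m: "m = (\<beta> + sqrt (\<beta>\<^sup>2 + 4 * a * d)) / (2 * a)" and small: "2 * a * m \<le> 1 + \<beta>"
  defines "E \<equiv> max (u 0 - m) 0"
  shows "max (u T - m) 0 \<le> E / (1 + a * real T * E)"
proof (induction T)
  case (Suc T)
  define \<epsilon> where "\<epsilon> = max (u T - m) 0"
  have E0: "0 \<le> E" by (simp add: E_def)
  have root: "2 * a * m - \<beta> = sqrt (\<beta>\<^sup>2 + 4 * a * d)" using a m by simp
  have ad: "0 \<le> a * d" using a d by simp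
  have "(2 * a * m - \<beta>)\<^sup>2 = \<beta>\<^sup>2 + 4 * a * d"
    unfolding root using ad by (simp add: real_sqrt_pow2)
  then have "4 * a * (a * m\<^sup>2 - \<beta> * m - d) = 0" by (simp add: power2_eq_square algebra_simps)
  then have fixed: "a * m\<^sup>2 = \<beta> * m + d" using a by simp
  have ge: "\<beta> \<le> 2 * a * m"
  proof -
    have "0 \<le> sqrt (\<beta>\<^sup>2 + 4 * a * d)" using ad by (simp add: mult.assoc)
    then show ?thesis using root by linarith
  qed
  define z where "z = u T - m"
  have "u (Suc T) - m \<le> z * (1 + \<beta> - 2 * a * m) - a * z\<^sup>2"
    using step[of T] fixed by (simp add: z_def power2_eq_square algebra_simps)
  also have "\<dots> \<le> \<epsilon> - a * \<epsilon>\<^sup>2"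
  proof (cases "0 \<le> z")
    case True
    have "z * (1 + \<beta> - 2 * a * m) \<le> z * 1" using True ge by (intro mult_left_mono) auto
    then show ?thesis using True by (simp add: \<epsilon>_def z_def)
  next
    case False
    have "z * (1 + \<beta> - 2 * a * m) \<le> 0" using False small by (simp add: mult_nonpos_nonneg)
    moreover have "0 \<le> a * z\<^sup>2" using a by simp
    ultimately show ?thesis using False by (simp add: \<epsilon>_def z_def)
  qed
  finally have s1: "u (Suc T) - m \<le> \<epsilon> - a * \<epsilon>\<^sup>2" .
  have e0: "0 \<le> \<epsilon>" by (simp add: \<epsilon>_def)
  have p: "0 < 1 + a * \<epsilon>" using a e0 by (simp add: add_pos_nonneg)
  have "(\<epsilon> - a * \<epsilon>\<^sup>2) * (1 + a * \<epsilon>) = \<epsilon> - a\<^sup>2 * \<epsilon> ^ 3"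
    by (simp add: power2_eq_square power3_eq_cube algebra_simps)
  also have "\<dots> \<le> \<epsilon>" using e0 by simp
  finally have "\<epsilon> - a * \<epsilon>\<^sup>2 \<le> \<epsilon> / (1 + a * \<epsilon>)" using p by (simp add: pos_le_divide_eq)
  moreover have "0 \<le> \<epsilon> / (1 + a * \<epsilon>)" using e0 p by simp
  ultimately have s2: "max (u (Suc T) - m) 0 \<le> \<epsilon> / (1 + a * \<epsilon>)" using s1 by simp
  define F where "F = E / (1 + a * real T * E)"
  have q: "0 < 1 + a * real T * E" using a E0 by (simp add: add_pos_nonneg)
  have F0: "0 \<le> F" using E0 q by (simp add: F_def)
  have IH: "\<epsilon> \<le> F" using Suc by (simp add: \<epsilon>_def F_def)
  have pF: "0 < 1 + a * F" using a F0 by (simp add: add_pos_nonneg)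
  have "\<epsilon> * (1 + a * F) \<le> F * (1 + a * \<epsilon>)" using IH by (simp add: algebra_simps)
  then have "\<epsilon> * (1 + a * F) / (1 + a * \<epsilon>) \<le> F" using p by (simp add: pos_divide_le_eq)
  then have "\<epsilon> / (1 + a * \<epsilon>) \<le> F / (1 + a * F)" by (simp add: pos_le_divide_eq[OF pF])
  also have "\<dots> = E / (1 + a * real (Suc T) * E)"
  proof -
    have "1 + a * F = (1 + a * real (Suc T) * E) / (1 + a * real T * E)"
      using q unfolding F_def by (simp add: field_simps)
    then show ?thesis using q by (simp add: F_def)
  qed
  finally show ?case using s2 by linarith
qed (simp add: E_def)

text \<open>Under the conventions \<open>1 / 0 = \<infinity>\<close> and \<open>1 / \<infinity> = 0\<close> the two-fold reciprocal is an ordinary quotient, also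
for \<open>v = 0\<close>.\<close>

lemma ereal_inverse_add:
  fixes v k :: real
  assumes "0 \<le> v" "0 \<le> k"
  shows "1 / (inverse (ereal v) + ereal k) = ereal (v / (1 + k * v))"
proof (cases "v = 0")
  case False
  then have "0 < v" using assms by simp
  then have "1 / (1 / v + k) = v / (1 + k * v)" "0 < 1 / v + k"
    using assms by (auto simp: field_simps add_pos_nonneg)
  then show ?thesis using \<open>0 < v\<close>
    by (simp add: divide_ereal_def one_ereal_def inverse_eq_divide)
qed (simp add: zero_ereal_def[symmetric])

section \<open>Comparison with a fixed pair and validity of the controller\<close>

context hew_run
begin

lemma rho_le:
  assumes i: "i < n" and th: "0 < th" "th \<le> \<theta>hi" and u: "0 \<le> u" and chi: "0 \<le> chi"
  shows "rho P i th u chi \<le> 96 * (th\<^sup>2 * u) + 256 / L * (th * chi) + 32 / L * (th\<^sup>2 * noise_level i)"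
proof -
  have th1: "th \<le> 1" using th amplitudes by linarith
  have ex: "exp (2 * th) \<le> 3" using th \<theta>hi_small by (intro exp_le_3) auto
  have t32: "th ^ 3 \<le> th\<^sup>2" using th th1 by (intro power_decreasing) auto
  have t31: "th ^ 3 \<le> th" using th th1 power_decreasing[of 1 3 th] by simp
  have e2: "exp (2 * th) * th ^ 3 \<le> 3 * th\<^sup>2" using ex t32 th by (intro mult_mono) auto
  have e1: "exp (2 * th) * th ^ 3 \<le> 3 * th" using ex t31 th by (intro mult_mono) auto
  have nl: "0 \<le> noise_level i" by (rule noise_level_nonneg[OF i])
  define E where "E = exp (2 * th) * th ^ 3"
  have "rho P i th u chi = 32 * (E * u) + (16 * th + 64 * E) * (chi / L) + 8 * (E * (noise_level i / L))"
    by (simp add: rho_def E_def noise_level_def mult_ac)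
  also have "\<dots> \<le> 32 * (3 * th\<^sup>2 * u) + (16 * th + 64 * (3 * th)) * (chi / L) + 8 * (3 * th\<^sup>2 * (noise_level i / L))"
    using e1 e2 u chi nl L_pos unfolding E_def[symmetric]
    by (intro add_mono mult_left_mono mult_right_mono) auto
  also have "\<dots> = 96 * (th\<^sup>2 * u) + 208 * (th * chi / L) + 24 * (th\<^sup>2 * noise_level i / L)"
    by (simp add: algebra_simps add_divide_distrib)
  also have "\<dots> \<le> 96 * (th\<^sup>2 * u) + 256 * (th * chi / L) + 32 * (th\<^sup>2 * noise_level i / L)"
    using th u chi nl L_pos by (intro add_mono mult_right_mono) auto
  finally show ?thesis by simp
qed

lemma kappa_le:
  assumes i: "i < n" and th: "0 < th" "th \<le> \<theta>hi" and u: "0 \<le> u" and chi: "0 \<le> chi"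
  shows "L / 2 * kappa P i th u chi
    \<le> 32 * (th ^ 4 * u) + 64 / L * (th ^ 4 * chi) + 16 / L * (th\<^sup>2 * noise_level i)"
proof -
  have th1: "th \<le> 1" using th amplitudes by linarith
  have ex: "exp (2 * th) \<le> 3" using th \<theta>hi_small by (intro exp_le_3) auto
  have t42: "th ^ 4 \<le> th\<^sup>2" using th th1 by (intro power_decreasing) auto
  have nl: "0 \<le> noise_level i" by (rule noise_level_nonneg[OF i])
  define E where "E = exp (2 * th) * th ^ 4"
  have e4: "E \<le> 3 * th ^ 4" unfolding E_def using ex th by (intro mult_right_mono) auto
  have "L / 2 * kappa P i th u chi
      = 8 * (E * u) + 16 * (E * (chi / L)) + (th\<^sup>2 + 2 * E) * (noise_level i / L)"
    using L_pos H_pos[OF i] batch_pos[OF i]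
    by (simp add: kappa_def E_def noise_level_def field_simps power2_eq_square)
  also have "\<dots> \<le> 8 * (3 * th ^ 4 * u) + 16 * (3 * th ^ 4 * (chi / L)) + (th\<^sup>2 + 6 * th\<^sup>2) * (noise_level i / L)"
    using e4 t42 u chi nl L_pos
    by (intro add_mono mult_left_mono mult_right_mono) auto
  also have "\<dots> = 24 * (th ^ 4 * u) + 48 * (th ^ 4 * chi / L) + 7 * (th\<^sup>2 * noise_level i / L)"
    by (simp add: algebra_simps add_divide_distrib)
  also have "\<dots> \<le> 32 * (th ^ 4 * u) + 64 * (th ^ 4 * chi / L) + 16 * (th\<^sup>2 * noise_level i / L)"
    using th u chi nl L_pos by (intro add_mono mult_right_mono) auto
  finally show ?thesis by simp
qed

text \<open>The constraint \<open>u \<le> fbar P\<close> gives \<open>A u \<le> th / 4\<close> for \<open>A = A_coef P th\<close>.\<close>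

lemma s_gain_ge:
  assumes th: "0 < th" and u: "0 \<le> u" "u \<le> fbar P"
  shows "th / (2 * L * (radius P)\<^sup>2 * (1 + th / 4)) * u\<^sup>2 \<le> s_gain P th u"
proof -
  define A where "A = A_coef P th"
  have A0: "0 \<le> A" using th L_pos R_pos by (simp add: A_def A_coef_def)
  have "A * u \<le> A * fbar P" using A0 u by (intro mult_left_mono)
  also have "\<dots> = th / 4" using L_pos R_pos by (simp add: A_def A_coef_def fbar_def)
  finally have Au: "A * u \<le> th / 4" .
  have p: "0 < 1 + A * u" using A0 u by (simp add: add_pos_nonneg)
  have "th / (2 * L * (radius P)\<^sup>2 * (1 + th / 4)) * u\<^sup>2 = A * u\<^sup>2 / (1 + th / 4)"
    by (simp add: A_def A_coef_def)
  also have "\<dots> \<le> A * u\<^sup>2 / (1 + A * u)"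
    using A0 Au p th by (intro divide_left_mono) auto
  also have "\<dots> = u - u / (1 + A * u)"
    using p by (simp add: field_simps power2_eq_square)
  finally show ?thesis by (simp add: s_gain_def T_map_def A_def)
qed

text \<open>The bounds on gain, bias and variance for the comparator amplitudes, averaged with the comparator
weights.\<close>

lemma comparator_value_le:
  assumes feas: "feasible P \<theta>lo \<theta>hi (wb, \<theta>b)" and u: "0 \<le> u" "u \<le> fbar P" and chi: "0 \<le> chi"
  shows "J_id P wb \<theta>b u chi \<le> u - a_cvx P wb \<theta>b * u\<^sup>2 + beta_cvx P wb \<theta>b * u
    + gamma_cvx P wb \<theta>b * chi + delta_cvx P wb \<theta>b"
proof -
  have wb: "0 \<le> wb i" and th: "0 < \<theta>b i" "\<theta>b i \<le> \<theta>hi" if "i < n" for i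
    using feas that amplitudes by (auto simp: feasible_def)
  let ?a = "\<lambda>i. \<theta>b i / (2 * L * (radius P)\<^sup>2 * (1 + \<theta>b i / 4))"
  have "J_id P wb \<theta>b u chi
      = u + (\<Sum>i<n. wb i * (rho P i (\<theta>b i) u chi - s_gain P (\<theta>b i) u))
        + (\<Sum>i<n. (wb i)\<^sup>2 * (L / 2 * kappa P i (\<theta>b i) u chi))"
    by (simp add: J_id_def mu_def right_diff_distrib sum_subtractf sum_distrib_left mult.left_commute)
  also have "\<dots> \<le> u
      + (\<Sum>i<n. wb i * (96 * ((\<theta>b i)\<^sup>2 * u) + 256 / L * (\<theta>b i * chi)
          + 32 / L * ((\<theta>b i)\<^sup>2 * noise_level i) - ?a i * u\<^sup>2))
      + (\<Sum>i<n. (wb i)\<^sup>2 * (32 * ((\<theta>b i) ^ 4 * u) + 64 / L * ((\<theta>b i) ^ 4 * chi)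
          + 16 / L * ((\<theta>b i)\<^sup>2 * noise_level i)))"
    using wb th u chi
    by (intro add_mono order_refl sum_mono mult_left_mono diff_mono rho_le kappa_le s_gain_ge) auto
  also have "\<dots> = u - a_cvx P wb \<theta>b * u\<^sup>2 + beta_cvx P wb \<theta>b * u
    + gamma_cvx P wb \<theta>b * chi + delta_cvx P wb \<theta>b"
  proof -
    have 1: "(\<Sum>i<n. wb i * (96 * ((\<theta>b i)\<^sup>2 * u) + 256 / L * (\<theta>b i * chi)
          + 32 / L * ((\<theta>b i)\<^sup>2 * noise_level i) - ?a i * u\<^sup>2))
        = 96 * (\<Sum>i<n. wb i * (\<theta>b i)\<^sup>2) * u + 256 / L * (\<Sum>i<n. wb i * \<theta>b i) * chi
          + 32 / L * (\<Sum>i<n. wb i * (\<theta>b i)\<^sup>2 * noise_level i) - (\<Sum>i<n. wb i * ?a i) * u\<^sup>2"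
      unfolding sum_distrib_left sum_distrib_right sum.distrib[symmetric] sum_subtractf[symmetric]
      by (intro sum.cong refl) (simp only: distrib_left right_diff_distrib mult_ac)
    have 2: "(\<Sum>i<n. (wb i)\<^sup>2 * (32 * ((\<theta>b i) ^ 4 * u) + 64 / L * ((\<theta>b i) ^ 4 * chi)
          + 16 / L * ((\<theta>b i)\<^sup>2 * noise_level i)))
        = 32 * (\<Sum>i<n. (wb i)\<^sup>2 * (\<theta>b i) ^ 4) * u + 64 / L * (\<Sum>i<n. (wb i)\<^sup>2 * (\<theta>b i) ^ 4) * chi
          + 16 / L * (\<Sum>i<n. (wb i)\<^sup>2 * (\<theta>b i)\<^sup>2 * noise_level i)"
      unfolding sum_distrib_left sum_distrib_right sum.distrib[symmetric]
      by (intro sum.cong refl) (simp only: distrib_left mult_ac)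
    show ?thesis
      unfolding 1 2
      unfolding a_cvx_def beta_cvx_def gamma_cvx_def delta_cvx_def noise_level_def
      by (simp only: distrib_right)
  qed
  finally show ?thesis .
qed

lemma comparator_coefficients:
  assumes feas: "feasible P \<theta>lo \<theta>hi (wb, \<theta>b)"
  shows "0 < a_cvx P wb \<theta>b" "0 \<le> beta_cvx P wb \<theta>b" "0 \<le> gamma_cvx P wb \<theta>b" "0 \<le> delta_cvx P wb \<theta>b"
proof -
  have wb: "0 \<le> wb i" and th: "0 < \<theta>b i" if "i < n" for i
    using feas that amplitudes by (auto simp: feasible_def)
  have nl: "0 \<le> vsq P i / (real (H i) * real (batch P i))" if "i < n" for i
    using noise_level_nonneg[OF that] by (simp add: noise_level_def)
  have pos: "0 < \<theta>b i / (2 * L * (radius P)\<^sup>2 * (1 + \<theta>b i / 4))" if "i < n" for i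
    using th[OF that] L_pos R_pos by (intro divide_pos_pos mult_pos_pos) (auto intro: add_pos_pos)
  have "(\<Sum>i<n. wb i) = 1" using feas by (simp add: feasible_def)
  then obtain j where j: "j < n" "wb j \<noteq> 0"
    by (metis lessThan_iff sum.neutral zero_neq_one)
  show "0 < a_cvx P wb \<theta>b"
    unfolding a_cvx_def
  proof (rule sum_pos2)
    show "j \<in> {..<n}" using j by simp
    show "0 < wb j * (\<theta>b j / (2 * L * (radius P)\<^sup>2 * (1 + \<theta>b j / 4)))"
      using wb[OF j(1)] j pos[OF j(1)] by (intro mult_pos_pos) auto
    show "0 \<le> wb i * (\<theta>b i / (2 * L * (radius P)\<^sup>2 * (1 + \<theta>b i / 4)))" if "i \<in> {..<n}" for i
      using that by (intro mult_nonneg_nonneg wb less_imp_le[OF pos]) auto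
  qed simp
  show "0 \<le> beta_cvx P wb \<theta>b"
    unfolding beta_cvx_def using wb th
    by (intro add_nonneg_nonneg mult_nonneg_nonneg sum_nonneg) auto
  show "0 \<le> gamma_cvx P wb \<theta>b"
    unfolding gamma_cvx_def using wb th L_pos
    by (intro add_nonneg_nonneg mult_nonneg_nonneg sum_nonneg) (auto intro: less_imp_le)
  show "0 \<le> delta_cvx P wb \<theta>b"
    unfolding delta_cvx_def using wb th L_pos nl
    by (intro add_nonneg_nonneg mult_nonneg_nonneg sum_nonneg) (auto intro: less_imp_le)
qed

text \<open>The scalar recursion of the controller bounds the expected suboptimality and the control-variate
errors of the run in every round. The cap at \<open>fbar P\<close> is harmless because the run stays in the trust ball.\<close>

lemma controller_certificate:
  fixes u chi :: "nat \<Rightarrow> real"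
  assumes u0: "expectation (gap 0) \<le> u 0"
    and e0: "\<And>i. i < n \<Longrightarrow> integrable M (\<lambda>\<omega>. (norm (e i 0 \<omega>))\<^sup>2)"
    and chi0: "\<And>i. i < n \<Longrightarrow> (\<integral>\<omega>. (norm (e i 0 \<omega>))\<^sup>2 \<partial>M) \<le> chi 0"
    and u_Suc: "\<And>t. u (Suc t) = min (fbar P) (J_id P (w t) (\<theta> t) (u t) (chi t))"
    and chi_Suc: "\<And>t. chi (Suc t) = A_chi P + B_chi P \<theta>hi * u t + C_chi \<theta>hi * chi t"
  shows "expectation (gap t) \<le> u t" "0 \<le> chi t"
proof -
  have inv: "hew_round M P B x y c cs w \<theta> \<theta>lo \<theta>hi t (u t) (chi t)" for t
  proof (induction t)
    case 0
    have "sq_integrable M (e i 0)" if "i < n" for i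
      using e0[OF that] rh_M[OF e_meas[OF that]] by (simp add: sq_integrable_def)
    then show ?case
      using u0 chi0 by unfold_locales auto
  next
    case (Suc t)
    interpret hew_round M P B x y c cs w \<theta> \<theta>lo \<theta>hi t "u t" "chi t" by (rule Suc)
    define V where "V = (MAX i\<in>{..<n}. noise_level i)"
    have V: "noise_level j \<le> V" if "j < n" for j
      unfolding V_def using that by (intro Max_ge) auto
    have chi: "chi (Suc t) = 6 * V + 144 * L * \<theta>hi\<^sup>2 * u t + 288 * \<theta>hi\<^sup>2 * chi t"
      by (simp add: chi_Suc A_chi_def B_chi_def C_chi_def V_def noise_level_def)
    show ?case
    proof unfold_locales
      show "expectation (gap (Suc t)) \<le> u (Suc t)"
        using expected_gap_Suc_le expected_gap_bounds(2)[of "Suc t"] by (simp add: u_Suc)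
      show "sq_integrable M (e j (Suc t))" if "j < n" for j
        by (rule sq_integrable_e_Suc[OF that])
      show "(\<integral>\<omega>. (norm (e j (Suc t) \<omega>))\<^sup>2 \<partial>M) \<le> chi (Suc t)" if "j < n" for j
        unfolding chi by (rule next_error_le[OF that V])
    qed
  qed
  show "expectation (gap t) \<le> u t" by (rule hew_round.gap_le[OF inv])
  show "0 \<le> chi t" by (rule hew_round.chi_nonneg[OF inv])
qed

end

theorem theoremB14:
  fixes P :: "(real ^ 'd) fed_problem"
    and M :: "'w measure"
    and B :: "nat \<Rightarrow> nat \<Rightarrow> nat \<Rightarrow> 'w \<Rightarrow> nat set"
    and x :: "nat \<Rightarrow> 'w \<Rightarrow> real ^ 'd"
    and y :: "nat \<Rightarrow> nat \<Rightarrow> nat \<Rightarrow> 'w \<Rightarrow> real ^ 'd"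
    and c :: "nat \<Rightarrow> nat \<Rightarrow> 'w \<Rightarrow> real ^ 'd"
    and cs :: "nat \<Rightarrow> 'w \<Rightarrow> real ^ 'd"
    and w \<theta> :: "nat \<Rightarrow> nat \<Rightarrow> real"
    and u chi :: "nat \<Rightarrow> real"
    and \<theta>lo \<theta>hi :: real
    and wb \<theta>b :: "nat \<Rightarrow> real"
  defines "g \<equiv> (\<lambda>t. \<integral>\<omega>. (global_obj P (x t \<omega>) - global_obj P (minimizer P)) \<partial>M)"
    and "\<G> \<equiv> local_history P M (x 0) (\<lambda>i. c i 0) B"
    and "sg \<equiv> (\<lambda>i t l \<omega>. minibatch_grad P i (B i t l \<omega>) (y i t l \<omega>))"
    and "a \<equiv> a_cvx P wb \<theta>b"
    and "\<beta> \<equiv> beta_cvx P wb \<theta>b"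
    and "\<gamma> \<equiv> gamma_cvx P wb \<theta>b"
    and "\<delta> \<equiv> delta_cvx P wb \<theta>b"
    and "chibar \<equiv> chi_bar P \<theta>hi (chi 0)"
    and "d \<equiv> d_cvx P wb \<theta>b \<theta>hi (chi 0)"
    and "m \<equiv> m_cvx P wb \<theta>b \<theta>hi (chi 0)"
  assumes problem: "convex_smooth_problem P"
    and amplitudes: "0 < \<theta>lo" "\<theta>lo \<le> \<theta>hi" "\<theta>hi \<le> 1"
    and contraction: "C_chi \<theta>hi < 1"
    and prob: "prob_space M"
    and initial_measurable: "x 0 \<in> borel_measurable M"
      "\<And>i. i < nodes P \<Longrightarrow> c i 0 \<in> borel_measurable M"
    and minibatch_measurable: "\<And>i t l. i < nodes P \<Longrightarrow> l < horizon P i \<Longrightarrow>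
      B i t l \<in> M \<rightarrow>\<^sub>M count_space (Pow {..<samples P i})"
    and minibatch_size: "\<And>i t l \<omega>. i < nodes P \<Longrightarrow> l < horizon P i \<Longrightarrow> \<omega> \<in> space M \<Longrightarrow>
      card (B i t l \<omega>) = batch P i"
    and algorithm: "\<And>\<omega>. \<omega> \<in> space M \<Longrightarrow>
      hew_local_sgd P w \<theta> (\<lambda>i t l. B i t l \<omega>) (\<lambda>t. x t \<omega>) (\<lambda>i t l. y i t l \<omega>)
        (\<lambda>i t. c i t \<omega>) (\<lambda>t. cs t \<omega>)"
    and in_ball: "AE \<omega> in M. \<forall>t. x t \<omega> \<in> trust_ball P \<and>
      (\<forall>i<nodes P. \<forall>l\<le>horizon P i. y i t l \<omega> \<in> trust_ball P)"
    and independent: "\<And>i t l. i < nodes P \<Longrightarrow> l < horizon P i \<Longrightarrow>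
      cond_indep_discrete M (\<G> i t l) (\<lambda>(j, k). B j t k) {(j, k). j < nodes P \<and> k < horizon P j}"
    and unbiased: "\<And>i t l. i < nodes P \<Longrightarrow> l < horizon P i \<Longrightarrow>
      AE \<omega> in M. vec_cond_exp M (\<G> i t l) (sg i t l) \<omega> = grad (node_obj P i) (y i t l \<omega>)"
    and variance: "\<And>i t l. i < nodes P \<Longrightarrow> l < horizon P i \<Longrightarrow>
      AE \<omega> in M. real_cond_exp M (\<G> i t l)
        (\<lambda>\<omega>'. (norm (sg i t l \<omega>' - grad (node_obj P i) (y i t l \<omega>')))\<^sup>2) \<omega>
        \<le> vsq P i / real (batch P i)"
    and u0: "u 0 \<in> {g 0..fbar P}"
    and chi0_integrable: "\<And>i. i < nodes P \<Longrightarrow>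
      integrable M (\<lambda>\<omega>. (norm (c i 0 \<omega> - grad (node_obj P i) (x 0 \<omega>)))\<^sup>2)"
    and chi0: "(MAX i\<in>{..<nodes P}.
      \<integral>\<omega>. (norm (c i 0 \<omega> - grad (node_obj P i) (x 0 \<omega>)))\<^sup>2 \<partial>M) \<le> chi 0"
    and controller: "exact_controller P \<theta>lo \<theta>hi w \<theta> u chi"
    and comparator: "feasible P \<theta>lo \<theta>hi (wb, \<theta>b)"
  shows "(\<forall>t. u (Suc t) \<le> u t - a * (u t)\<^sup>2 + \<beta> * u t + \<gamma> * chi t + \<delta>) \<and>
    (\<forall>t. chi t \<le> chibar) \<and>
    (\<forall>t. u (Suc t) \<le> u t - a * (u t)\<^sup>2 + \<beta> * u t + d) \<and>
    (2 * a * m \<le> 1 + \<beta> \<longrightarrow>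
      (\<forall>T. g T \<le> u T \<and>
        ereal (u T) \<le> ereal m + 1 / (inverse (ereal (max (u 0 - m) 0)) + ereal (a * real T))) \<and>
      (\<forall>T. g T \<le> u T \<and>
        ereal (u T) \<le> ereal m + 1 / (inverse (ereal (u 0)) + ereal (a * real T))))"
proof -
  interpret prob_space M by (rule prob)
  interpret hew_run M P B x y c cs w \<theta> \<theta>lo \<theta>hi
  proof unfold_locales
    show "feasible P \<theta>lo \<theta>hi (w t, \<theta> t)" for t
      using controller by (simp add: exact_controller_def is_arg_min_def)
  qed (fact problem amplitudes contraction initial_measurable minibatch_measurable algorithm in_ball
      independent[unfolded \<G>_def] unbiased[unfolded \<G>_def sg_def] variance[unfolded \<G>_def sg_def])+
  have u_Suc: "u (Suc t) = min (fbar P) (J_id P (w t) (\<theta> t) (u t) (chi t))"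
    and chi_Suc: "chi (Suc t) = A_chi P + B_chi P \<theta>hi * u t + C_chi \<theta>hi * chi t" for t
    using controller by (auto simp: exact_controller_def)
  have optimal: "J_id P (w t) (\<theta> t) (u t) (chi t) \<le> J_id P wb \<theta>b (u t) (chi t)" for t
    using controller comparator unfolding exact_controller_def is_arg_min_def
    by (auto simp: not_less split: prod.splits)
  have g_gap: "g t = expectation (gap t)" for t
    unfolding g_def gap_def[abs_def] ..
  have e_0: "(\<lambda>\<omega>. (norm (e i 0 \<omega>))\<^sup>2) = (\<lambda>\<omega>. (norm (c i 0 \<omega> - grad (node_obj P i) (x 0 \<omega>)))\<^sup>2)" for i
    by (simp add: e_def)
  have chi0': "(\<integral>\<omega>. (norm (e i 0 \<omega>))\<^sup>2 \<partial>M) \<le> chi 0" if "i < n" for i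
    unfolding e_0 using that by (intro order_trans[OF Max_ge chi0]) auto
  have cert: "g t \<le> u t" and chi_pos: "0 \<le> chi t" for t
  proof -
    have "expectation (gap 0) \<le> u 0" using u0 by (simp add: g_gap)
    moreover have "integrable M (\<lambda>\<omega>. (norm (e i 0 \<omega>))\<^sup>2)" if "i < n" for i
      unfolding e_0 by (rule chi0_integrable[OF that])
    ultimately show "g t \<le> u t" "0 \<le> chi t"
      using controller_certificate[of u chi t, OF _ _ chi0' u_Suc chi_Suc] by (simp_all add: g_gap)
  qed
  have u_nonneg: "0 \<le> u t" for t
    using cert[of t] expected_gap_bounds(1)[of t] by (simp add: g_gap)
  have u_le: "u t \<le> fbar P" for t
    using u0 by (cases t) (auto simp: u_Suc)
  have step: "u (Suc t) \<le> u t - a * (u t)\<^sup>2 + \<beta> * u t + \<gamma> * chi t + \<delta>" for t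
    using comparator_value_le[OF comparator u_nonneg u_le chi_pos, of t t] optimal[of t]
    unfolding u_Suc a_def \<beta>_def \<gamma>_def \<delta>_def by linarith
  have coef: "0 < a" "0 \<le> \<beta>" "0 \<le> \<gamma>" "0 \<le> \<delta>"
    using comparator_coefficients[OF comparator] by (simp_all add: a_def \<beta>_def \<gamma>_def \<delta>_def)
  have chi_le: "chi t \<le> chibar" for t
  proof (induction t)
    case 0
    then show ?case by (simp add: chibar_def chi_bar_def)
  next
    case (Suc t)
    let ?C = "C_chi \<theta>hi"
    have "(A_chi P + B_chi P \<theta>hi * fbar P) / (1 - ?C) \<le> chibar"
      by (simp add: chibar_def chi_bar_def)
    then have "A_chi P + B_chi P \<theta>hi * fbar P \<le> chibar * (1 - ?C)"
      using contraction by (simp add: pos_divide_le_eq)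
    moreover have "B_chi P \<theta>hi * u t \<le> B_chi P \<theta>hi * fbar P"
      using u_le[of t] L_pos by (intro mult_left_mono) (auto simp: B_chi_def)
    moreover have "?C * chi t \<le> ?C * chibar"
      using Suc by (intro mult_left_mono) (auto simp: C_chi_def)
    ultimately show ?case unfolding chi_Suc by (simp add: algebra_simps)
  qed
  have d_eq: "d = \<gamma> * chibar + \<delta>"
    by (simp add: d_def d_cvx_def \<gamma>_def \<delta>_def chibar_def)
  have step': "u (Suc t) \<le> u t - a * (u t)\<^sup>2 + \<beta> * u t + d" for t
    using step[of t] mult_left_mono[OF chi_le[of t] coef(3)] unfolding d_eq by linarith
  have d_pos: "0 \<le> d"
    using coef chi_pos[of 0] chi_le[of 0] unfolding d_eq
    by (intro add_nonneg_nonneg mult_nonneg_nonneg) auto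
  have m_eq: "m = (\<beta> + sqrt (\<beta>\<^sup>2 + 4 * a * d)) / (2 * a)"
    by (simp add: m_def m_cvx_def a_def \<beta>_def d_def)
  have m_pos: "0 \<le> m"
    unfolding m_eq using coef d_pos by (intro divide_nonneg_pos add_nonneg_nonneg) auto
  have final: "ereal (u T) \<le> ereal m + 1 / (inverse (ereal v) + ereal (a * real T))"
    if small: "2 * a * m \<le> 1 + \<beta>" and v: "max (u 0 - m) 0 \<le> v" for T v
  proof -
    let ?E = "max (u 0 - m) 0" and ?k = "a * real T"
    have k: "0 \<le> ?k" using coef by simp
    have E0: "0 \<le> ?E" by simp
    have v0: "0 \<le> v" using v by simp
    have p: "0 < 1 + ?k * ?E" "0 < 1 + ?k * v" using k v0 by (auto intro!: add_pos_nonneg mult_nonneg_nonneg)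
    have "u T - m \<le> ?E / (1 + ?k * ?E)"
      using quadratic_recursion_bound[where u = u, OF coef(1,2) d_pos step' m_eq small, of T] by linarith
    also have "\<dots> \<le> v / (1 + ?k * v)"
    proof -
      have "?E * (1 + ?k * v) \<le> v * (1 + ?k * ?E)" using v by (simp add: algebra_simps)
      then have "?E * (1 + ?k * v) / (1 + ?k * ?E) \<le> v" using p(1) by (simp only: pos_divide_le_eq)
      then show ?thesis by (simp add: pos_le_divide_eq[OF p(2)])
    qed
    finally show ?thesis
      unfolding ereal_inverse_add[OF v0 k] by simp
  qed
  show ?thesis
    by (intro conjI allI impI step chi_le step' cert final) (use u_nonneg[of 0] m_pos in auto)
qed

end
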